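(* Let $F(X,Y)\in\mathbb{Z}[X,Y]$ be a binary form of degree $n\geq 3$ with non-zero discriminant $D(F)$. Let $0<\epsilon<1/n$ and let $S$ be a finite set of primes. For a prime $p$ let $g_p$ be the largest integer $g$ with $p^g\mid D(F)$. Let $s'$ be the number of primes $p\in S$ such that $F(x,y)\equiv 0\pmod{p^{g_p+1}}$ has a solution $(x,y)\in\mathbb{Z}^2_{\rm prim}$, and assume $s'>0$. For $B>0$ let $N(F,S,\epsilon,B)$ be the number of $(x,y)\in\mathbb{Z}^2_{\rm prim}$ with \[ \max(|x|,|y|)\leq B,\quad F(x,y)\neq 0,\quad [F(x,y)]_S\geq |F(x,y)|^{\epsilon}. \] Then there are constants $0<c<C$ depending only on $F,S,\epsilon$ such that for all sufficiently large $B$, \[ c\,B^{2-n\epsilon}(\log B)^{s'-1}\leq N(F,S,\epsilon,B)\leq C\,B^{2-n\epsilon}(\log B)^{s'-1}. \]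
   Context: $\mathbb{Z}^2_{\rm prim}$ is the set of $(x,y)\in\mathbb{Z}^2$ with $\gcd(x,y)=1$. For a finite set of primes $S$ and a non-zero integer $m$, $[m]_S:=\prod_{p\in S}p^{a_p}$, where $p^{a_p}$ is the exact power of $p$ dividing $m$. *)

theory Defs
  imports Complex_Main "HOL-Computational_Algebra.Computational_Algebra" "HOL-Number_Theory.Cong"
begin

text \<open>Elements of \<open>R[X,Y]\<close> are represented as \<open>R poly poly\<close>: the inner variable is \<open>X\<close>, the outer one
  is \<open>Y\<close>, so that \<open>coeff (coeff F j) i\<close> is the coefficient of \<open>X ^ i * Y ^ j\<close>.\<close>

definition eval2 :: "'a::comm_ring_1 poly poly \<Rightarrow> 'a \<Rightarrow> 'a \<Rightarrow> 'a" where
  "eval2 F x y = poly (poly F [:y:]) x"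

definition binary_form :: "nat \<Rightarrow> 'a::zero poly poly \<Rightarrow> bool" where
  "binary_form n F \<longleftrightarrow> F \<noteq> 0 \<and> (\<forall>i j. coeff (coeff F j) i \<noteq> 0 \<longrightarrow> i + j = n)"

text \<open>\<open>lin_form a b\<close> is \<open>a X - b Y\<close>.\<close>

definition lin_form :: "'a::comm_ring_1 \<Rightarrow> 'a \<Rightarrow> 'a poly poly" where
  "lin_form a b = [:[:0, a:], [:- b:]:]"

text \<open>If \<open>F\<close> is the product over \<open>i < n\<close> of the complex linear forms \<open>\<alpha> i X - \<beta> i Y\<close>, its
  discriminant is the product of \<open>(\<alpha> i * \<beta> j - \<alpha> j * \<beta> i) ^ 2\<close> over \<open>i < j < n\<close>. For a
  binary form of degree \<open>n\<close> over the integers such a factorization exists, and the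
  product is an integer that does not depend on the chosen factorization.\<close>

definition form_disc :: "nat \<Rightarrow> int poly poly \<Rightarrow> int" where
  "form_disc n F = (THE D. \<exists>\<alpha> \<beta> :: nat \<Rightarrow> complex.
     map_poly (map_poly of_int) F = (\<Prod>i<n. lin_form (\<alpha> i) (\<beta> i)) \<and>
     of_int D = (\<Prod>j<n. \<Prod>i<j. (\<alpha> i * \<beta> j - \<alpha> j * \<beta> i) ^ 2))"

definition Z2_prim :: "(int \<times> int) set" where
  "Z2_prim = {(x, y). gcd x y = 1}"

definition S_part :: "nat set \<Rightarrow> int \<Rightarrow> nat" where
  "S_part S m = (\<Prod>p\<in>S. p ^ multiplicity (int p) m)"

definition s_prime :: "nat \<Rightarrow> int poly poly \<Rightarrow> nat set \<Rightarrow> nat" where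
  "s_prime n F S = card {p \<in> S. \<exists>(x, y) \<in> Z2_prim.
     [eval2 F x y = 0] (mod int p ^ (multiplicity (int p) (form_disc n F) + 1))}"

definition N_count :: "int poly poly \<Rightarrow> nat set \<Rightarrow> real \<Rightarrow> real \<Rightarrow> nat" where
  "N_count F S \<epsilon> B = card {(x, y) \<in> Z2_prim.
     real_of_int (max \<bar>x\<bar> \<bar>y\<bar>) \<le> B \<and> eval2 F x y \<noteq> 0 \<and>
     real (S_part S (eval2 F x y)) \<ge> real_of_int \<bar>eval2 F x y\<bar> powr \<epsilon>}"

end

theory Submission
  imports Defs "Jordan_Normal_Form.Determinant" "HOL-Real_Asymp.Real_Asymp" "HOL-Library.FuncSet"
begin

text \<open>
  Let \<open>P\<close> be the set of the primes counted by \<open>s'\<close>. The primes of \<open>S\<close> outside \<open>P\<close> contribute a bounded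
  factor to the \<open>S\<close>-part. The discriminant of a form with coefficients \<open>a\<^sub>k\<close> is the determinant of an
  integral Bezoutian matrix, and lies in the ideal generated by \<open>a\<^sub>0\<close> and \<open>a\<^sub>1\<^sup>2\<close>. After a unimodular
  substitution this shows that a primitive zero modulo \<open>p ^ (g\<^sub>p + 1)\<close> satisfies the hypothesis of
  Hensel's lemma.

  Upper bound: by Hensel, primitive points that are congruent modulo a fixed number and whose values
  are divisible by \<open>M = \<Prod>p\<in>P. p ^ v\<^sub>p\<close> have pairwise determinants divisible by a fixed fraction of
  \<open>M\<close>, so their slopes \<open>x / y\<close> are separated by a multiple of \<open>M / y\<^sup>2\<close>. On the other hand \<open>|F| \<le> T\<close> confines the slope to
  \<open>n\<close> intervals of length proportional to \<open>T / |y| ^ n\<close>, because the roots of \<open>F\<close> are simple. For \<open>y\<close> in a dyadic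
  interval at height \<open>H\<close> this leaves \<open>O(1 + H\<^sup>2 / X * min (X / M) (M / X))\<close> points, where
  \<open>X = H ^ (n \<epsilon>)\<close>, and only about \<open>(ln X) ^ (s' - 1)\<close> exponent vectors have \<open>M\<close> near \<open>X\<close>.

  Lower bound: there are about \<open>(ln B) ^ (s' - 1)\<close> exponent vectors with \<open>M\<close> of order
  \<open>B ^ (n \<epsilon>)\<close>. For each of them Hensel's lemma yields a congruence \<open>v \<equiv> t u\<close> of modulus of order \<open>M\<close>
  that forces exactly these valuations on the value at \<open>(u, v)\<close>. The modulus is smaller than \<open>B\<close>
  because \<open>n \<epsilon> < 1\<close>, and a sieve using \<open>\<Sum>q\<ge>2. 1 / q\<^sup>2 < 1\<close> shows that a positive proportion of
  the points satisfying the congruence is primitive.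
\<close>

section \<open>The discriminant as an integral determinant\<close>

text \<open>The Bezoutian is a sum of products of the summands of the derivative, so its matrix is
  the Gram matrix of a matrix built from the linear factors. This ties a polynomial in the
  coefficients, where divisibility can be read off, to the definition of the discriminant by
  factors. If \<open>p ^ (g + 1)\<close> divides a0 and the square of a1, it divides the
  discriminant; so at a zero modulo \<open>p ^ (g + 1)\<close> twice the valuation of a1 is at most
  g, which is the range in which Newton steps started at 0 work. The exponent is s' - 1 and not s'
  because the height fixes M up to a bounded factor, so that one exponent is determined by the
  others. In the upper bound the weight makes the vectors with M far from X summable. In the lower
  bound the valuations are prescribed exactly, so different vectors give disjoint sets and their
  counts add up. The error terms are a power of ln B above, and B ln B for each exponent vector
  below; both are absorbed because n \<epsilon> < 1 makes 2 - n \<epsilon> exceed 1.\<close>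

lemma det_scale_rows:
  fixes f :: "nat \<Rightarrow> nat \<Rightarrow> 'a::comm_ring_1"
  shows "det (mat n n (\<lambda>(i, k). c i * f i k)) = (\<Prod>i<n. c i) * det (mat n n (\<lambda>(i, k). f i k))"
proof -
  have "(\<Prod>i = 0..<n. mat n n (\<lambda>(i, k). c i * f i k) $$ (i, p i))
      = (\<Prod>i<n. c i) * (\<Prod>i = 0..<n. mat n n (\<lambda>(i, k). f i k) $$ (i, p i))"
    if "p permutes {0..<n}" for p
  proof -
    have "p i < n" if "i < n" for i
      using permutes_in_image[OF \<open>p permutes {0..<n}\<close>, of i] that by simp
    then have "(\<Prod>i = 0..<n. mat n n (\<lambda>(i, k). c i * f i k) $$ (i, p i))
      = (\<Prod>i = 0..<n. c i * mat n n (\<lambda>(i, k). f i k) $$ (i, p i))"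
      by (intro prod.cong) auto
    then show ?thesis by (simp add: prod.distrib atLeast0LessThan)
  qed
  then show ?thesis
    unfolding det_def by (simp add: sum_distrib_left mult_ac)
qed

lemma det_scale_cols:
  fixes f :: "nat \<Rightarrow> nat \<Rightarrow> 'a::comm_ring_1"
  shows "det (mat n n (\<lambda>(i, k). c k * f i k)) = (\<Prod>k<n. c k) * det (mat n n (\<lambda>(i, k). f i k))"
proof -
  have "det (mat n n (\<lambda>(i, k). c k * f i k)) = det (transpose_mat (mat n n (\<lambda>(i, k). c k * f i k)))"
    by (subst det_transpose[of _ n]) auto
  also have "transpose_mat (mat n n (\<lambda>(i, k). c k * f i k)) = mat n n (\<lambda>(i, k). c i * f k i)"
    by (intro eq_matI) auto
  also have "det \<dots> = (\<Prod>k<n. c k) * det (mat n n (\<lambda>(i, k). f k i))"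
    by (rule det_scale_rows)
  also have "mat n n (\<lambda>(i, k). f k i) = transpose_mat (mat n n (\<lambda>(i, k). f i k))"
    by (intro eq_matI) auto
  also have "det \<dots> = det (mat n n (\<lambda>(i, k). f i k))"
    by (subst det_transpose[of _ n]) auto
  finally show ?thesis .
qed

text \<open>Factors are dehomogenised as \<open>\<alpha> j * t - \<beta> j\<close>, so a root at
  infinity is a constant factor. The derivative of the full product is the sum of
  \<open>\<alpha> i\<close> times these products.\<close>

definition omit_prod :: "(nat \<Rightarrow> 'a::comm_ring_1) \<Rightarrow> (nat \<Rightarrow> 'a) \<Rightarrow> nat \<Rightarrow> nat \<Rightarrow> 'a poly" where
  "omit_prod \<alpha> \<beta> n i = (\<Prod>j\<in>{..<n} - {i}. [:- \<beta> j, \<alpha> j:])"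

text \<open>Row i lists the coefficients of the i-th summand of the derivative. Its top coefficient
  is the product of all \<open>\<alpha> j\<close>, the same in every row; the last column is divided
  by it.\<close>

definition disc_root_mat :: "(nat \<Rightarrow> 'a::comm_ring_1) \<Rightarrow> (nat \<Rightarrow> 'a) \<Rightarrow> nat \<Rightarrow> 'a mat" where
  "disc_root_mat \<alpha> \<beta> n =
     mat n n (\<lambda>(i, k). if k = n - 1 then 1 else \<alpha> i * coeff (omit_prod \<alpha> \<beta> n i) k)"

lemma degree_linear_prod_le: "degree (\<Prod>j\<in>A. [:- \<beta> j, \<alpha> j::'a::comm_ring_1:]) \<le> card A"
proof (cases "finite A")
  case True
  have "degree (\<Prod>j\<in>A. [:- \<beta> j, \<alpha> j:]) \<le> (\<Sum>j\<in>A. degree [:- \<beta> j, \<alpha> j:])"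
    using degree_prod_sum_le[OF True, of "\<lambda>j. [:- \<beta> j, \<alpha> j:]"] by (simp only: comp_def)
  also have "\<dots> \<le> (\<Sum>j\<in>A. 1)" by (intro sum_mono) (auto simp: degree_pCons_eq_if)
  finally show ?thesis by simp
qed auto

lemma coeff_linear_prod_card:
  assumes "finite A"
  shows "coeff (\<Prod>j\<in>A. [:- \<beta> j, \<alpha> j::'a::comm_ring_1:]) (card A) = (\<Prod>j\<in>A. \<alpha> j)"
  using assms
proof (induction A rule: finite_induct)
  case (insert x A)
  have "coeff (\<Prod>j\<in>A. [:- \<beta> j, \<alpha> j:]) (Suc (card A)) = 0"
    by (rule coeff_eq_0) (use degree_linear_prod_le[of \<beta> \<alpha> A] in simp)
  then show ?case using insert by simp
qed auto

lemma omit_prod_mult: "i < n \<Longrightarrow> [:- \<beta> i, \<alpha> i:] * omit_prod \<alpha> \<beta> n i = (\<Prod>j<n. [:- \<beta> j, \<alpha> j:])"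
  unfolding omit_prod_def by (subst prod.remove[of "{..<n}" i]) auto

text \<open>Both products contain all factors except those with index i and n. What remains is
  \<open>\<alpha> i\<close> times factor n minus \<open>\<alpha> n\<close> times factor i, in which
  the variable cancels.\<close>

lemma omit_prod_diff:
  assumes "i < n"
  shows "Polynomial.smult (\<alpha> i) (omit_prod \<alpha> \<beta> (Suc n) i) - Polynomial.smult (\<alpha> n) (omit_prod \<alpha> \<beta> (Suc n) n)
       = Polynomial.smult (\<alpha> n * \<beta> i - \<alpha> i * \<beta> n) (omit_prod \<alpha> \<beta> n i)"
proof -
  have 1: "omit_prod \<alpha> \<beta> (Suc n) i = [:- \<beta> n, \<alpha> n:] * omit_prod \<alpha> \<beta> n i"
  proof -
    have "{..<Suc n} - {i} = insert n ({..<n} - {i})" using assms by auto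
    then show ?thesis unfolding omit_prod_def by simp
  qed
  have 2: "omit_prod \<alpha> \<beta> (Suc n) n = [:- \<beta> i, \<alpha> i:] * omit_prod \<alpha> \<beta> n i"
  proof -
    have "{..<Suc n} - {n} = {..<n}" by auto
    then show ?thesis unfolding omit_prod_mult[OF assms] by (simp add: omit_prod_def)
  qed
  show ?thesis unfolding 1 2
    by (simp add: smult_diff_left smult_diff_right algebra_simps smult_add_left)
qed

text \<open>Subtracting the last row from the others turns the matrix for \<open>n + 1\<close> linear factors into
  the one for \<open>n\<close> factors, up to row scalings.\<close>

lemma det_disc_root_mat:
  fixes \<alpha> \<beta> :: "nat \<Rightarrow> 'a::field"
  assumes "\<And>i. i < n \<Longrightarrow> \<alpha> i \<noteq> 0"
  shows "(det (disc_root_mat \<alpha> \<beta> n))\<^sup>2 = (\<Prod>j<n. \<Prod>i<j. (\<alpha> i * \<beta> j - \<alpha> j * \<beta> i)\<^sup>2)"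
  using assms
proof (induction n)
  case 0
  then show ?case by (simp add: disc_root_mat_def det_def)
next
  case (Suc n)
  define V where "V = disc_root_mat \<alpha> \<beta> (Suc n)"
  define T where "T = mat (Suc n) (Suc n) (\<lambda>(i, k). if i = k then 1 else if k = n then -1 else (0::'a))"
  define c where "c = (\<lambda>i. \<alpha> n * \<beta> i - \<alpha> i * \<beta> n)"
  define W where "W = mat n n (\<lambda>(i, k). coeff (omit_prod \<alpha> \<beta> n i) k)"
  have V: "V \<in> carrier_mat (Suc n) (Suc n)" and T: "T \<in> carrier_mat (Suc n) (Suc n)"
    by (auto simp: V_def T_def disc_root_mat_def)
  have "upper_triangular T" by (auto simp: T_def)
  then have "det T = 1"
    using T by (subst det_upper_triangular[of _ "Suc n"])
      (auto simp: T_def prod_list_diag_prod)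
  then have detTV: "det (T * V) = det V" using det_mult[OF T V] by simp
  have TV: "(T * V) $$ (i, k) = (if i = n then V $$ (i, k) else V $$ (i, k) - V $$ (n, k))"
    if "i < Suc n" "k < Suc n" for i k
  proof -
    have "(T * V) $$ (i, k) = (\<Sum>l = 0..<Suc n. T $$ (i, l) * V $$ (l, k))"
      using that T V by (simp add: scalar_prod_def del: sum.op_ivl_Suc)
    also have "\<dots> = (\<Sum>l = 0..<Suc n. (if l = i then V $$ (l, k) else 0)
        + (if l = n then (if i = n then 0 else - V $$ (l, k)) else 0))"
      using that by (intro sum.cong) (auto simp: T_def)
    also have "\<dots> = (\<Sum>l = 0..<Suc n. (if l = i then V $$ (l, k) else 0))
        + (\<Sum>l = 0..<Suc n. (if l = n then (if i = n then 0 else - V $$ (l, k)) else 0))"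
      by (rule sum.distrib)
    also have "\<dots> = V $$ (i, k) + (if i = n then 0 else - V $$ (n, k))"
      using that by (subst (1 2) sum.delta) (auto simp del: sum.op_ivl_Suc)
    finally show ?thesis by simp
  qed
  have Vn: "V $$ (i, n) = 1" if "i < Suc n" for i
    using that by (simp add: V_def disc_root_mat_def)
  \<comment> \<open>The last column of \<open>V\<close> consists of ones, so after the subtraction
    only its bottom entry is left.\<close>
  have "det (T * V) = (\<Sum>i<Suc n. (T * V) $$ (i, n) * cofactor (T * V) i n)"
    using T V by (intro laplace_expansion_column) auto
  also have "\<dots> = (\<Sum>i<Suc n. if i = n then cofactor (T * V) i n else 0)"
    by (intro sum.cong) (auto simp: TV Vn)
  also have "\<dots> = det (mat_delete (T * V) n n)"
    by (simp add: cofactor_def)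
  also have "mat_delete (T * V) n n = mat n n (\<lambda>(i, k). c i * coeff (omit_prod \<alpha> \<beta> n i) k)"
  proof (intro eq_matI)
    fix i k assume "i < dim_row (mat n n (\<lambda>(i, k). c i * coeff (omit_prod \<alpha> \<beta> n i) k))"
      and "k < dim_col (mat n n (\<lambda>(i, k). c i * coeff (omit_prod \<alpha> \<beta> n i) k))"
    then have ik: "i < n" "k < n" by auto
    have "mat_delete (T * V) n n $$ (i, k) = (T * V) $$ (i, k)"
      using ik T V by (simp add: mat_delete_def)
    also have "\<dots> = V $$ (i, k) - V $$ (n, k)" using ik by (simp add: TV)
    also have "\<dots> = coeff (Polynomial.smult (\<alpha> i) (omit_prod \<alpha> \<beta> (Suc n) i) - Polynomial.smult (\<alpha> n) (omit_prod \<alpha> \<beta> (Suc n) n)) k"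
      using ik by (simp add: V_def disc_root_mat_def)
    also have "\<dots> = c i * coeff (omit_prod \<alpha> \<beta> n i) k"
      unfolding omit_prod_diff[OF ik(1)] by (simp add: c_def)
    finally show "mat_delete (T * V) n n $$ (i, k)
        = mat n n (\<lambda>(i, k). c i * coeff (omit_prod \<alpha> \<beta> n i) k) $$ (i, k)" using ik by simp
  qed (use T V in auto)
  also have "det \<dots> = (\<Prod>i<n. c i) * det W" unfolding W_def by (rule det_scale_rows)
  finally have 1: "det V = (\<Prod>i<n. c i) * det W" using detTV by simp
  \<comment> \<open>The rows of \<open>W\<close> lack the factors \<open>\<alpha> i\<close>.
    Inserting all of them multiplies the determinant by \<open>a\<close> and makes the last column
    constant \<open>a\<close>; taking this \<open>a\<close> out of the column gives the other
    matrix, and the non-zero \<open>a\<close> cancels.\<close>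
  have 2: "det W = det (disc_root_mat \<alpha> \<beta> n)"
  proof (cases n)
    case 0
    then show ?thesis by (simp add: W_def disc_root_mat_def det_def)
  next
    case (Suc m)
    define a where "a = (\<Prod>i<n. \<alpha> i)"
    have lead: "\<alpha> i * coeff (omit_prod \<alpha> \<beta> n i) m = a" if "i < n" for i
    proof -
      have "card ({..<n} - {i}) = m" using that Suc by simp
      then have "coeff (omit_prod \<alpha> \<beta> n i) m = (\<Prod>j\<in>{..<n} - {i}. \<alpha> j)"
        unfolding omit_prod_def using coeff_linear_prod_card[of "{..<n} - {i}" \<beta> \<alpha>] by simp
      then show ?thesis unfolding a_def using that by (simp add: prod.remove[of "{..<n}" i])
    qed
    have "a * det W = det (mat n n (\<lambda>(i, k). \<alpha> i * coeff (omit_prod \<alpha> \<beta> n i) k))"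
      unfolding W_def a_def by (rule det_scale_rows[symmetric])
    also have "mat n n (\<lambda>(i, k). \<alpha> i * coeff (omit_prod \<alpha> \<beta> n i) k)
       = mat n n (\<lambda>(i, k). (if k = m then a else 1) *
           (if k = n - 1 then 1 else \<alpha> i * coeff (omit_prod \<alpha> \<beta> n i) k))"
      by (intro eq_matI) (auto simp: lead[unfolded Suc] Suc)
    also have "det \<dots> = (\<Prod>k<n. if k = m then a else 1) * det (disc_root_mat \<alpha> \<beta> n)"
      unfolding disc_root_mat_def by (rule det_scale_cols)
    also have "(\<Prod>k<n. if k = m then a else 1) = a" using Suc by (simp add: prod.delta)
    finally have "a * det W = a * det (disc_root_mat \<alpha> \<beta> n)" .
    moreover have "a \<noteq> 0" unfolding a_def using Suc.prems by auto
    ultimately show ?thesis by simp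
  qed
  have "(det V)\<^sup>2 = (\<Prod>i<n. (c i)\<^sup>2) * (det (disc_root_mat \<alpha> \<beta> n))\<^sup>2"
    unfolding 1 2 by (simp add: power_mult_distrib prod_power_distrib)
  also have "(det (disc_root_mat \<alpha> \<beta> n))\<^sup>2 = (\<Prod>j<n. \<Prod>i<j. (\<alpha> i * \<beta> j - \<alpha> j * \<beta> i)\<^sup>2)"
    using Suc by simp
  also have "(\<Prod>i<n. (c i)\<^sup>2) = (\<Prod>i<n. (\<alpha> i * \<beta> n - \<alpha> n * \<beta> i)\<^sup>2)"
    by (intro prod.cong) (auto simp: c_def power2_commute)
  finally show ?case by (simp add: V_def mult.commute)
qed

text \<open>The coefficients of the Bezoutian \<open>(f(x) f'(y) - f'(x) f(y)) / (x - y)\<close>, obtained by comparing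
  coefficients after multiplication by \<open>x - y\<close>.\<close>

fun bez :: "(nat \<Rightarrow> int) \<Rightarrow> nat \<Rightarrow> nat \<Rightarrow> int" where
  "bez a 0 k = a 1 * a (Suc k) - a 0 * (int (Suc (Suc k)) * a (Suc (Suc k)))"
| "bez a (Suc j) k = bez a j (Suc k) - (a (Suc j) * (int (Suc (Suc k)) * a (Suc (Suc k)))
     - int (Suc (Suc j)) * a (Suc (Suc j)) * a (Suc k))"

text \<open>The Bezoutian matrix with its last row and column divided by the leading coefficient. This keeps
  the entries integral and removes the square of the leading coefficient from the determinant.\<close>

definition disc_coeff_mat :: "(nat \<Rightarrow> int) \<Rightarrow> nat \<Rightarrow> int mat" where
  "disc_coeff_mat a n = mat n n (\<lambda>(j, k).
     if j = n - 1 then (if k = n - 1 then int n else int (Suc k) * a (Suc k))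
     else if k = n - 1 then int (Suc j) * a (Suc j) else bez a j k)"

text \<open>Once the derivative is written as a sum over the factors, the recursion for
  \<open>bez\<close> holds for each summand separately: in
  \<open>a (Suc k) = \<alpha> i * w i k - \<beta> i * w i (Suc k)\<close> the terms with
  \<open>\<beta> i\<close> cancel.\<close>

lemma of_int_bez:
  fixes \<alpha> \<beta> :: "nat \<Rightarrow> 'a::field_char_0"
  assumes g: "map_poly of_int g = (\<Prod>i<n. [:- \<beta> i, \<alpha> i:])"
  defines "w \<equiv> \<lambda>i. coeff (omit_prod \<alpha> \<beta> n i)"
  shows "of_nat (Suc k) * of_int (coeff g (Suc k)) = (\<Sum>i<n. \<alpha> i * w i k)"
    and "of_int (bez (coeff g) j k) = (\<Sum>i<n. (\<alpha> i * w i j) * (\<alpha> i * w i k))"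
proof -
  define a :: "nat \<Rightarrow> 'a" where "a k = of_int (coeff g k)" for k
  have a: "a k = coeff (\<Prod>i<n. [:- \<beta> i, \<alpha> i:]) k" for k
    using arg_cong[OF g, of "\<lambda>p. coeff p k"] by (simp add: a_def coeff_map_poly)
  have deriv: "of_nat (Suc k) * a (Suc k) = (\<Sum>i<n. \<alpha> i * w i k)" for k
  proof -
    have "pderiv (\<Prod>i<n. [:- \<beta> i, \<alpha> i:]) = (\<Sum>i<n. omit_prod \<alpha> \<beta> n i * [:\<alpha> i:])"
      by (simp add: pderiv_prod omit_prod_def pderiv_pCons)
    then have "coeff (pderiv (\<Prod>i<n. [:- \<beta> i, \<alpha> i:])) k = (\<Sum>i<n. \<alpha> i * w i k)"
      by (simp add: coeff_sum w_def mult.commute)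
    then show ?thesis by (simp add: coeff_pderiv a)
  qed
  have fac: "a (Suc k) = \<alpha> i * w i k - \<beta> i * w i (Suc k)" if "i < n" for i k
    unfolding a omit_prod_mult[OF that, symmetric] by (simp add: w_def)
  have fac0: "a 0 = - \<beta> i * w i 0" if "i < n" for i
    unfolding a omit_prod_mult[OF that, symmetric] by (simp add: w_def)
  have bez: "of_int (bez (coeff g) j k) = (\<Sum>i<n. (\<alpha> i * w i j) * (\<alpha> i * w i k))" for j k
  proof (induction j arbitrary: k)
    case 0
    have "of_int (bez (coeff g) 0 k) = (of_nat (Suc 0) * a (Suc 0)) * a (Suc k)
        - a 0 * (of_nat (Suc (Suc k)) * a (Suc (Suc k)))"
      by (simp add: a_def)
    also have "\<dots> = (\<Sum>i<n. \<alpha> i * w i 0 * a (Suc k) - a 0 * (\<alpha> i * w i (Suc k)))"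
      unfolding deriv by (simp add: sum_distrib_right sum_distrib_left sum_subtractf)
    also have "\<dots> = (\<Sum>i<n. (\<alpha> i * w i 0) * (\<alpha> i * w i k))"
      by (intro sum.cong refl) (simp add: fac fac0 algebra_simps)
    finally show ?case .
  next
    case (Suc j)
    have "of_int (bez (coeff g) (Suc j) k) = of_int (bez (coeff g) j (Suc k))
        - (a (Suc j) * (of_nat (Suc (Suc k)) * a (Suc (Suc k)))
           - (of_nat (Suc (Suc j)) * a (Suc (Suc j))) * a (Suc k))"
      by (simp add: a_def)
    also have "\<dots> = (\<Sum>i<n. (\<alpha> i * w i j) * (\<alpha> i * w i (Suc k))
        - (a (Suc j) * (\<alpha> i * w i (Suc k)) - (\<alpha> i * w i (Suc j)) * a (Suc k)))"
      unfolding deriv Suc.IH by (simp add: sum_distrib_right sum_distrib_left sum_subtractf)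
    also have "\<dots> = (\<Sum>i<n. (\<alpha> i * w i (Suc j)) * (\<alpha> i * w i k))"
      by (intro sum.cong refl) (simp add: fac algebra_simps)
    finally show ?case .
  qed
  show "of_nat (Suc k) * of_int (coeff g (Suc k)) = (\<Sum>i<n. \<alpha> i * w i k)"
    using deriv[of k] by (simp add: a_def)
  show "of_int (bez (coeff g) j k) = (\<Sum>i<n. (\<alpha> i * w i j) * (\<alpha> i * w i k))"
    by (rule bez)
qed

text \<open>The recursion hides the symmetry; the Gram form over the linear factors shows
  it.\<close>

lemma bez_commute:
  fixes \<alpha> \<beta> :: "nat \<Rightarrow> 'a::field_char_0"
  assumes g: "map_poly of_int g = (\<Prod>i<n. [:- \<beta> i, \<alpha> i:])"
  shows "bez (coeff g) j k = bez (coeff g) k j"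
proof -
  have "(of_int (bez (coeff g) j k) :: 'a) = of_int (bez (coeff g) k j)"
    unfolding of_int_bez(2)[OF g] by (simp add: mult.commute)
  then show ?thesis by simp
qed

lemma disc_coeff_mat_eq:
  fixes \<alpha> \<beta> :: "nat \<Rightarrow> 'a::field_char_0"
  assumes g: "map_poly of_int g = (\<Prod>i<n. [:- \<beta> i, \<alpha> i:])"
  shows "map_mat of_int (disc_coeff_mat (coeff g) n)
       = transpose_mat (disc_root_mat \<alpha> \<beta> n) * disc_root_mat \<alpha> \<beta> n"
proof -
  define w where "w i = coeff (omit_prod \<alpha> \<beta> n i)" for i
  note deriv = of_int_bez(1)[OF g, folded w_def] and bez = of_int_bez(2)[OF g, folded w_def]
  show ?thesis
  proof (intro eq_matI)
    fix j k assume "j < dim_row (transpose_mat (disc_root_mat \<alpha> \<beta> n) * disc_root_mat \<alpha> \<beta> n)"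
      and "k < dim_col (transpose_mat (disc_root_mat \<alpha> \<beta> n) * disc_root_mat \<alpha> \<beta> n)"
    then have jk: "j < n" "k < n" by (auto simp: disc_root_mat_def)
    have "(transpose_mat (disc_root_mat \<alpha> \<beta> n) * disc_root_mat \<alpha> \<beta> n) $$ (j, k)
      = (\<Sum>i<n. (if j = n - 1 then 1 else \<alpha> i * w i j) * (if k = n - 1 then 1 else \<alpha> i * w i k))"
      using jk by (auto simp: disc_root_mat_def scalar_prod_def w_def atLeast0LessThan intro!: sum.cong)
    also have "\<dots> = of_int (disc_coeff_mat (coeff g) n $$ (j, k))"
      using jk deriv[symmetric]
      by (auto simp: disc_coeff_mat_def bez simp del: of_nat_Suc)
    finally show "map_mat of_int (disc_coeff_mat (coeff g) n) $$ (j, k)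
      = (transpose_mat (disc_root_mat \<alpha> \<beta> n) * disc_root_mat \<alpha> \<beta> n) $$ (j, k)"
      using jk by (simp add: disc_coeff_mat_def)
  qed (auto simp: disc_root_mat_def disc_coeff_mat_def)
qed

lemma of_int_det: "of_int (det A) = det (map_mat of_int A :: 'a::comm_ring_1 mat)"
  by (simp add: det_def if_distrib[of of_int] permutes_def cong: if_cong)

lemma det_disc_coeff_mat:
  fixes \<alpha> \<beta> :: "nat \<Rightarrow> 'a::field_char_0"
  assumes g: "map_poly of_int g = (\<Prod>i<n. [:- \<beta> i, \<alpha> i:])" and n: "coeff g n \<noteq> 0"
  shows "of_int (det (disc_coeff_mat (coeff g) n)) = (\<Prod>j<n. \<Prod>i<j. (\<alpha> i * \<beta> j - \<alpha> j * \<beta> i)\<^sup>2)"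
proof -
  have V: "disc_root_mat \<alpha> \<beta> n \<in> carrier_mat n n" by (simp add: disc_root_mat_def)
  have "of_int (coeff g n) = (\<Prod>i<n. \<alpha> i)"
    using arg_cong[OF g, of "\<lambda>p. coeff p n"] coeff_linear_prod_card[of "{..<n}" \<beta> \<alpha>]
    by (simp add: coeff_map_poly)
  then have "\<alpha> i \<noteq> 0" if "i < n" for i using n that by (metis finite_lessThan lessThan_iff of_int_eq_0_iff prod_zero)
  then have "(det (disc_root_mat \<alpha> \<beta> n))\<^sup>2 = (\<Prod>j<n. \<Prod>i<j. (\<alpha> i * \<beta> j - \<alpha> j * \<beta> i)\<^sup>2)"
    by (rule det_disc_root_mat)
  moreover have "of_int (det (disc_coeff_mat (coeff g) n)) = (det (disc_root_mat \<alpha> \<beta> n))\<^sup>2"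
    unfolding of_int_det disc_coeff_mat_eq[OF g]
    using V det_mult[of "transpose_mat (disc_root_mat \<alpha> \<beta> n)" n "disc_root_mat \<alpha> \<beta> n"]
      det_transpose[OF V] by (simp add: power2_eq_square)
  ultimately show ?thesis by simp
qed

text \<open>Modulo \<open>a 0\<close> the first row and the first column of the matrix are divisible by \<open>a 1\<close>, and
  the corner entry by its square.\<close>

lemma dvd_det_disc_coeff_mat:
  assumes n: "n \<ge> 2" and d: "d dvd a 0" "d dvd a 1" and q: "q dvd a 0" "q dvd d * d"
    and sym: "\<And>j k. bez a j k = bez a k j"
  shows "q dvd det (disc_coeff_mat a n)"
proof -
  let ?M = "disc_coeff_mat a n"
  have M: "?M \<in> carrier_mat n n" by (simp add: disc_coeff_mat_def)
  have row: "d dvd ?M $$ (0, k)" if "k < n" for k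
    using that n d by (auto simp: disc_coeff_mat_def dvd_diff)
  have col: "d dvd ?M $$ (k, 0)" if "k < n" for k
    using that n d by (auto simp: disc_coeff_mat_def dvd_diff sym[of k 0])
  have "q dvd a 1 * a 1" using q(2) d(2) by (meson dvd_trans mult_dvd_mono)
  then have corner: "q dvd ?M $$ (0, 0)"
    using n q by (simp add: disc_coeff_mat_def dvd_diff)
  \<comment> \<open>In the Leibniz expansion a permutation either fixes 0 and picks the corner, or
    picks one further entry of row 0 and one of column 0, each divisible by
    \<open>d\<close>.\<close>
  have "q dvd (\<Prod>i = 0..<n. ?M $$ (i, p i))" if p: "p permutes {0..<n}" for p
  proof (cases "p 0 = 0")
    case True
    have "?M $$ (0, p 0) dvd (\<Prod>i = 0..<n. ?M $$ (i, p i))" using n by (intro dvd_prodI) auto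
    then show ?thesis using corner True by (metis dvd_trans)
  next
    case False
    obtain i where i: "p i = 0" "i < n"
      using permutes_surj[OF p] permutes_in_image[OF p] n
      by (metis atLeastLessThan_iff less_eq_nat.simps(1) order_less_le_trans pos2 surjD)
    have p0: "p 0 < n" using permutes_in_image[OF p, of 0] n by simp
    have i0: "i \<noteq> 0" using i False by metis
    have "(\<Prod>i\<in>{0, i}. ?M $$ (i, p i)) dvd (\<Prod>i = 0..<n. ?M $$ (i, p i))"
      using i n by (intro prod_dvd_prod_subset) auto
    moreover have "(\<Prod>i\<in>{0, i}. ?M $$ (i, p i)) = ?M $$ (0, p 0) * ?M $$ (i, 0)"
      using i i0 by simp
    moreover have "d * d dvd ?M $$ (0, p 0) * ?M $$ (i, 0)"
      using row[OF p0] col[OF i(2)] by (rule mult_dvd_mono)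
    ultimately show ?thesis using q(2) by (metis dvd_trans)
  qed
  then show ?thesis unfolding det_def'[OF M] by (intro dvd_sum dvd_mult) auto
qed

section \<open>Binary forms and unimodular substitutions\<close>

text \<open>The zero polynomial is allowed here, which spares non-vanishing side conditions for
  products and in \<open>homogeneous_eqI\<close>.\<close>

definition homogeneous :: "nat \<Rightarrow> 'a::zero poly poly \<Rightarrow> bool" where
  "homogeneous n H \<longleftrightarrow> (\<forall>i j. coeff (coeff H j) i \<noteq> 0 \<longrightarrow> i + j = n)"

lemma homogeneous_mult:
  fixes G H :: "'a::comm_ring_1 poly poly"
  assumes "homogeneous m G" "homogeneous n H"
  shows "homogeneous (m + n) (G * H)"
  unfolding homogeneous_def
proof (intro allI impI)
  fix i j assume "coeff (coeff (G * H) j) i \<noteq> 0"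
  then have "(\<Sum>k\<le>j. \<Sum>l\<le>i. coeff (coeff G k) l * coeff (coeff H (j - k)) (i - l)) \<noteq> 0"
    by (simp add: coeff_mult coeff_sum)
  then obtain k where k: "k \<le> j" "(\<Sum>l\<le>i. coeff (coeff G k) l * coeff (coeff H (j - k)) (i - l)) \<noteq> 0"
    by (meson atMost_iff sum.not_neutral_contains_not_neutral)
  then obtain l where l: "l \<le> i" "coeff (coeff G k) l * coeff (coeff H (j - k)) (i - l) \<noteq> 0"
    by (meson atMost_iff sum.not_neutral_contains_not_neutral)
  then have "coeff (coeff G k) l \<noteq> 0" "coeff (coeff H (j - k)) (i - l) \<noteq> 0"
    by auto
  then have "l + k = m" "(i - l) + (j - k) = n"
    using assms unfolding homogeneous_def by blast+
  with k l show "i + j = m + n" by linarith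
qed

lemma homogeneous_lin_form: "homogeneous 1 (lin_form a b)"
  by (auto simp: homogeneous_def lin_form_def coeff_pCons split: nat.splits)

lemma homogeneous_prod_lin_form: "homogeneous n (\<Prod>i<n. lin_form (\<alpha> i) (\<beta> i))"
proof (induction n)
  case 0
  then show ?case by (auto simp: homogeneous_def coeff_pCons one_pCons split: nat.splits)
next
  case (Suc n)
  then show ?case using homogeneous_mult[OF Suc homogeneous_lin_form] by simp
qed

lemma poly_altdef_le:
  fixes p :: "'a::comm_semiring_1 poly"
  assumes "degree p \<le> n"
  shows "poly p x = (\<Sum>i\<le>n. coeff p i * x ^ i)"
  unfolding poly_altdef
  by (rule sum.mono_neutral_left) (use assms in \<open>auto simp: coeff_eq_0\<close>)

lemma homogeneous_degree_le:
  assumes "homogeneous n H"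
  shows "degree H \<le> n" and "degree (coeff H j) \<le> n"
proof -
  show "degree H \<le> n"
  proof (rule degree_le, intro allI impI)
    fix j assume "n < j"
    then show "coeff H j = 0"
      using assms by (intro poly_eqI) (fastforce simp: homogeneous_def)
  qed
  show "degree (coeff H j) \<le> n"
    using assms by (intro degree_le) (fastforce simp: homogeneous_def)
qed

lemma eval2_homogeneous:
  fixes H :: "'a::comm_ring_1 poly poly"
  assumes H: "homogeneous n H"
  shows "eval2 H x y = (\<Sum>j\<le>n. coeff (coeff H j) (n - j) * x ^ (n - j) * y ^ j)"
proof -
  have "eval2 H x y = (\<Sum>j\<le>n. poly (coeff H j) x * y ^ j)"
    unfolding eval2_def poly_altdef_le[OF homogeneous_degree_le(1)[OF H]]
    by (simp add: poly_sum poly_power)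
  also have "\<dots> = (\<Sum>j\<le>n. (\<Sum>i\<le>n. if i = n - j then coeff (coeff H j) i * x ^ i else 0) * y ^ j)"
    unfolding poly_altdef_le[OF homogeneous_degree_le(2)[OF H]]
  proof (intro sum.cong refl arg_cong2[of _ _ _ _ "(*)"])
    fix j i assume "j \<in> {..n}" "i \<in> {..n}"
    show "coeff (coeff H j) i * x ^ i = (if i = n - j then coeff (coeff H j) i * x ^ i else 0)"
    proof (cases "coeff (coeff H j) i = 0")
      case False
      then have "i + j = n" using H unfolding homogeneous_def by blast
      then show ?thesis by auto
    qed auto
  qed
  also have "\<dots> = (\<Sum>j\<le>n. coeff (coeff H j) (n - j) * x ^ (n - j) * y ^ j)"
    by simp
  finally show ?thesis .
qed

lemma coeff_poly_1_homogeneous: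
  fixes H :: "'a::comm_ring_1 poly poly"
  assumes H: "homogeneous n H" and ij: "i + j = n"
  shows "coeff (coeff H j) i = coeff (poly H 1) i"
proof -
  have "coeff (poly H 1) i = (\<Sum>k\<le>n. coeff (coeff H k) i)"
    unfolding poly_altdef_le[OF homogeneous_degree_le(1)[OF H]] by (simp add: coeff_sum)
  also have "\<dots> = (\<Sum>k\<le>n. if k = j then coeff (coeff H k) i else 0)"
    using H ij by (intro sum.cong) (fastforce simp: homogeneous_def)+
  also have "\<dots> = coeff (coeff H j) i" using ij by simp
  finally show ?thesis by simp
qed

text \<open>In a fixed degree the exponent of X determines that of Y, so setting Y to 1 loses no
  coefficient.\<close>

lemma homogeneous_eqI:
  fixes G H :: "'a::comm_ring_1 poly poly"
  assumes "homogeneous n G" "homogeneous n H" "poly G 1 = poly H 1"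
  shows "G = H"
proof (intro poly_eqI)
  fix i j
  show "coeff (coeff G j) i = coeff (coeff H j) i"
  proof (cases "i + j = n")
    case True
    then show ?thesis using assms coeff_poly_1_homogeneous by metis
  next
    case False
    then have "coeff (coeff G j) i = 0" "coeff (coeff H j) i = 0"
      using assms(1,2) unfolding homogeneous_def by blast+
    then show ?thesis by simp
  qed
qed

lemma homogeneous_factorization:
  fixes G :: "'a::alg_closed_field poly poly"
  assumes G: "homogeneous n G" "G \<noteq> 0" and n: "n \<ge> 1"
  shows "\<exists>\<alpha> \<beta>. G = (\<Prod>i<n. lin_form (\<alpha> i) (\<beta> i))"
proof -
  define f where "f = poly G 1"
  have "f \<noteq> 0"
  proof
    assume "f = 0"
    then have "G = 0" using G by (intro homogeneous_eqI[of n]) (auto simp: f_def homogeneous_def)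
    then show False using G by simp
  qed
  then obtain A where A: "size A = degree f" "f = Polynomial.smult (lead_coeff f) (\<Prod>x\<in>#A. [:-x, 1:])"
    using alg_closed_imp_factorization[of f] by blast
  obtain xs where xs: "mset xs = A" using ex_mset by blast
  define m where "m = length xs"
  have fx: "f = Polynomial.smult (lead_coeff f) (\<Prod>i<m. [:- (xs ! i), 1:])"
  proof -
    have "(\<Prod>x\<in>#A. [:-x, 1:]) = prod_list (map (\<lambda>x. [:-x, 1:]) xs)"
      unfolding xs[symmetric] by (metis mset_map prod_mset_prod_list)
    also have "\<dots> = (\<Prod>i<m. [:- (xs ! i), 1:])"
      unfolding m_def by (induction xs rule: rev_induct) (auto simp: nth_append)
    finally show ?thesis using A by simp
  qed
  have "degree f \<le> n"
  proof (rule degree_le, intro allI impI)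
    fix i assume "n < i"
    then have "coeff (coeff G k) i = 0" for k using G(1) by (fastforce simp: homogeneous_def)
    then show "coeff f i = 0"
      unfolding f_def poly_altdef_le[OF homogeneous_degree_le(1)[OF G(1)]] by (simp add: coeff_sum)
  qed
  then have mn: "m \<le> n" using A xs by (auto simp: m_def)
  \<comment> \<open>Factor 0 carries the leading coefficient. The indices from \<open>m\<close> on
    give the forms \<open>s i * Y\<close>, the roots at infinity, which make up for the degree lost
    on setting Y to 1; if \<open>m = 0\<close>, the leading coefficient sits on such a form.\<close>
  define s where "s i = (if i = 0 then lead_coeff f else 1)" for i :: nat
  define \<alpha> where "\<alpha> i = (if i < m then s i else 0)" for i
  define \<beta> where "\<beta> i = (if i < m then s i * xs ! i else - s i)" for i
  have "poly (\<Prod>i<n. lin_form (\<alpha> i) (\<beta> i)) 1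
      = (\<Prod>i<n. [:s i:] * (if i < m then [:- (xs ! i), 1:] else 1))"
    unfolding poly_prod by (intro prod.cong) (auto simp: lin_form_def \<alpha>_def \<beta>_def one_pCons)
  also have "\<dots> = (\<Prod>i<n. [:s i:]) * (\<Prod>i<n. if i < m then [:- (xs ! i), 1:] else 1)"
    by (rule prod.distrib)
  also have "(\<Prod>i<n. [:s i:]) = [:lead_coeff f:]"
  proof -
    have "(\<Prod>i<n. [:s i:]) = [:s 0:] * (\<Prod>i\<in>{..<n} - {0}. [:s i:])"
      using n by (subst prod.remove[of _ 0]) auto
    also have "(\<Prod>i\<in>{..<n} - {0}. [:s i:]) = 1" by (intro prod.neutral) (auto simp: s_def)
    finally show ?thesis by (simp add: s_def)
  qed
  also have "(\<Prod>i<n. if i < m then [:- (xs ! i), 1:] else 1) = (\<Prod>i<m. [:- (xs ! i), 1:])"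
    using mn by (intro prod.mono_neutral_cong_right) auto
  also have "[:lead_coeff f:] * (\<Prod>i<m. [:- (xs ! i), 1:]) = poly G 1"
    using fx by (simp add: f_def)
  finally have "G = (\<Prod>i<n. lin_form (\<alpha> i) (\<beta> i))"
    using G(1) homogeneous_prod_lin_form by (intro homogeneous_eqI) auto
  then show ?thesis by blast
qed

lemma eval2_mult: "eval2 (G * H) x y = eval2 G x y * eval2 H x y"
  by (simp add: eval2_def)

lemma eval2_prod_lin_form: "eval2 (\<Prod>i<n. lin_form (\<alpha> i) (\<beta> i)) x y = (\<Prod>i<(n::nat). \<alpha> i * x - \<beta> i * y)"
  by (induction n) (auto simp: eval2_mult, auto simp: eval2_def lin_form_def algebra_simps)

section \<open>Unimodular substitutions and invariance of the discriminant\<close>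

definition complexify :: "int poly poly \<Rightarrow> complex poly poly" where
  "complexify F = map_poly (map_poly of_int) F"

lemma coeff_complexify: "coeff (coeff (complexify F) j) i = of_int (coeff (coeff F j) i)"
  by (simp add: complexify_def coeff_map_poly)

lemma homogeneous_complexify: "homogeneous n F \<Longrightarrow> homogeneous n (complexify F)"
  by (auto simp: homogeneous_def coeff_complexify)

lemma eval2_complexify:
  assumes "homogeneous n F"
  shows "eval2 (complexify F) (of_int x) (of_int y) = of_int (eval2 F x y)"
  unfolding eval2_homogeneous[OF assms] eval2_homogeneous[OF homogeneous_complexify[OF assms]]
  by (simp add: coeff_complexify)

text \<open>This is F(x + z x', y + z y') as a polynomial in z. When the determinant x y' - x' y is
  1, it is the dehomogenised form in the basis (x, y), (x', y'), with constant term F(x, y) and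
  z^n-coefficient F(x', y').\<close>

definition subst_poly :: "nat \<Rightarrow> int poly poly \<Rightarrow> int \<Rightarrow> int \<Rightarrow> int \<Rightarrow> int \<Rightarrow> int poly" where
  "subst_poly n F x y x' y' =
     (\<Sum>j\<le>n. Polynomial.smult (coeff (coeff F j) (n - j)) ([:x, x':] ^ (n - j) * [:y, y':] ^ j))"

lemma map_poly_of_int_simps:
  "map_poly (of_int :: int \<Rightarrow> 'a::field_char_0) (p * q) = map_poly of_int p * map_poly of_int q"
  "map_poly (of_int :: int \<Rightarrow> 'a) (p + q) = map_poly of_int p + map_poly of_int q"
  by (auto intro!: poly_eqI simp: coeff_map_poly coeff_mult)

lemma poly_map_of_int_subst_poly:
  assumes F: "homogeneous n F"
  shows "poly (map_poly of_int (subst_poly n F x y x' y')) (z::complex)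
     = eval2 (complexify F) (of_int x + z * of_int x') (of_int y + z * of_int y')"
proof -
  have pow: "map_poly (of_int :: int \<Rightarrow> complex) (p ^ k) = map_poly of_int p ^ k" for p k
    by (induction k) (auto simp: map_poly_of_int_simps)
  have lin: "map_poly (of_int :: int \<Rightarrow> complex) [:a, b:] = [:of_int a, of_int b:]" for a b
    by (auto intro!: poly_eqI simp: coeff_map_poly coeff_pCons split: nat.splits)
  have sm: "map_poly (of_int :: int \<Rightarrow> complex) (Polynomial.smult a p) = Polynomial.smult (of_int a) (map_poly of_int p)" for a p
    by (auto intro!: poly_eqI simp: coeff_map_poly)
  have "map_poly (of_int :: int \<Rightarrow> complex) (sum h A) = (\<Sum>j\<in>A. map_poly of_int (h j))" for h :: "nat \<Rightarrow> int poly" and A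
    by (induction A rule: infinite_finite_induct) (auto simp: map_poly_of_int_simps)
  then show ?thesis
    unfolding subst_poly_def eval2_homogeneous[OF homogeneous_complexify[OF F]]
    by (simp add: sm map_poly_of_int_simps pow lin poly_sum coeff_complexify mult_ac)
qed

lemma poly_subst_poly:
  assumes F: "homogeneous n F"
  shows "poly (subst_poly n F x y x' y') z = eval2 F (x + z * x') (y + z * y')"
  unfolding subst_poly_def eval2_homogeneous[OF F] by (simp add: poly_sum poly_power mult_ac)

lemma map_poly_of_int_subst_poly:
  assumes F: "homogeneous n F" "complexify F = (\<Prod>i<n. lin_form (\<alpha> i) (\<beta> i))"
  shows "map_poly of_int (subst_poly n F x y x' y')
     = (\<Prod>i<n. [:- (\<beta> i * of_int y - \<alpha> i * of_int x), \<alpha> i * of_int x' - \<beta> i * of_int y':])"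
proof -
  have "poly (map_poly of_int (subst_poly n F x y x' y')) z
     = poly (\<Prod>i<n. [:- (\<beta> i * of_int y - \<alpha> i * of_int x), \<alpha> i * of_int x' - \<beta> i * of_int y':]) z" for z
    unfolding poly_map_of_int_subst_poly[OF F(1)] F(2) eval2_prod_lin_form poly_prod
    by (intro prod.cong) (auto simp: algebra_simps)
  then show ?thesis by (intro poly_eq_poly_eq_iff[THEN iffD1] ext)
qed

lemma coeff_subst_poly_lead:
  assumes F: "homogeneous n F" "complexify F = (\<Prod>i<n. lin_form (\<alpha> i) (\<beta> i))"
  shows "coeff (subst_poly n F x y x' y') n = eval2 F x' y'"
proof -
  have "of_int (coeff (subst_poly n F x y x' y') n) = (\<Prod>i<n. \<alpha> i * of_int x' - \<beta> i * of_int y')"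
    using arg_cong[OF map_poly_of_int_subst_poly[OF F], of "\<lambda>p. coeff p n" x y x' y']
      coeff_linear_prod_card[of "{..<n}" "\<lambda>i. \<beta> i * of_int y - \<alpha> i * of_int x" "\<lambda>i. \<alpha> i * of_int x' - \<beta> i * of_int y'"]
    by (simp add: coeff_map_poly)
  also have "\<dots> = of_int (eval2 F x' y')"
    unfolding eval2_complexify[OF F(1), symmetric] F(2) eval2_prod_lin_form ..
  finally show ?thesis by (simp only: of_int_eq_iff)
qed

text \<open>The substitution multiplies each 2 by 2 determinant of two linear factors by minus its
  own determinant, hence by -1, and the squares do not change.\<close>

lemma form_disc_subst_poly:
  assumes F: "homogeneous n F" "complexify F = (\<Prod>i<n. lin_form (\<alpha> i) (\<beta> i))"
    and det: "x * y' - x' * y = 1" and lead: "coeff (subst_poly n F x y x' y') n \<noteq> 0"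
  shows "of_int (det (disc_coeff_mat (coeff (subst_poly n F x y x' y')) n))
       = (\<Prod>j<n. \<Prod>i<j. (\<alpha> i * \<beta> j - \<alpha> j * \<beta> i)\<^sup>2)"
proof -
  define a b where "a i = \<alpha> i * of_int x' - \<beta> i * of_int y'"
    and "b i = \<beta> i * of_int y - \<alpha> i * of_int x" for i
  have det': "of_int x * of_int y' - of_int x' * of_int y = (1::complex)"
    using arg_cong[OF det, of "of_int :: int \<Rightarrow> complex"] by simp
  have "a i * b j - a j * b i = - (\<alpha> i * \<beta> j - \<alpha> j * \<beta> i) * (of_int x * of_int y' - of_int x' * of_int y)" for i j
    by (simp add: a_def b_def algebra_simps)
  then have *: "(a i * b j - a j * b i)\<^sup>2 = (\<alpha> i * \<beta> j - \<alpha> j * \<beta> i)\<^sup>2" for i j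
    by (simp add: det' power2_commute)
  show ?thesis
    using det_disc_coeff_mat[OF map_poly_of_int_subst_poly[OF F] lead]
    unfolding a_def[symmetric] b_def[symmetric] * .
qed

text \<open>Otherwise one of the linear factors would vanish at both vectors of a basis and so be
  zero.\<close>

lemma subst_poly_nonzero:
  assumes F: "homogeneous n F" "complexify F = (\<Prod>i<n. lin_form (\<alpha> i) (\<beta> i))" "F \<noteq> 0"
    and det: "x * y' - x' * y = 1"
  shows "subst_poly n F x y x' y' \<noteq> 0"
proof
  assume "subst_poly n F x y x' y' = 0"
  then have "(\<Prod>i<n. [:- (\<beta> i * of_int y - \<alpha> i * of_int x), \<alpha> i * of_int x' - \<beta> i * of_int y':]) = 0"
    using map_poly_of_int_subst_poly[OF F(1,2), of x y x' y'] by simp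
  then obtain i where i: "i < n" "\<alpha> i * of_int x = \<beta> i * of_int y" "\<alpha> i * of_int x' = \<beta> i * of_int y'"
    by auto
  have det': "of_int x * of_int y' - of_int x' * of_int y = (1::complex)"
    using arg_cong[OF det, of "of_int :: int \<Rightarrow> complex"] by simp
  have "\<alpha> i * (of_int x * of_int y' - of_int x' * of_int y)
      = (\<alpha> i * of_int x) * of_int y' - (\<alpha> i * of_int x') * of_int y"
    by (simp add: algebra_simps)
  then have "\<alpha> i = 0" unfolding i(2,3) by (simp add: det')
  moreover have "\<beta> i * (of_int x * of_int y' - of_int x' * of_int y)
      = (\<beta> i * of_int y') * of_int x - (\<beta> i * of_int y) * of_int x'"
    by (simp add: algebra_simps)
  then have "\<beta> i = 0" unfolding i(2,3)[symmetric] by (simp add: det')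
  ultimately have "lin_form (\<alpha> i) (\<beta> i) = 0" by (simp add: lin_form_def)
  then have "complexify F = 0" unfolding F(2) using i(1) by (auto intro!: prod_zero)
  then have "coeff (coeff F j) k = 0" for j k using coeff_complexify[of F j k] by simp
  then have "F = 0" by (intro poly_eqI) simp
  then show False using F(3) by simp
qed

text \<open>This gives meaning to the definite description in \<open>form_disc\<close>: every
  factorization yields the same integer, a determinant formed from coefficients alone. The
  determinant formula wants a non-zero leading coefficient, hence the shear by a z with F(-z, 1)
  different from 0.\<close>

lemma form_disc_factorization:
  assumes n: "n \<ge> 1" and F: "binary_form n F"
  obtains \<alpha> \<beta> where "complexify F = (\<Prod>i<n. lin_form (\<alpha> i) (\<beta> i))"
    "of_int (form_disc n F) = (\<Prod>j<n. \<Prod>i<j. (\<alpha> i * \<beta> j - \<alpha> j * \<beta> i)\<^sup>2)"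
proof -
  have hom: "homogeneous n F" and "F \<noteq> 0" using F by (auto simp: binary_form_def homogeneous_def)
  have "complexify F \<noteq> 0"
  proof
    assume "complexify F = 0"
    then have "coeff (coeff F j) k = 0" for j k using coeff_complexify[of F j k] by simp
    then have "F = 0" by (intro poly_eqI) simp
    then show False using \<open>F \<noteq> 0\<close> by simp
  qed
  then obtain \<alpha> \<beta> where fac: "complexify F = (\<Prod>i<n. lin_form (\<alpha> i) (\<beta> i))"
    using homogeneous_factorization[OF homogeneous_complexify[OF hom]] n by blast
  have "subst_poly n F 0 1 (-1) 0 \<noteq> 0"
    using subst_poly_nonzero[OF hom fac \<open>F \<noteq> 0\<close>] by simp
  then obtain z where z: "poly (subst_poly n F 0 1 (-1) 0) z \<noteq> 0"
    using poly_all_0_iff_0 by blast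
  define D where "D = det (disc_coeff_mat (coeff (subst_poly n F 1 0 (-z) 1)) n)"
  have D: "of_int D = (\<Prod>j<n. \<Prod>i<j. (\<alpha> i * \<beta> j - \<alpha> j * \<beta> i)\<^sup>2)"
    if fac: "complexify F = (\<Prod>i<n. lin_form (\<alpha> i) (\<beta> i))" for \<alpha> \<beta>
    unfolding D_def
    by (rule form_disc_subst_poly[OF hom fac])
      (use z in \<open>simp_all add: coeff_subst_poly_lead[OF hom fac] poly_subst_poly[OF hom]\<close>)
  have "form_disc n F = D"
    unfolding form_disc_def complexify_def[symmetric]
  proof (rule the_equality)
    show "\<exists>\<alpha> \<beta>. complexify F = (\<Prod>i<n. lin_form (\<alpha> i) (\<beta> i)) \<and>
      complex_of_int D = (\<Prod>j<n. \<Prod>i<j. (\<alpha> i * \<beta> j - \<alpha> j * \<beta> i)\<^sup>2)"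
      using D[OF fac] fac by blast
    fix D' assume "\<exists>\<alpha> \<beta>. complexify F = (\<Prod>i<n. lin_form (\<alpha> i) (\<beta> i)) \<and>
      complex_of_int D' = (\<Prod>j<n. \<Prod>i<j. (\<alpha> i * \<beta> j - \<alpha> j * \<beta> i)\<^sup>2)"
    then obtain \<alpha>' \<beta>' where fac': "complexify F = (\<Prod>i<n. lin_form (\<alpha>' i) (\<beta>' i))"
      and D': "complex_of_int D' = (\<Prod>j<n. \<Prod>i<j. (\<alpha>' i * \<beta>' j - \<alpha>' j * \<beta>' i)\<^sup>2)" by blast
    have "complex_of_int D' = complex_of_int D" unfolding D' D[OF fac'] ..
    then show "D' = D" by (simp only: of_int_eq_iff)
  qed
  then show thesis using that[OF fac] D[OF fac] by simp
qed

text \<open>In coordinates with (x, y) at (1, 0), \<open>b 0\<close> is F(x, y) and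
  \<open>b 1\<close> is its derivative along the second basis vector. The discriminant is the
  determinant formed from \<open>b\<close>; were the valuation of \<open>b 1\<close> larger than
  half that of the discriminant, the divisibility lemma would put one more power of p into the
  discriminant than it has.\<close>

lemma unimodular_expansion:
  assumes n: "n \<ge> 2" and F: "binary_form n F" "form_disc n F \<noteq> 0" and prim: "gcd x y = 1"
  shows "\<exists>x' y' (b :: nat \<Rightarrow> int). x * y' - x' * y = 1 \<and>
    (\<forall>u v. eval2 F (u * x + v * x') (u * y + v * y') = (\<Sum>k\<le>n. b k * v ^ k * u ^ (n - k))) \<and>
    (\<forall>p. prime p \<longrightarrow> p ^ (multiplicity p (form_disc n F) + 1) dvd b 0
       \<longrightarrow> b 1 \<noteq> 0 \<and> 2 * multiplicity p (b 1) \<le> multiplicity p (form_disc n F))"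
proof -
  have hom: "homogeneous n F" and "F \<noteq> 0" using F by (auto simp: binary_form_def homogeneous_def)
  obtain \<alpha> \<beta> where fac: "complexify F = (\<Prod>i<n. lin_form (\<alpha> i) (\<beta> i))"
    and D: "of_int (form_disc n F) = (\<Prod>j<n. \<Prod>i<j. (\<alpha> i * \<beta> j - \<alpha> j * \<beta> i)\<^sup>2)"
    using form_disc_factorization[of n F] n F(1) by auto
  obtain s t where st: "s * x + t * y = 1" using bezout_int[of x y] prim by auto
  have "subst_poly n F (- t) s (-x) (-y) \<noteq> 0"
    by (rule subst_poly_nonzero[OF hom fac \<open>F \<noteq> 0\<close>]) (use st in \<open>simp add: algebra_simps\<close>)
  \<comment> \<open>Adding a multiple of (x, y) to the second basis vector keeps the determinant and
    makes F non-zero there, as the determinant formula requires.\<close>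
  then obtain z where "poly (subst_poly n F (- t) s (-x) (-y)) z \<noteq> 0"
    using poly_all_0_iff_0 by blast
  then have lead: "eval2 F (- t - z * x) (s - z * y) \<noteq> 0" by (simp add: poly_subst_poly[OF hom])
  define x' y' where "x' = - t - z * x" and "y' = s - z * y"
  define g where "g = subst_poly n F x y x' y'"
  have det: "x * y' - x' * y = 1" using st by (simp add: x'_def y'_def algebra_simps)
  have deg: "degree g \<le> n"
  proof -
    have "degree g = degree (map_poly (of_int :: int \<Rightarrow> complex) g)"
      by (simp add: degree_map_poly)
    then show ?thesis
      unfolding g_def map_poly_of_int_subst_poly[OF hom fac]
      using degree_linear_prod_le[of "\<lambda>i. \<beta> i * of_int y - \<alpha> i * of_int x" "\<lambda>i. \<alpha> i * of_int x' - \<beta> i * of_int y'" "{..<n}"]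
      by simp
  qed
  \<comment> \<open>For non-zero u, divide by \<open>u ^ n\<close> and evaluate at v / u. For u = 0
    only the top term survives, and its coefficient is F(x', y').\<close>
  have expansion: "eval2 F (u * x + v * x') (u * y + v * y') = (\<Sum>k\<le>n. coeff g k * v ^ k * u ^ (n - k))" for u v
  proof (cases "u = 0")
    case True
    have "(\<Sum>k\<le>n. coeff g k * v ^ k * u ^ (n - k)) = (\<Sum>k\<le>n. if k = n then coeff g n * v ^ n else 0)"
      using True by (intro sum.cong) auto
    also have "\<dots> = coeff g n * v ^ n" by simp
    also have "\<dots> = eval2 F (v * x') (v * y')"
      unfolding g_def coeff_subst_poly_lead[OF hom fac] eval2_homogeneous[OF hom] sum_distrib_right
      by (intro sum.cong) (auto simp: power_mult_distrib power_add[symmetric] mult_ac)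
    finally show ?thesis using True by simp
  next
    case False
    let ?u = "of_int u :: complex" and ?v = "of_int v :: complex"
    have u: "?u \<noteq> 0" using False by simp
    have "of_int (\<Sum>k\<le>n. coeff g k * v ^ k * u ^ (n - k)) = ?u ^ n * (\<Sum>k\<le>n. of_int (coeff g k) * (?v / ?u) ^ k)"
      unfolding sum_distrib_left of_int_sum
      by (intro sum.cong refl) (use u in \<open>simp add: power_divide power_diff[OF u]\<close>)
    also have "(\<Sum>k\<le>n. of_int (coeff g k) * (?v / ?u) ^ k) = poly (map_poly of_int g) (?v / ?u)"
      by (subst poly_altdef_le[of _ n]) (use deg in \<open>auto simp: degree_map_poly coeff_map_poly\<close>)
    also have "?u ^ n * \<dots> = (\<Prod>i<n. ?u) * (\<Prod>i<n. \<alpha> i * (of_int x + ?v / ?u * of_int x') - \<beta> i * (of_int y + ?v / ?u * of_int y'))"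
      unfolding g_def poly_map_of_int_subst_poly[OF hom] fac eval2_prod_lin_form by simp
    also have "\<dots> = (\<Prod>i<n. \<alpha> i * of_int (u * x + v * x') - \<beta> i * of_int (u * y + v * y'))"
      unfolding prod.distrib[symmetric] by (intro prod.cong) (use u in \<open>auto simp: field_simps\<close>)
    also have "\<dots> = of_int (eval2 F (u * x + v * x') (u * y + v * y'))"
      unfolding eval2_complexify[OF hom, symmetric] fac eval2_prod_lin_form ..
    finally show ?thesis by (simp only: of_int_eq_iff)
  qed
  have leadg: "coeff g n \<noteq> 0"
    unfolding g_def coeff_subst_poly_lead[OF hom fac] using lead by (simp add: x'_def y'_def)
  have "of_int (det (disc_coeff_mat (coeff g) n)) = (of_int (form_disc n F) :: complex)"
    unfolding D g_def by (rule form_disc_subst_poly[OF hom fac det]) (use leadg in \<open>simp add: g_def\<close>)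
  then have disc: "form_disc n F = det (disc_coeff_mat (coeff g) n)" by (simp only: of_int_eq_iff)
  have sym: "bez (coeff g) j k = bez (coeff g) k j" for j k
    using bez_commute[OF map_poly_of_int_subst_poly[OF hom fac]] unfolding g_def .
  have "coeff g 1 \<noteq> 0 \<and> 2 * multiplicity p (coeff g 1) \<le> multiplicity p (form_disc n F)"
    if p: "prime p" "p ^ (multiplicity p (form_disc n F) + 1) dvd coeff g 0" for p
  proof (rule ccontr)
    define m where "m = multiplicity p (form_disc n F)"
    \<comment> \<open>\<open>h\<close> is (m + 1) / 2 rounded up, so a multiplicity whose double
      exceeds m is at least \<open>h\<close>.\<close>
    define h where "h = (m + 2) div 2"
    have h: "h \<le> m + 1" "m + 1 \<le> 2 * h" by (auto simp: h_def)
    assume "\<not> ?thesis"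
    then have "coeff g 1 = 0 \<or> h \<le> multiplicity p (coeff g 1)"
      unfolding h_def m_def by linarith
    then have "p ^ h dvd coeff g 1" by (auto intro: multiplicity_dvd')
    moreover have "p ^ h dvd coeff g 0" using p(2) h(1) unfolding m_def
      by (metis dvd_trans le_imp_power_dvd)
    moreover have "p ^ (m + 1) dvd p ^ h * p ^ h"
      using h(2) by (metis le_imp_power_dvd mult_2 power_add)
    ultimately have "p ^ (m + 1) dvd form_disc n F"
      unfolding disc using dvd_det_disc_coeff_mat[OF n _ _ p(2)[folded m_def] _ sym] by blast
    then have "m + 1 \<le> m"
      unfolding m_def using F(2) p(1) by (intro multiplicity_geI) auto
    then show False by simp
  qed
  then show ?thesis using det expansion by blast
qed

section \<open>Local and real geometry of the zeros\<close>

text \<open>The value is \<open>b 0 * u ^ n + b 1 * v * u ^ (n - 1)\<close> plus a multiple of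
  \<open>v ^ 2\<close>. As \<open>v\<close> is divisible by \<open>p ^ (g + 1)\<close> but
  \<open>b 1\<close> at most by \<open>p ^ g\<close>, the quadratic part has strictly larger
  valuation than the linear term. The latter therefore has to account for all of
  \<open>p ^ k\<close>, and \<open>b 1\<close> supplies at most g of it.\<close>

lemma separation_expansion:
  fixes b :: "nat \<Rightarrow> int" and p u v :: int
  assumes p: "prime p" and n: "n \<ge> 1" and b1: "b 1 \<noteq> 0" "multiplicity p (b 1) \<le> g"
    and u: "\<not> p dvd u" and v: "p ^ (g + 1) dvd v"
    and k: "p ^ k dvd b 0" "p ^ k dvd (\<Sum>k\<le>n. b k * v ^ k * u ^ (n - k))"
  shows "p ^ (k - g) dvd v"
proof (cases "v = 0")
  case False
  define e where "e = multiplicity p v"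
  define h where "h = multiplicity p (b 1)"
  have p0: "p \<noteq> 0" "\<not> is_unit p" using p by auto
  obtain v' where v': "v = p ^ e * v'" "\<not> p dvd v'"
    using multiplicity_decompose'[of v p] False p0 unfolding e_def by metis
  obtain c where c: "b 1 = p ^ h * c" "\<not> p dvd c"
    using multiplicity_decompose'[of "b 1" p] b1 p0 unfolding h_def by metis
  have e: "g + 1 \<le> e" unfolding e_def using v False p0 by (intro multiplicity_geI) auto
  have hg: "h \<le> g" using b1 by (simp add: h_def)
  define r where "r = (\<Sum>k = 2..n. b k * v ^ (k - 2) * u ^ (n - k))"
  have "{..n} = insert 0 (insert 1 {2..n})" using n by auto
  then have "(\<Sum>k\<le>n. b k * v ^ k * u ^ (n - k))
      = b 0 * u ^ n + b 1 * v * u ^ (n - 1) + (\<Sum>k = 2..n. b k * v ^ k * u ^ (n - k))"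
    by simp
  also have "(\<Sum>k = 2..n. b k * v ^ k * u ^ (n - k)) = v ^ 2 * r"
    unfolding r_def sum_distrib_left
  proof (intro sum.cong refl)
    fix k assume "k \<in> {2..n}"
    then have "v ^ k = v ^ 2 * v ^ (k - 2)" by (metis atLeastAtMost_iff le_add_diff_inverse power_add)
    then show "b k * v ^ k * u ^ (n - k) = v ^ 2 * (b k * v ^ (k - 2) * u ^ (n - k))" by simp
  qed
  finally have "p ^ k dvd b 0 * u ^ n + (b 1 * v * u ^ (n - 1) + v ^ 2 * r)"
    using k(2) by (simp add: add.assoc)
  then have "p ^ k dvd b 1 * v * u ^ (n - 1) + v ^ 2 * r"
    using k(1) by (meson dvd_add_right_iff dvd_mult2)
  moreover define w where "w = c * v' * u ^ (n - 1) + p ^ (e - h) * (v' ^ 2 * r)"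
  have "b 1 * v * u ^ (n - 1) + v ^ 2 * r = p ^ (h + e) * (c * v' * u ^ (n - 1) + p ^ (e - h) * (v' ^ 2 * r))"
  proof -
    have "p ^ (h + e) * p ^ (e - h) = p ^ e * p ^ e" using e hg by (simp flip: power_add)
    then have "p ^ (h + e) * (c * v' * u ^ (n - 1) + p ^ (e - h) * (v' ^ 2 * r))
        = p ^ h * p ^ e * (c * v' * u ^ (n - 1)) + p ^ e * p ^ e * (v' ^ 2 * r)"
      by (simp only: distrib_left mult.assoc[symmetric] power_add)
    then show ?thesis unfolding c(1) v'(1) by (simp add: algebra_simps power2_eq_square)
  qed
  moreover have "\<not> p dvd c * v' * u ^ (n - 1) + p ^ (e - h) * (v' ^ 2 * r)"
  proof -
    have "p dvd p ^ (e - h) * (v' ^ 2 * r)" using e hg by (intro dvd_mult2 dvd_power) auto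
    moreover have "\<not> p dvd c * v' * u ^ (n - 1)"
      using p c v' u by (auto simp: prime_dvd_mult_iff dest: prime_dvd_power)
    ultimately show ?thesis by (simp only: dvd_add_left_iff not_False_eq_True)
  qed
  ultimately have dvd: "p ^ k dvd p ^ (h + e) * w" and w: "\<not> p dvd w" by (auto simp: w_def)
  have "k \<le> h + e"
  proof (rule ccontr)
    assume "\<not> k \<le> h + e"
    then have "p ^ (h + e + 1) dvd p ^ k" by (intro le_imp_power_dvd) auto
    then have "p ^ (h + e) * p dvd p ^ (h + e) * w" using dvd_trans dvd
      by (metis Suc_eq_plus1 power_Suc2)
    then show False using w p0 by simp
  qed
  then have "k - g \<le> e" using hg by linarith
  then show ?thesis using v'(1) by (metis dvd_mult2 le_imp_power_dvd)
qed simp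

section \<open>Hensel lifting to an exact valuation\<close>

lemma diff_dvd_poly_diff: "(x - y) dvd poly p x - poly p (y::'a::comm_ring_1)"
proof (induction p)
  case (pCons a p)
  have "poly (pCons a p) x - poly (pCons a p) y = (x - y) * poly p x + y * (poly p x - poly p y)"
    by (simp add: algebra_simps)
  then show ?case using pCons by (simp add: dvd_add)
qed simp

text \<open>A Taylor step that uses the slope at 0 instead of the slope at \<open>t\<close>: both
  points are divisible by \<open>p ^ (h + 1)\<close>, so the slopes differ by a multiple of it. The
  same \<open>coeff \<gamma> 1\<close> thus serves every iteration.\<close>

lemma hensel_step:
  fixes \<gamma> :: "int poly" and p :: int
  assumes p: "p ^ (h + 1) dvd t" "p ^ (h + 1) dvd s"
  obtains E where "poly \<gamma> (t + s) = poly \<gamma> t + s * (coeff \<gamma> 1 + p ^ (h + 1) * E)"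
proof -
  obtain a0 \<gamma>0 where g0: "\<gamma> = pCons a0 \<gamma>0" by (cases \<gamma>)
  obtain a1 r where r: "\<gamma>0 = pCons a1 r" by (cases \<gamma>0)
  have g: "\<gamma> = pCons a0 (pCons a1 r)" using g0 r by simp
  obtain t' s' where ts: "t = p ^ (h + 1) * t'" "s = p ^ (h + 1) * s'" using p by (auto elim!: dvdE)
  have "(t + s) - t dvd poly r (t + s) - poly r t" by (rule diff_dvd_poly_diff)
  then obtain e where e: "poly r (t + s) = poly r t + s * e" by (metis add_diff_cancel_left' diff_add_cancel add.commute dvdE)
  have "poly \<gamma> (t + s) = poly \<gamma> t + s * (a1 + ((2 * t + s) * poly r t + (t + s) ^ 2 * e))"
    unfolding g by (simp add: e) (simp add: algebra_simps power2_eq_square)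
  also have "(2 * t + s) * poly r t + (t + s) ^ 2 * e
     = p ^ (h + 1) * ((2 * t' + s') * poly r t + (t + s) * (t' + s') * e)"
    unfolding ts by (simp add: algebra_simps power2_eq_square)
  finally show thesis using that[of "(2 * t' + s') * poly r t + (t + s) * (t' + s') * e"] by (simp add: g)
qed

text \<open>Moving \<open>t\<close> by \<open>p ^ (m - h) * s\<close> changes the value by
  \<open>p ^ m * (s * c)\<close> modulo \<open>p ^ (m + 1)\<close>, with \<open>c\<close> prime to
  p. The move must stay divisible by \<open>p ^ (h + 1)\<close>, that is 2 h < m, which follows from
  2 h <= g < m.\<close>

lemma hensel_exact:
  fixes \<gamma> :: "int poly" and p :: int
  assumes p: "prime p" and b1: "coeff \<gamma> 1 \<noteq> 0" "2 * multiplicity p (coeff \<gamma> 1) \<le> g"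
    and b0: "p ^ (g + 1) dvd coeff \<gamma> 0" and m: "g + 1 \<le> m"
  shows "\<exists>t. p ^ m dvd poly \<gamma> t \<and> \<not> p ^ (m + 1) dvd poly \<gamma> t"
proof -
  define h where "h = multiplicity p (coeff \<gamma> 1)"
  have p0: "p \<noteq> 0" "\<not> is_unit p" using p by auto
  obtain c where c: "coeff \<gamma> 1 = p ^ h * c" "\<not> p dvd c"
    using multiplicity_decompose'[of "coeff \<gamma> 1" p] b1 p0 unfolding h_def by metis
  have newton: "\<exists>E. poly \<gamma> (t + p ^ (m - h) * s) = poly \<gamma> t + p ^ m * (s * c) + p ^ (m + 1) * (s * E)"
    if t: "p ^ (h + 1) dvd t" and m: "g + 1 \<le> m" for t s m
  proof -
    have hm: "h + 1 \<le> m - h" using m b1 by (simp add: h_def)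
    have "p ^ (h + 1) dvd p ^ (m - h) * s" using hm by (intro dvd_mult2 le_imp_power_dvd)
    then obtain E where E: "poly \<gamma> (t + p ^ (m - h) * s)
        = poly \<gamma> t + p ^ (m - h) * s * (coeff \<gamma> 1 + p ^ (h + 1) * E)"
      using hensel_step[OF t] by blast
    have "p ^ (m - h) * p ^ h = p ^ m" using hm by (simp flip: power_add)
    then have "p ^ h * p ^ (m - h) = p ^ m" by (simp add: mult.commute)
    then have "p ^ (m - h) * s * (coeff \<gamma> 1 + p ^ (h + 1) * E) = p ^ m * (s * c) + p ^ (m + 1) * (s * E)"
      unfolding c(1) by (simp add: algebra_simps)
    then show ?thesis using E by (auto simp: add.assoc)
  qed
  have "\<exists>t. p ^ (h + 1) dvd t \<and> p ^ m dvd poly \<gamma> t"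
    using m
  proof (induction m rule: dec_induct)
    case base
    then show ?case using b0 by (intro exI[of _ 0]) (simp add: poly_0_coeff_0)
  next
    case (step j)
    then obtain t where t1: "p ^ (h + 1) dvd t" "p ^ j dvd poly \<gamma> t" by blast
    then obtain a where "poly \<gamma> t = p ^ j * a" by (auto elim: dvdE)
    note t = t1(1) this
    have "coprime c p" using p c(2) by (metis coprime_commute prime_imp_coprime)
    then obtain i where "[c * i = 1] (mod p)" using cong_solve_coprime_int by blast
    then have "[c * i * (- a) = 1 * (- a)] (mod p)" by (rule cong_scalar_right)
    \<comment> \<open>This \<open>s\<close> cancels the lowest remaining digit \<open>a\<close> of
      the value modulo p.\<close>
    moreover define s where "s = - (i * a)"
    ultimately have "p dvd c * s + a" by (simp add: cong_iff_dvd_diff mult.assoc)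
    then obtain d where d: "c * s + a = p * d" by (auto elim!: dvdE)
    obtain E where E: "poly \<gamma> (t + p ^ (j - h) * s) = poly \<gamma> t + p ^ j * (s * c) + p ^ (j + 1) * (s * E)"
      using newton[OF t(1) step(1)] by blast
    also have "\<dots> = p ^ j * (c * s + a) + p ^ (j + 1) * (s * E)" using t(2) by (simp add: algebra_simps)
    also have "\<dots> = p ^ Suc j * (d + s * E)" unfolding d by (simp add: algebra_simps)
    finally have "p ^ Suc j dvd poly \<gamma> (t + p ^ (j - h) * s)" by simp
    moreover have "h + 1 \<le> j - h" using step(1) b1 by (simp add: h_def)
    then have "p ^ (h + 1) dvd t + p ^ (j - h) * s" using t(1)
      by (intro dvd_add dvd_mult2 le_imp_power_dvd)
    ultimately show ?case by blast
  qed
  then obtain t where t: "p ^ (h + 1) dvd t" "p ^ m dvd poly \<gamma> t" by blast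
  show ?thesis
  proof (cases "p ^ (m + 1) dvd poly \<gamma> t")
    case False
    then show ?thesis using t by blast
  next
    case True
    \<comment> \<open>The valuation is too large, and a move with s = 1 adds a nonzero digit at
      exactly \<open>p ^ m\<close>.\<close>
    obtain E where E: "poly \<gamma> (t + p ^ (m - h) * 1) = poly \<gamma> t + p ^ m * (1 * c) + p ^ (m + 1) * (1 * E)"
      using newton[OF t(1) m] by blast
    have "\<not> p ^ (m + 1) dvd p ^ m * c" using c(2) p0 by simp
    moreover have "p ^ (m + 1) dvd poly \<gamma> t + p ^ (m + 1) * E" using True by (rule dvd_add) simp
    ultimately have "\<not> p ^ (m + 1) dvd p ^ m * c + (poly \<gamma> t + p ^ (m + 1) * E)"
      by (simp only: dvd_add_left_iff not_False_eq_True)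
    then have "\<not> p ^ (m + 1) dvd poly \<gamma> (t + p ^ (m - h))"
      using E by (simp add: algebra_simps)
    moreover have "p ^ m dvd poly \<gamma> (t + p ^ (m - h))"
      using E t(2) by (simp add: dvd_add dvd_mult2)
    ultimately show ?thesis by blast
  qed
qed

text \<open>Let \<open>l i\<close> be the smallest form at t. Every other \<open>l j\<close> is
  bounded below, since the fixed non-zero determinant of the two forms equals
  \<open>\<alpha> j * l i - \<alpha> i * l j\<close> and is thus at most
  \<open>2 * A * norm (l j)\<close>. So \<open>l i\<close> is at most a constant times the product,
  and t is correspondingly close to the real part of the root of \<open>l i\<close>.\<close>

lemma linear_forms_cover:
  fixes \<alpha> \<beta> :: "nat \<Rightarrow> complex"
  assumes n: "n \<ge> 2" and \<delta>: "\<And>i j. i < n \<Longrightarrow> j < n \<Longrightarrow> i \<noteq> j \<Longrightarrow> \<alpha> i * \<beta> j - \<alpha> j * \<beta> i \<noteq> 0"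
  shows "\<exists>D > 0. \<exists>c :: nat \<Rightarrow> real. \<forall>t. \<bar>t\<bar> \<le> 1 \<longrightarrow>
    (\<exists>i<n. \<bar>t - c i\<bar> \<le> D * (\<Prod>i<n. norm (\<alpha> i * of_real t - \<beta> i)))"
proof -
  define I where "I = {(i, j). i < n \<and> j < n \<and> i \<noteq> j}"
  define \<kappa>0 where "\<kappa>0 = Min ((\<lambda>(i, j). norm (\<alpha> i * \<beta> j - \<alpha> j * \<beta> i)) ` I)"
  have I: "finite I" "I \<noteq> {}"
  proof -
    show "finite I" by (rule finite_subset[of _ "{..<n} \<times> {..<n}"]) (auto simp: I_def)
    have "(0, 1) \<in> I" using n by (simp add: I_def)
    then show "I \<noteq> {}" by blast
  qed
  have "\<kappa>0 \<in> (\<lambda>(i, j). norm (\<alpha> i * \<beta> j - \<alpha> j * \<beta> i)) ` I"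
    unfolding \<kappa>0_def using I by (intro Min_in) auto
  then have \<kappa>0: "\<kappa>0 > 0" using \<delta> by (auto simp: I_def)
  have \<kappa>0_le: "\<kappa>0 \<le> norm (\<alpha> i * \<beta> j - \<alpha> j * \<beta> i)" if "i < n" "j < n" "i \<noteq> j" for i j
    unfolding \<kappa>0_def using I that by (intro Min_le) (auto simp: I_def image_iff)
  define A where "A = 1 + (\<Sum>i<n. norm (\<alpha> i))"
  have A1: "A \<ge> 1" unfolding A_def by (simp add: sum_nonneg)
  have A: "norm (\<alpha> i) \<le> A" if "i < n" for i
    using member_le_sum[of i "{..<n}" "\<lambda>i. norm (\<alpha> i)"] that by (simp add: A_def)
  define \<kappa> where "\<kappa> = \<kappa>0 / (2 * A)"
  have \<kappa>: "\<kappa> > 0" using \<kappa>0 A1 by (simp add: \<kappa>_def)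
  \<comment> \<open>This is the factor between \<open>norm (l i)\<close> and the distance to the
    centre. If \<open>\<alpha> i = 0\<close>, the form is the constant \<open>- \<beta> i\<close>,
    which is non-zero; the centre is then 0 and the distance is at most 1.\<close>
  define mm where "mm i = (if \<alpha> i = 0 then norm (\<beta> i) else norm (\<alpha> i))" for i
  have mm: "mm i > 0" if "i < n" for i
  proof -
    define j where "j = (if i = 0 then 1 else 0 :: nat)"
    have "j < n" "j \<noteq> i" using n by (auto simp: j_def)
    then show ?thesis using \<delta>[of i j] that by (auto simp: mm_def)
  qed
  define \<mu> where "\<mu> = Min (mm ` {..<n})"
  have \<mu>: "\<mu> > 0"
  proof -
    have "\<mu> \<in> mm ` {..<n}" unfolding \<mu>_def using n by (intro Min_in) (auto simp: lessThan_empty_iff)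
    then show ?thesis using mm by auto
  qed
  have \<mu>_le: "\<mu> \<le> mm i" if "i < n" for i unfolding \<mu>_def using that by (intro Min_le) auto
  define c where "c i = (if \<alpha> i = 0 then 0 else Re (\<beta> i / \<alpha> i))" for i
  define D where "D = 1 / (\<mu> * \<kappa> ^ (n - 1))"
  have D: "D > 0" using \<mu> \<kappa> by (simp add: D_def)
  have "\<exists>i<n. \<bar>t - c i\<bar> \<le> D * (\<Prod>i<n. norm (\<alpha> i * of_real t - \<beta> i))" if t: "\<bar>t\<bar> \<le> 1" for t
  proof -
    define l where "l i = \<alpha> i * of_real t - \<beta> i" for i
    have "Min ((\<lambda>i. norm (l i)) ` {..<n}) \<in> (\<lambda>i. norm (l i)) ` {..<n}"
      using n by (intro Min_in) (auto simp: lessThan_empty_iff)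
    then obtain i where i: "i < n" "norm (l i) = Min ((\<lambda>i. norm (l i)) ` {..<n})" by auto
    then have min: "norm (l i) \<le> norm (l j)" if "j < n" for j using that by simp
    have far: "\<kappa> \<le> norm (l j)" if j: "j < n" "j \<noteq> i" for j
    proof -
      have "\<alpha> i * \<beta> j - \<alpha> j * \<beta> i = \<alpha> j * l i - \<alpha> i * l j" by (simp add: l_def algebra_simps)
      then have "\<kappa>0 \<le> norm (\<alpha> j * l i - \<alpha> i * l j)" using \<kappa>0_le[of i j] i j by simp
      also have "\<dots> \<le> norm (\<alpha> j) * norm (l i) + norm (\<alpha> i) * norm (l j)"
        using norm_triangle_ineq4[of "\<alpha> j * l i" "\<alpha> i * l j"] by (simp add: norm_mult)
      also have "\<dots> \<le> A * norm (l j) + A * norm (l j)"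
        using A[of i] A[of j] min[of j] i(1) j A1 by (intro add_mono mult_mono) auto
      finally show ?thesis using A1 by (simp add: \<kappa>_def field_simps)
    qed
    have "\<bar>t - c i\<bar> \<le> norm (l i) / mm i"
    proof (cases "\<alpha> i = 0")
      case True
      then show ?thesis using t mm[OF i(1)] by (simp add: c_def mm_def l_def)
    next
      case False
      have "\<bar>t - c i\<bar> = \<bar>Re (of_real t - \<beta> i / \<alpha> i)\<bar>" using False by (simp add: c_def)
      also have "\<dots> \<le> norm (of_real t - \<beta> i / \<alpha> i)" by (rule abs_Re_le_cmod)
      also have "of_real t - \<beta> i / \<alpha> i = l i / \<alpha> i" using False by (simp add: l_def field_simps)
      finally show ?thesis using False by (simp add: mm_def norm_divide)
    qed
    also have "\<dots> \<le> norm (l i) / \<mu>" using \<mu> \<mu>_le[OF i(1)] by (intro divide_left_mono) auto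
    also have "\<dots> = D * (norm (l i) * \<kappa> ^ (n - 1))" using \<kappa> by (simp add: D_def)
    also have "\<dots> \<le> D * (norm (l i) * (\<Prod>j\<in>{..<n} - {i}. norm (l j)))"
    proof (intro mult_left_mono)
      have "\<kappa> ^ (n - 1) = (\<Prod>j\<in>{..<n} - {i}. \<kappa>)" using i by simp
      also have "\<dots> \<le> (\<Prod>j\<in>{..<n} - {i}. norm (l j))" using far \<kappa> by (intro prod_mono) auto
      finally show "\<kappa> ^ (n - 1) \<le> (\<Prod>j\<in>{..<n} - {i}. norm (l j))" .
    qed (use D in auto)
    also have "norm (l i) * (\<Prod>j\<in>{..<n} - {i}. norm (l j)) = (\<Prod>j<n. norm (l j))"
      using i by (simp add: prod.remove[of "{..<n}" i])
    finally show ?thesis using i(1) unfolding l_def by blast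
  qed
  then show ?thesis using D by blast
qed

text \<open>Two charts keep the slope in [-1, 1], where the constants are uniform. Exchanging the
  variables exchanges \<open>\<alpha>\<close> and \<open>\<beta>\<close> up to signs that the norm
  ignores.\<close>

lemma form_cover:
  assumes n: "n \<ge> 2" and F: "binary_form n F" "form_disc n F \<noteq> 0"
  shows "\<exists>D > 0. \<exists>c. \<forall>x y. y \<noteq> 0 \<longrightarrow> \<bar>x\<bar> \<le> \<bar>y\<bar> \<longrightarrow>
      (\<exists>i<n. \<bar>real_of_int x / real_of_int y - c i\<bar> \<le> D * \<bar>real_of_int (eval2 F x y)\<bar> / \<bar>real_of_int y\<bar> ^ n)"
    and "\<exists>D > 0. \<exists>c. \<forall>x y. y \<noteq> 0 \<longrightarrow> \<bar>x\<bar> \<le> \<bar>y\<bar> \<longrightarrow>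
      (\<exists>i<n. \<bar>real_of_int x / real_of_int y - c i\<bar> \<le> D * \<bar>real_of_int (eval2 F y x)\<bar> / \<bar>real_of_int y\<bar> ^ n)"
proof -
  have hom: "homogeneous n F" using F by (auto simp: binary_form_def homogeneous_def)
  obtain \<alpha> \<beta> where fac: "complexify F = (\<Prod>i<n. lin_form (\<alpha> i) (\<beta> i))"
    and D: "of_int (form_disc n F) = (\<Prod>j<n. \<Prod>i<j. (\<alpha> i * \<beta> j - \<alpha> j * \<beta> i)\<^sup>2)"
    using form_disc_factorization[of n F] n F(1) by auto
  have lt: "\<alpha> i * \<beta> j - \<alpha> j * \<beta> i \<noteq> 0" if "i < j" "j < n" for i j
  proof
    assume "\<alpha> i * \<beta> j - \<alpha> j * \<beta> i = 0"
    then have "(\<Prod>i<j. (\<alpha> i * \<beta> j - \<alpha> j * \<beta> i)\<^sup>2) = 0" using that(1) by (intro prod_zero) auto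
    then have "(\<Prod>j<n. \<Prod>i<j. (\<alpha> i * \<beta> j - \<alpha> j * \<beta> i)\<^sup>2) = 0" using that(2) by (intro prod_zero) auto
    then have "complex_of_int (form_disc n F) = 0" unfolding D .
    then show False using F(2) by simp
  qed
  have \<delta>: "\<alpha> i * \<beta> j - \<alpha> j * \<beta> i \<noteq> 0" if "i < n" "j < n" "i \<noteq> j" for i j
    using lt[of i j] lt[of j i] that by (cases "i < j") auto
  have val: "\<bar>real_of_int (eval2 F x y)\<bar> = (\<Prod>i<n. norm (\<alpha> i * of_int x - \<beta> i * of_int y))" for x y
  proof -
    have "\<bar>real_of_int (eval2 F x y)\<bar> = norm (complex_of_int (eval2 F x y))" by simp
    also have "\<dots> = (\<Prod>i<n. norm (\<alpha> i * of_int x - \<beta> i * of_int y))"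
      unfolding eval2_complexify[OF hom, symmetric] fac eval2_prod_lin_form by (simp add: prod_norm)
    finally show ?thesis .
  qed
  have scale: "(\<Prod>i<n. norm (a i * of_int x - b i * of_int y)) / \<bar>real_of_int y\<bar> ^ n
      = (\<Prod>i<n. norm (a i * of_real (real_of_int x / real_of_int y) - b i))" if "y \<noteq> 0"
    for a b :: "nat \<Rightarrow> complex" and x y
  proof -
    have "norm (a i * of_real (real_of_int x / real_of_int y) - b i) = norm (a i * of_int x - b i * of_int y) / \<bar>real_of_int y\<bar>" for i
    proof -
      have "a i * of_real (real_of_int x / real_of_int y) - b i = (a i * of_int x - b i * of_int y) / of_int y"
        using that by (simp add: field_simps)
      then show ?thesis by (simp add: norm_divide)
    qed
    then show ?thesis by (simp add: prod_dividef)
  qed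
  have cov: "\<exists>D > 0. \<exists>c. \<forall>x y. y \<noteq> 0 \<longrightarrow> \<bar>x\<bar> \<le> \<bar>y\<bar> \<longrightarrow>
      (\<exists>i<n. \<bar>real_of_int x / real_of_int y - c i\<bar> \<le> D * \<Phi> x y / \<bar>real_of_int y\<bar> ^ n)"
    if ab: "\<And>i j. i < n \<Longrightarrow> j < n \<Longrightarrow> i \<noteq> j \<Longrightarrow> a i * b j - a j * b i \<noteq> 0"
      and \<Phi>: "\<And>x y. \<Phi> x y = (\<Prod>i<n. norm (a i * of_int x - b i * of_int y))"
    for a b :: "nat \<Rightarrow> complex" and \<Phi> :: "int \<Rightarrow> int \<Rightarrow> real"
  proof -
    have "\<exists>D > 0. \<exists>c :: nat \<Rightarrow> real. \<forall>t. \<bar>t\<bar> \<le> 1 \<longrightarrow>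
      (\<exists>i<n. \<bar>t - c i\<bar> \<le> D * (\<Prod>i<n. norm (a i * of_real t - b i)))"
      by (rule linear_forms_cover[OF n]) (rule ab)
    then obtain D and c :: "nat \<Rightarrow> real" where Dc: "D > 0" "\<And>t. \<bar>t\<bar> \<le> 1 \<Longrightarrow>
      (\<exists>i<n. \<bar>t - c i\<bar> \<le> D * (\<Prod>i<n. norm (a i * of_real t - b i)))" by blast
    have "\<exists>i<n. \<bar>real_of_int x / real_of_int y - c i\<bar> \<le> D * \<Phi> x y / \<bar>real_of_int y\<bar> ^ n"
      if "y \<noteq> 0" "\<bar>x\<bar> \<le> \<bar>y\<bar>" for x y
    proof -
      have "\<bar>real_of_int x\<bar> \<le> \<bar>real_of_int y\<bar>" using that(2) by (metis of_int_abs of_int_le_iff)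
      then have "\<bar>real_of_int x / real_of_int y\<bar> \<le> 1" using that(1) by (simp add: abs_divide)
      then show ?thesis
        using Dc(2)[of "real_of_int x / real_of_int y"] unfolding scale[OF that(1), symmetric] \<Phi> by simp
    qed
    then show ?thesis using Dc(1) by blast
  qed
  show "\<exists>D > 0. \<exists>c. \<forall>x y. y \<noteq> 0 \<longrightarrow> \<bar>x\<bar> \<le> \<bar>y\<bar> \<longrightarrow>
      (\<exists>i<n. \<bar>real_of_int x / real_of_int y - c i\<bar> \<le> D * \<bar>real_of_int (eval2 F x y)\<bar> / \<bar>real_of_int y\<bar> ^ n)"
    by (rule cov[of \<alpha> \<beta>]) (use \<delta> val in auto)
  show "\<exists>D > 0. \<exists>c. \<forall>x y. y \<noteq> 0 \<longrightarrow> \<bar>x\<bar> \<le> \<bar>y\<bar> \<longrightarrow>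
      (\<exists>i<n. \<bar>real_of_int x / real_of_int y - c i\<bar> \<le> D * \<bar>real_of_int (eval2 F y x)\<bar> / \<bar>real_of_int y\<bar> ^ n)"
  proof (rule cov[of \<beta> \<alpha>])
    show "\<beta> i * \<alpha> j - \<beta> j * \<alpha> i \<noteq> 0" if "i < n" "j < n" "i \<noteq> j" for i j
      using \<delta>[of i j] that by (simp add: mult.commute)
    show "\<bar>real_of_int (eval2 F y x)\<bar> = (\<Prod>i<n. norm (\<beta> i * of_int x - \<alpha> i * of_int y))" for x y
      unfolding val by (simp add: norm_minus_commute)
  qed
qed

section \<open>Size, p-adic separation and exact valuations of a form\<close>

lemma form_bound:
  assumes hom: "homogeneous n F"
  shows "\<exists>K \<ge> 1. \<forall>x y B. \<bar>real_of_int x\<bar> \<le> B \<longrightarrow> \<bar>real_of_int y\<bar> \<le> B \<longrightarrow>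
    \<bar>real_of_int (eval2 F x y)\<bar> \<le> K * B ^ n"
proof -
  define K where "K = 1 + (\<Sum>j\<le>n. \<bar>real_of_int (coeff (coeff F j) (n - j))\<bar>)"
  have K: "K \<ge> 1" by (simp add: K_def sum_nonneg)
  have "\<bar>real_of_int (eval2 F x y)\<bar> \<le> K * B ^ n"
    if xy: "\<bar>real_of_int x\<bar> \<le> B" "\<bar>real_of_int y\<bar> \<le> B" for x y B
  proof -
    have "\<bar>real_of_int (eval2 F x y)\<bar> \<le> (\<Sum>j\<le>n. \<bar>real_of_int (coeff (coeff F j) (n - j) * x ^ (n - j) * y ^ j)\<bar>)"
      unfolding eval2_homogeneous[OF hom] of_int_sum by (rule sum_abs)
    also have "\<dots> \<le> (\<Sum>j\<le>n. \<bar>real_of_int (coeff (coeff F j) (n - j))\<bar> * B ^ n)"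
    proof (rule sum_mono)
      fix j assume j: "j \<in> {..n}"
      have "\<bar>real_of_int x\<bar> ^ (n - j) * \<bar>real_of_int y\<bar> ^ j \<le> B ^ (n - j) * B ^ j"
        using xy by (intro mult_mono power_mono) auto
      also have "\<dots> = B ^ n" using j by (simp flip: power_add)
      finally show "\<bar>real_of_int (coeff (coeff F j) (n - j) * x ^ (n - j) * y ^ j)\<bar>
          \<le> \<bar>real_of_int (coeff (coeff F j) (n - j))\<bar> * B ^ n"
        by (simp add: abs_mult power_abs mult.assoc mult_left_mono)
    qed
    also have "\<dots> = (K - 1) * B ^ n" by (simp add: K_def sum_distrib_right)
    also have "\<dots> \<le> K * B ^ n" using xy by (intro mult_right_mono) auto
    finally show ?thesis .
  qed
  then show ?thesis using K by blast
qed

text \<open>In unimodular coordinates at (x, y) the second point has second coordinate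
  \<open>x * y' - x' * y\<close> and first coordinate congruent to 1 modulo p, so the expansion at a
  single zero applies.\<close>

lemma form_separation:
  fixes p :: int
  assumes n: "n \<ge> 2" and F: "binary_form n F" "form_disc n F \<noteq> 0" and p: "prime p"
    and g: "g = multiplicity p (form_disc n F)"
    and xy: "gcd x y = 1" "gcd x' y' = 1" "[x = x'] (mod p ^ (g + 1))" "[y = y'] (mod p ^ (g + 1))"
    and k: "p ^ k dvd eval2 F x y" "p ^ k dvd eval2 F x' y'"
  shows "p ^ (k - g) dvd x * y' - x' * y"
proof (cases "k \<le> g")
  case False
  obtain x1 y1 and b :: "nat \<Rightarrow> int" where det: "x * y1 - x1 * y = 1"
    and ex: "\<forall>u v. eval2 F (u * x + v * x1) (u * y + v * y1) = (\<Sum>k\<le>n. b k * v ^ k * u ^ (n - k))"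
    and b1: "\<forall>p. prime p \<longrightarrow> p ^ (multiplicity p (form_disc n F) + 1) dvd b 0
       \<longrightarrow> b 1 \<noteq> 0 \<and> 2 * multiplicity p (b 1) \<le> multiplicity p (form_disc n F)"
    using unimodular_expansion[OF n F xy(1)] by blast
  have "eval2 F x y = (\<Sum>k\<le>n. b k * 0 ^ k * 1 ^ (n - k))" using ex[rule_format, of 1 0] by simp
  also have "\<dots> = (\<Sum>k\<le>n. if k = 0 then b 0 else 0)" by (intro sum.cong) auto
  finally have b0: "b 0 = eval2 F x y" by simp
  have "p ^ (g + 1) dvd p ^ k" using False by (intro le_imp_power_dvd) auto
  then have "p ^ (g + 1) dvd b 0" using k(1) b0 by (metis dvd_trans)
  then have b1': "b 1 \<noteq> 0" "multiplicity p (b 1) \<le> g" using b1 p g by auto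
  define u v where "u = x' * y1 - x1 * y'" and "v = x * y' - x' * y"
  have "u * x + v * x1 = x' * (x * y1 - x1 * y)" "u * y + v * y1 = y' * (x * y1 - x1 * y)"
    by (simp_all add: u_def v_def algebra_simps)
  then have val: "eval2 F x' y' = (\<Sum>k\<le>n. b k * v ^ k * u ^ (n - k))" using ex[rule_format, of u v] det by simp
  have "[x * y' - x' * y = x' * y' - x' * y'] (mod p ^ (g + 1))"
    using xy(3,4) by (intro cong_diff cong_mult) auto
  then have v: "p ^ (g + 1) dvd v" by (simp add: v_def cong_0_iff)
  have "[x * y1 - x1 * y = u] (mod p ^ (g + 1))"
    unfolding u_def using xy(3,4) by (intro cong_diff cong_mult) auto
  then have "[1 = u] (mod p)" unfolding det by (rule cong_dvd_mono_modulus) simp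
  then have u: "\<not> p dvd u" using p by (metis cong_dvd_iff not_prime_unit)
  show ?thesis
    using separation_expansion[where p = p and n = n and b = b and g = g and u = u and v = v and k = k]
      p b1' u v n k val b0 unfolding v_def by simp
qed simp

lemma cong_eval2:
  fixes x y :: int
  assumes hom: "homogeneous n F" and "[x = x'] (mod m)" "[y = y'] (mod m)"
  shows "[eval2 F x y = eval2 F x' y'] (mod m)"
  unfolding eval2_homogeneous[OF hom] using assms by (intro cong_sum cong_mult cong_pow) auto

lemma eval2_scale:
  fixes x y :: int
  assumes hom: "homogeneous n F"
  shows "eval2 F (d * x) (d * y) = d ^ n * eval2 F x y"
  unfolding eval2_homogeneous[OF hom] sum_distrib_left
  by (intro sum.cong) (auto simp: power_mult_distrib power_add[symmetric] mult_ac)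

text \<open>For \<open>v\<close> congruent to \<open>t * u\<close> the value is congruent to
  \<open>u ^ n * poly \<gamma> t\<close>, and \<open>u\<close> is a unit modulo p; so one lifted
  \<open>t\<close> fixes the valuation on a whole lattice class. The modulus needs one power more
  than m to exclude a higher valuation.\<close>

lemma hensel_form:
  fixes p :: int and b :: "nat \<Rightarrow> int"
  assumes p: "prime p" and n: "n \<ge> 1" and b1: "b 1 \<noteq> 0" "2 * multiplicity p (b 1) \<le> g"
    and b0: "p ^ (g + 1) dvd b 0" and m: "g + 1 \<le> m"
  shows "\<exists>t. \<forall>u v. \<not> p dvd u \<longrightarrow> [v = t * u] (mod p ^ (m + 1)) \<longrightarrow>
    p ^ m dvd (\<Sum>k\<le>n. b k * v ^ k * u ^ (n - k)) \<and> \<not> p ^ (m + 1) dvd (\<Sum>k\<le>n. b k * v ^ k * u ^ (n - k))"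
proof -
  define \<gamma> where "\<gamma> = (\<Sum>k\<le>n. monom (b k) k)"
  have co: "coeff \<gamma> k = (if k \<le> n then b k else 0)" for k
    by (simp add: \<gamma>_def coeff_sum)
  have "coeff \<gamma> 1 = b 1" "coeff \<gamma> 0 = b 0" using n by (simp_all add: co)
  then obtain t where t: "p ^ m dvd poly \<gamma> t" "\<not> p ^ (m + 1) dvd poly \<gamma> t"
    using hensel_exact[of p \<gamma> g m] p b1 b0 m by metis
  have "p ^ m dvd (\<Sum>k\<le>n. b k * v ^ k * u ^ (n - k)) \<and> \<not> p ^ (m + 1) dvd (\<Sum>k\<le>n. b k * v ^ k * u ^ (n - k))"
    if u: "\<not> p dvd u" and v: "[v = t * u] (mod p ^ (m + 1))" for u v
  proof -
    have "[(\<Sum>k\<le>n. b k * v ^ k * u ^ (n - k)) = (\<Sum>k\<le>n. b k * (t * u) ^ k * u ^ (n - k))] (mod p ^ (m + 1))"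
      using v by (intro cong_sum cong_mult cong_pow) auto
    also have "(\<Sum>k\<le>n. b k * (t * u) ^ k * u ^ (n - k)) = u ^ n * poly \<gamma> t"
      unfolding \<gamma>_def poly_sum poly_monom sum_distrib_left
      by (intro sum.cong) (auto simp: power_mult_distrib power_add[symmetric] mult_ac)
    finally have c: "[(\<Sum>k\<le>n. b k * v ^ k * u ^ (n - k)) = u ^ n * poly \<gamma> t] (mod p ^ (m + 1))" .
    have cop: "coprime (p ^ j) (u ^ n)" for j
      using p u by (simp add: prime_imp_coprime)
    have "[(\<Sum>k\<le>n. b k * v ^ k * u ^ (n - k)) = u ^ n * poly \<gamma> t] (mod p ^ m)"
      using c by (rule cong_dvd_mono_modulus) simp
    then have "p ^ m dvd (\<Sum>k\<le>n. b k * v ^ k * u ^ (n - k))" using t(1) by (simp add: cong_dvd_iff)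
    moreover have "\<not> p ^ (m + 1) dvd u ^ n * poly \<gamma> t"
      using t(2) cop[of "m + 1"] by (simp only: coprime_dvd_mult_right_iff not_False_eq_True)
    ultimately show ?thesis using cong_dvd_iff[OF c] by blast
  qed
  then show ?thesis by blast
qed

section \<open>Sums over exponent vectors\<close>

text \<open>Distinct exponents make this a part of the geometric series.\<close>

lemma sum_power_inj_le:
  fixes r :: real
  assumes "0 \<le> r" "r < 1" "finite K" "inj_on f K"
  shows "(\<Sum>k\<in>K. r ^ f k) \<le> 1 / (1 - r)"
proof -
  have "(\<Sum>k\<in>K. r ^ f k) = (\<Sum>i\<in>f ` K. r ^ i)"
    using assms(4) by (simp add: sum.reindex)
  also have "\<dots> \<le> (\<Sum>i. r ^ i)"
    using assms by (intro sum_le_suminf summable_geometric) auto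
  also have "\<dots> = 1 / (1 - r)" using assms by (intro suminf_geometric) auto
  finally show ?thesis .
qed

lemma sum_exp_above_le:
  fixes l z :: real
  assumes l: "l > 0" and z: "z \<ge> 0" and K: "finite K" "\<And>k. k \<in> K \<Longrightarrow> z < real k * l"
  shows "(\<Sum>k\<in>K. exp (z - real k * l)) \<le> 1 / (1 - exp (- l))"
proof -
  define m where "m = nat \<lfloor>z / l\<rfloor>"
  have "real m = of_int \<lfloor>z / l\<rfloor>" using l z by (simp add: m_def)
  then have "real m \<le> z / l" "z / l < real m + 1" by linarith+
  then have m: "z < (real m + 1) * l" and m': "real m * l \<le> z"
    using l by (simp_all add: field_simps)
  have k: "m + 1 \<le> k" if "k \<in> K" for k
  proof -
    have "real m * l < real k * l" using K(2)[OF that] m' by linarith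
    then show ?thesis using l by simp
  qed
  have "(\<Sum>k\<in>K. exp (z - real k * l)) \<le> (\<Sum>k\<in>K. exp (- l) ^ (k - (m + 1)))"
  proof (rule sum_mono)
    fix k assume "k \<in> K"
    then have "z - real k * l \<le> real (k - (m + 1)) * - l"
      using k m by (simp add: of_nat_diff algebra_simps)
    then show "exp (z - real k * l) \<le> exp (- l) ^ (k - (m + 1))"
      by (simp add: exp_of_nat_mult[symmetric])
  qed
  also have "\<dots> \<le> 1 / (1 - exp (- l))"
    using l K k by (intro sum_power_inj_le) (auto simp: inj_on_def intro: eq_diff_iff[THEN iffD1])
  finally show ?thesis .
qed

lemma sum_exp_below_le:
  fixes l z :: real
  assumes l: "l > 0" and z: "z \<ge> 0" and K: "finite K" "\<And>k. k \<in> K \<Longrightarrow> real k * l \<le> z"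
  shows "(\<Sum>k\<in>K. exp (real k * l - z)) \<le> 1 / (1 - exp (- l))" "real (card K) \<le> z / l + 1"
proof -
  define m where "m = nat \<lfloor>z / l\<rfloor>"
  have "real m = of_int \<lfloor>z / l\<rfloor>" using l z by (simp add: m_def)
  then have "real m \<le> z / l" by linarith
  then have m': "real m * l \<le> z" using l by (simp add: field_simps)
  have k: "k \<le> m" if "k \<in> K" for k
    using K(2)[OF that] l z by (simp add: m_def le_nat_floor field_simps)
  have "(\<Sum>k\<in>K. exp (real k * l - z)) \<le> (\<Sum>k\<in>K. exp (- l) ^ (m - k))"
  proof (rule sum_mono)
    fix k assume "k \<in> K"
    then have "real k * l - z \<le> real (m - k) * - l"
      using k m' by (simp add: of_nat_diff algebra_simps)
    then show "exp (real k * l - z) \<le> exp (- l) ^ (m - k)"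
      by (simp add: exp_of_nat_mult[symmetric])
  qed
  also have "\<dots> \<le> 1 / (1 - exp (- l))"
  proof (intro sum_power_inj_le inj_onI)
    fix a b assume "a \<in> K" "b \<in> K" "m - a = m - b"
    then show "a = b" using k[of a] k[of b] by linarith
  qed (use l K in auto)
  finally show "(\<Sum>k\<in>K. exp (real k * l - z)) \<le> 1 / (1 - exp (- l))" .
  have "K \<subseteq> {..m}" using k by auto
  then have "card K \<le> m + 1" using card_mono[of "{..m}" K] by simp
  also have "real (m + 1) \<le> z / l + 1" using m' l by (simp add: field_simps)
  finally show "real (card K) \<le> z / l + 1" by simp
qed

lemma sum_exp_neg_le:
  fixes l z :: real
  assumes l: "l > 0" and K: "finite K"
  shows "(\<Sum>k\<in>K. exp (z - real k * l)) \<le> 1 / (1 - exp (- l)) * exp z"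
proof -
  have "(\<Sum>k\<in>K. exp (z - real k * l)) = (\<Sum>k\<in>K. exp (- l) ^ k) * exp z"
    unfolding sum_distrib_right
    by (intro sum.cong) (auto simp: exp_of_nat_mult[symmetric] exp_add[symmetric] algebra_simps)
  also have "\<dots> \<le> 1 / (1 - exp (- l)) * exp z"
    using l K by (intro mult_right_mono sum_power_inj_le) auto
  finally show ?thesis .
qed

text \<open>The factor \<open>exp (min z 0)\<close> records the decay for a negative target. It is
  needed because further primes replace z by z - k l, which may be far below 0.\<close>

lemma sum_exp_dist_le:
  fixes l z :: real
  assumes l: "l > 0"
  shows "(\<Sum>k\<le>V. exp (- \<bar>real k * l - z\<bar>)) \<le> 2 / (1 - exp (- l)) * exp (min z 0)"
proof (cases "z \<ge> 0")
  case True
  let ?A = "{k\<in>{..V}. real k * l \<le> z}" and ?B = "{k\<in>{..V}. z < real k * l}"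
  have "(\<Sum>k\<le>V. exp (- \<bar>real k * l - z\<bar>)) = (\<Sum>k\<in>?A \<union> ?B. exp (- \<bar>real k * l - z\<bar>))"
    by (intro sum.cong) auto
  also have "\<dots> = (\<Sum>k\<in>?A. exp (real k * l - z)) + (\<Sum>k\<in>?B. exp (z - real k * l))"
    by (subst sum.union_disjoint) (auto intro!: arg_cong2[of _ _ _ _ "(+)"] sum.cong)
  also have "\<dots> \<le> 1 / (1 - exp (- l)) + 1 / (1 - exp (- l))"
    using l True by (intro add_mono sum_exp_below_le sum_exp_above_le) auto
  finally show ?thesis using True by simp
next
  case False
  have "(\<Sum>k\<le>V. exp (- \<bar>real k * l - z\<bar>)) = (\<Sum>k\<le>V. exp (z - real k * l))"
  proof (intro sum.cong refl arg_cong[of _ _ exp])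
    fix k
    have "0 \<le> real k * l" using l by simp
    then show "- \<bar>real k * l - z\<bar> = z - real k * l" using False by simp
  qed
  also have "\<dots> \<le> 1 / (1 - exp (- l)) * exp z" using l by (intro sum_exp_neg_le) auto
  also have "\<dots> \<le> 2 / (1 - exp (- l)) * exp z"
    using l by (intro mult_right_mono divide_right_mono) auto
  finally show ?thesis using False by simp
qed

text \<open>The cost of one more prime: about z / l exponents lie below the target and contribute 1
  each, which gives one more factor \<open>1 + max z 0\<close>; the others form a geometric
  tail.\<close>

lemma sum_exp_min_le:
  fixes l z :: real
  assumes l: "l > 0"
  shows "(\<Sum>k\<le>V. exp (min (z - real k * l) 0))
    \<le> (1 / l + 1 + 1 / (1 - exp (- l))) * (1 + max z 0) * exp (min z 0)"
proof (cases "z \<ge> 0")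
  case True
  let ?A = "{k\<in>{..V}. real k * l \<le> z}" and ?B = "{k\<in>{..V}. z < real k * l}"
  have "(\<Sum>k\<le>V. exp (min (z - real k * l) 0)) = (\<Sum>k\<in>?A \<union> ?B. exp (min (z - real k * l) 0))"
    by (intro sum.cong) auto
  also have "\<dots> = (\<Sum>k\<in>?A. 1) + (\<Sum>k\<in>?B. exp (z - real k * l))"
    by (subst sum.union_disjoint) (auto intro!: arg_cong2[of _ _ _ _ "(+)"] sum.cong)
  also have "\<dots> = real (card ?A) + (\<Sum>k\<in>?B. exp (z - real k * l))" by simp
  also have "\<dots> \<le> (z / l + 1) + 1 / (1 - exp (- l))"
    using l True by (intro add_mono sum_exp_below_le sum_exp_above_le) auto
  also have "\<dots> \<le> (1 / l + 1 + 1 / (1 - exp (- l))) * (1 + z)"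
    using l True by (auto simp: algebra_simps add_divide_distrib)
  finally show ?thesis using True by simp
next
  case False
  have "(\<Sum>k\<le>V. exp (min (z - real k * l) 0)) = (\<Sum>k\<le>V. exp (z - real k * l))"
  proof (intro sum.cong refl arg_cong[of _ _ exp])
    fix k
    have "0 \<le> real k * l" using l by simp
    then show "min (z - real k * l) 0 = z - real k * l" using False by simp
  qed
  also have "\<dots> \<le> 1 / (1 - exp (- l)) * exp z" using l by (intro sum_exp_neg_le) auto
  also have "\<dots> \<le> (1 / l + 1 + 1 / (1 - exp (- l))) * exp z"
    using l by (intro mult_right_mono) auto
  finally show ?thesis using False by simp
qed

lemma sum_PiE_insert:
  assumes "q \<notin> P"
  shows "(\<Sum>v\<in>PiE (insert q P) (\<lambda>_. A). g v) = (\<Sum>k\<in>A. \<Sum>v\<in>PiE P (\<lambda>_. A). g (v(q := k)))"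
proof -
  have "(\<Sum>v\<in>PiE (insert q P) (\<lambda>_. A). g v)
      = (\<Sum>v\<in>(\<lambda>(k, v). v(q := k)) ` (A \<times> PiE P (\<lambda>_. A)). g v)"
    by (simp add: PiE_insert_eq)
  also have "\<dots> = (\<Sum>(k, v)\<in>A \<times> PiE P (\<lambda>_. A). g (v(q := k)))"
    by (subst sum.reindex) (auto simp: comp_def case_prod_unfold
        intro: inj_combinator[OF assms, unfolded case_prod_unfold])
  also have "\<dots> = (\<Sum>k\<in>A. \<Sum>v\<in>PiE P (\<lambda>_. A). g (v(q := k)))"
    by (rule sum.cartesian_product[symmetric])
  finally show ?thesis .
qed

text \<open>The exponent vectors \<open>v\<close> are weighted by \<open>min (M / X) (X / M)\<close> for \<open>M = \<Prod>p\<in>P. p ^ v p\<close> and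
  \<open>X = exp z\<close>; only about \<open>(ln X) ^ (card P - 1)\<close> of them are near \<open>X\<close>.\<close>

lemma sum_exponents_exp_le:
  fixes w :: "'a \<Rightarrow> real"
  assumes "finite P" "P \<noteq> {}" "\<And>p. p \<in> P \<Longrightarrow> w p > 0"
  shows "\<exists>C > 0. \<forall>V z. (\<Sum>v\<in>PiE P (\<lambda>_. {..V::nat}). exp (- \<bar>(\<Sum>p\<in>P. real (v p) * w p) - z\<bar>))
    \<le> C * (1 + max z 0) ^ (card P - 1) * exp (min z 0)"
  using assms
proof (induction P rule: finite_ne_induct)
  case (singleton q)
  have "(\<Sum>v\<in>PiE {q} (\<lambda>_. {..V::nat}). exp (- \<bar>(\<Sum>p\<in>{q}. real (v p) * w p) - z\<bar>))
     \<le> 2 / (1 - exp (- w q)) * exp (min z 0)" for V z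
    using sum_exp_dist_le[of "w q" z V] singleton by (simp add: sum_PiE_insert)
  moreover have "2 / (1 - exp (- w q)) > 0" using singleton by simp
  ultimately show ?case by (intro exI[of _ "2 / (1 - exp (- w q))"]) simp
next
  case (insert q P)
  then obtain C where C: "C > 0" "\<And>V z. (\<Sum>v\<in>PiE P (\<lambda>_. {..V::nat}). exp (- \<bar>(\<Sum>p\<in>P. real (v p) * w p) - z\<bar>))
    \<le> C * (1 + max z 0) ^ (card P - 1) * exp (min z 0)" by auto
  define l where "l = w q"
  have l: "l > 0" using insert by (simp add: l_def)
  define E where "E = 1 / l + 1 + 1 / (1 - exp (- l))"
  have E: "E > 0" unfolding E_def using l by (intro add_pos_pos) auto
  have "(\<Sum>v\<in>PiE (insert q P) (\<lambda>_. {..V::nat}). exp (- \<bar>(\<Sum>p\<in>insert q P. real (v p) * w p) - z\<bar>))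
    \<le> (C * E) * (1 + max z 0) ^ (card (insert q P) - 1) * exp (min z 0)" for V z
  proof -
    have s: "(\<Sum>p\<in>insert q P. real ((v(q := k)) p) * w p) = real k * l + (\<Sum>p\<in>P. real (v p) * w p)" for v k
    proof -
      have "(\<Sum>p\<in>P. real ((v(q := k)) p) * w p) = (\<Sum>p\<in>P. real (v p) * w p)"
        by (rule sum.cong) (use insert(3) in auto)
      then show ?thesis using insert by (simp add: l_def)
    qed
    have "(\<Sum>v\<in>PiE (insert q P) (\<lambda>_. {..V::nat}). exp (- \<bar>(\<Sum>p\<in>insert q P. real (v p) * w p) - z\<bar>))
      = (\<Sum>k\<le>V. \<Sum>v\<in>PiE P (\<lambda>_. {..V}). exp (- \<bar>(\<Sum>p\<in>P. real (v p) * w p) - (z - real k * l)\<bar>))"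
      unfolding sum_PiE_insert[OF insert(3)] s by (simp add: algebra_simps)
    \<comment> \<open>With the exponent k of the new prime fixed, the remaining primes must
      approximate z - k l.\<close>
    also have "\<dots> \<le> (\<Sum>k\<le>V. C * (1 + max (z - real k * l) 0) ^ (card P - 1) * exp (min (z - real k * l) 0))"
      by (intro sum_mono C)
    also have "\<dots> \<le> (\<Sum>k\<le>V. C * (1 + max z 0) ^ (card P - 1) * exp (min (z - real k * l) 0))"
    proof (intro sum_mono mult_right_mono mult_left_mono power_mono)
      fix k
      have "0 \<le> real k * l" using l by simp
      then show "1 + max (z - real k * l) 0 \<le> 1 + max z 0" by linarith
    qed (use C(1) in auto)
    also have "\<dots> = C * (1 + max z 0) ^ (card P - 1) * (\<Sum>k\<le>V. exp (min (z - real k * l) 0))"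
      by (simp add: sum_distrib_left)
    also have "\<dots> \<le> C * (1 + max z 0) ^ (card P - 1) * (E * (1 + max z 0) * exp (min z 0))"
      using C(1) sum_exp_min_le[OF l, of z V] unfolding E_def by (intro mult_left_mono) auto
    also have "\<dots> = (C * E) * (1 + max z 0) ^ (card (insert q P) - 1) * exp (min z 0)"
    proof -
      have "card (insert q P) - 1 = Suc (card P - 1)"
        using insert by (simp add: card_gt_0_iff)
      then show ?thesis by simp
    qed
    finally show ?thesis .
  qed
  then show ?case using C(1) E by (intro exI[of _ "C * E"]) auto
qed

section \<open>Counting primitive points from above\<close>

text \<open>Cut the interval into cells of length \<open>\<eta>\<close>; no cell holds two
  points.\<close>

lemma card_separated_le:
  fixes A :: "real set"
  assumes A: "A \<subseteq> {a..b}" and \<eta>: "\<eta> > 0" "a \<le> b"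
    and sep: "\<And>x y. x \<in> A \<Longrightarrow> y \<in> A \<Longrightarrow> x \<noteq> y \<Longrightarrow> \<eta> \<le> \<bar>x - y\<bar>"
  shows "real (card A) \<le> 1 + (b - a) / \<eta>"
proof -
  define f where "f x = nat \<lfloor>(x - a) / \<eta>\<rfloor>" for x
  have "inj_on f A"
  proof (rule inj_onI, rule ccontr)
    fix x y assume xy: "x \<in> A" "y \<in> A" "f x = f y" "x \<noteq> y"
    have "0 \<le> (x - a) / \<eta>" "0 \<le> (y - a) / \<eta>" using xy A \<eta> by auto
    then have "\<lfloor>(x - a) / \<eta>\<rfloor> = \<lfloor>(y - a) / \<eta>\<rfloor>"
      using xy(3) by (simp add: f_def eq_nat_nat_iff)
    then have "\<bar>(x - a) / \<eta> - (y - a) / \<eta>\<bar> < 1" by linarith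
    moreover have "(x - a) / \<eta> - (y - a) / \<eta> = (x - y) / \<eta>" using \<eta> by (simp add: field_simps)
    ultimately have "\<bar>x - y\<bar> / \<eta> < 1" using \<eta>(1) by (simp add: abs_divide)
    then have "\<bar>x - y\<bar> < \<eta>" using \<eta> by simp
    then show False using sep[OF xy(1,2,4)] by simp
  qed
  moreover have "f ` A \<subseteq> {..nat \<lfloor>(b - a) / \<eta>\<rfloor>}"
  proof
    fix k assume "k \<in> f ` A"
    then obtain x where x: "x \<in> A" "k = f x" by auto
    then have "(x - a) / \<eta> \<le> (b - a) / \<eta>" using A \<eta> by (auto intro!: divide_right_mono)
    then show "k \<in> {..nat \<lfloor>(b - a) / \<eta>\<rfloor>}" using x by (simp add: f_def nat_mono floor_mono)
  qed
  ultimately have "card A \<le> card {..nat \<lfloor>(b - a) / \<eta>\<rfloor>}"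
    by (intro card_inj_on_le) auto
  then have "real (card A) \<le> 1 + real (nat \<lfloor>(b - a) / \<eta>\<rfloor>)" by simp
  also have "\<dots> \<le> 1 + (b - a) / \<eta>" using \<eta> by simp
  finally show ?thesis .
qed

text \<open>Parallel primitive vectors agree up to sign; the condition on the second coordinates
  excludes the opposite vector.\<close>

lemma primitive_parallel_eq:
  fixes x y x' y' :: int
  assumes "gcd x y = 1" "gcd x' y' = 1" "x * y' = x' * y" "y \<noteq> 0" "0 < y \<longleftrightarrow> 0 < y'"
  shows "x = x' \<and> y = y'"
proof -
  have "coprime y x" "coprime y' x'" using assms by (auto simp: coprime_iff_gcd_eq_1 gcd.commute)
  then have "y dvd y'" "y' dvd y"
    using assms(3) by (metis coprime_dvd_mult_right_iff dvd_triv_right)+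
  then have "\<bar>y\<bar> = \<bar>y'\<bar>" using zdvd_antisym_abs by blast
  then have "y = y'" using assms by linarith
  then show ?thesis using assms by simp
qed

lemma prod_prime_powers_dvd:
  fixes d :: int
  assumes "finite P" "\<And>p. p \<in> P \<Longrightarrow> prime p" "\<And>p. p \<in> P \<Longrightarrow> int p ^ k p dvd d"
  shows "(\<Prod>p\<in>P. int p ^ k p) dvd d"
  using assms
proof (induction P rule: finite_induct)
  case (insert q P)
  have "coprime (int q ^ k q) (\<Prod>p\<in>P. int p ^ k p)"
  proof (rule prod_coprime_right)
    fix p assume "p \<in> P"
    then have "coprime q p" using insert by (intro primes_coprime) auto
    then show "coprime (int q ^ k q) (int p ^ k p)" by simp
  qed
  then show ?case using insert by (simp add: divides_mult)
qed simp

text \<open>Points with the same exponents, the same residues and the same sign have determinants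
  divisible by \<open>\<Prod>p\<in>P. p ^ (v p - g p)\<close>, which separates their slopes.\<close>

lemma card_class_le:
  fixes \<Phi> :: "int \<Rightarrow> int \<Rightarrow> int" and P :: "nat set" and g v :: "nat \<Rightarrow> nat" and \<rho> c :: real
  assumes P: "finite P" "\<And>p. p \<in> P \<Longrightarrow> prime p"
    and sep: "\<And>p k x y x' y'. p \<in> P \<Longrightarrow> gcd x y = 1 \<Longrightarrow> gcd x' y' = 1 \<Longrightarrow>
      [x = x'] (mod int p ^ (g p + 1)) \<Longrightarrow> [y = y'] (mod int p ^ (g p + 1)) \<Longrightarrow>
      int p ^ k dvd \<Phi> x y \<Longrightarrow> int p ^ k dvd \<Phi> x' y' \<Longrightarrow> int p ^ (k - g p) dvd x * y' - x' * y"
    and R: "R = (\<Prod>p\<in>P. int p ^ (g p + 1))"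
    and T: "T = {(x, y). gcd x y = 1 \<and> \<bar>x\<bar> \<le> \<bar>y\<bar> \<and> 2 ^ j \<le> \<bar>y\<bar> \<and> \<bar>y\<bar> < 2 ^ (j + 1) \<and>
       (0 < y) = \<sigma> \<and> x mod R = r1 \<and> y mod R = r2 \<and> (\<forall>p\<in>P. int p ^ v p dvd \<Phi> x y) \<and>
       \<bar>real_of_int x / real_of_int y - c\<bar> \<le> \<rho>}"
    and \<rho>: "\<rho> \<ge> 0"
  shows "finite T" and "real (card T)
    \<le> 1 + 8 * (\<Prod>p\<in>P. real p ^ g p) * (4 ^ j * min 1 \<rho> / (\<Prod>p\<in>P. real p ^ v p))"
proof -
  define M where "M = (\<Prod>p\<in>P. real p ^ v p)"
  define \<Gamma> where "\<Gamma> = (\<Prod>p\<in>P. real p ^ g p)"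
  \<comment> \<open>Two slopes differ by the determinant over y y'. The determinant is at least
    \<open>M / \<Gamma>\<close> in absolute value and y y' at most
    \<open>4 ^ (j + 1)\<close>.\<close>
  define \<eta> where "\<eta> = M / (\<Gamma> * 4 ^ (j + 1))"
  have p0: "real p > 0" if "p \<in> P" for p using P(2)[OF that] prime_gt_0_nat by simp
  have M: "M > 0" and \<Gamma>: "\<Gamma> > 0" unfolding M_def \<Gamma>_def using p0 by (auto intro!: prod_pos)
  then have \<eta>: "\<eta> > 0" by (simp add: \<eta>_def)
  have "T \<subseteq> {- (2 ^ (j + 1))..2 ^ (j + 1)} \<times> {- (2 ^ (j + 1))..2 ^ (j + 1)}" unfolding T by auto
  then show fin: "finite T" by (rule finite_subset) auto
  define f where "f = (\<lambda>(x, y). real_of_int x / real_of_int y)"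
  have gap: "\<eta> \<le> \<bar>f z - f z'\<bar>" if z: "z \<in> T" "z' \<in> T" "z \<noteq> z'" for z z'
  proof -
    obtain x y where xy: "z = (x, y)" by fastforce
    obtain x' y' where xy': "z' = (x', y')" by fastforce
    have t: "gcd x y = 1" "2 ^ j \<le> \<bar>y\<bar>" "\<bar>y\<bar> < 2 ^ (j + 1)" "(0 < y) = \<sigma>" "x mod R = r1" "y mod R = r2"
      "\<And>p. p \<in> P \<Longrightarrow> int p ^ v p dvd \<Phi> x y" using z(1) unfolding T xy by auto
    have t': "gcd x' y' = 1" "2 ^ j \<le> \<bar>y'\<bar>" "\<bar>y'\<bar> < 2 ^ (j + 1)" "(0 < y') = \<sigma>" "x' mod R = r1" "y' mod R = r2"
      "\<And>p. p \<in> P \<Longrightarrow> int p ^ v p dvd \<Phi> x' y'" using z(2) unfolding T xy' by auto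
    have "(0::int) < 2 ^ j" by simp
    then have y0: "y \<noteq> 0" "y' \<noteq> 0" using t(2) t'(2) by linarith+
    define d where "d = x * y' - x' * y"
    have "d \<noteq> 0"
      using primitive_parallel_eq[of x y x' y'] t t' y0 z(3) by (auto simp: d_def xy xy')
    have "[x = x'] (mod R)" "[y = y'] (mod R)" using t t' by (auto simp: Cong.cong_def)
    then have "[x = x'] (mod int p ^ (g p + 1))" "[y = y'] (mod int p ^ (g p + 1))" if "p \<in> P" for p
      using that P(1) unfolding R by (auto elim!: cong_dvd_mono_modulus intro!: dvd_prodI)
    then have "int p ^ (v p - g p) dvd d" if "p \<in> P" for p
      using sep[OF that t(1) t'(1)] t t' that unfolding d_def by blast
    then have "(\<Prod>p\<in>P. int p ^ (v p - g p)) dvd d"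
      using P by (intro prod_prime_powers_dvd) auto
    then have "(\<Prod>p\<in>P. int p ^ (v p - g p)) \<le> \<bar>d\<bar>"
      using \<open>d \<noteq> 0\<close> by (intro zdvd_imp_le) auto
    then have "real_of_int (\<Prod>p\<in>P. int p ^ (v p - g p)) \<le> real_of_int \<bar>d\<bar>" by (simp only: of_int_le_iff)
    then have d: "(\<Prod>p\<in>P. real p ^ (v p - g p)) \<le> \<bar>real_of_int d\<bar>" by simp
    have "M / \<Gamma> = (\<Prod>p\<in>P. real p ^ v p / real p ^ g p)" by (simp add: M_def \<Gamma>_def prod_dividef)
    \<comment> \<open>The subtraction is truncated: for \<open>v p < g p\<close> the right factor is
      1 and the left one is smaller.\<close>
    also have "\<dots> \<le> (\<Prod>p\<in>P. real p ^ (v p - g p))"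
    proof (rule prod_mono, safe)
      fix p assume p: "p \<in> P"
      show "0 \<le> real p ^ v p / real p ^ g p" by simp
      have "real p ^ v p \<le> real p ^ (v p - g p + g p)"
        using P(2)[OF p] prime_ge_1_nat by (intro power_increasing) auto
      then show "real p ^ v p / real p ^ g p \<le> real p ^ (v p - g p)"
        using p0[OF p] by (simp add: power_add divide_le_eq)
    qed
    finally have Md: "M / \<Gamma> \<le> \<bar>real_of_int d\<bar>" using d by simp
    have yy: "\<bar>real_of_int y * real_of_int y'\<bar> \<le> 4 ^ (j + 1)"
    proof -
      have "\<bar>real_of_int w\<bar> \<le> 2 ^ (j + 1)" if "\<bar>w\<bar> < 2 ^ (j + 1)" for w
      proof -
        have "real_of_int \<bar>w\<bar> \<le> real_of_int (2 ^ (j + 1))" using that by (simp only: of_int_le_iff)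
        then show ?thesis by simp
      qed
      then have "\<bar>real_of_int y\<bar> \<le> 2 ^ (j + 1)" "\<bar>real_of_int y'\<bar> \<le> 2 ^ (j + 1)"
        using t(3) t'(3) by blast+
      then have "\<bar>real_of_int y * real_of_int y'\<bar> \<le> 2 ^ (j + 1) * 2 ^ (j + 1)"
        unfolding abs_mult by (intro mult_mono) auto
      also have "\<dots> = (4::real) ^ (j + 1)" by (simp flip: power_mult_distrib)
      finally show ?thesis .
    qed
    have "f z - f z' = real_of_int d / (real_of_int y * real_of_int y')"
      using y0 by (simp add: f_def xy xy' d_def field_simps)
    then have "\<bar>f z - f z'\<bar> = \<bar>real_of_int d\<bar> / \<bar>real_of_int y * real_of_int y'\<bar>"
      by (simp add: abs_divide)
    also have "\<dots> \<ge> (M / \<Gamma>) / 4 ^ (j + 1)"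
      using Md yy y0 M \<Gamma> by (intro frac_le) auto
    finally show ?thesis by (simp add: \<eta>_def)
  qed
  have inj: "inj_on f T"
    using gap \<eta> by (intro inj_onI) (metis abs_zero cancel_comm_monoid_add_class.diff_cancel not_le)
  have sub: "f ` T \<subseteq> {-1..1}" "f ` T \<subseteq> {c - \<rho>..c + \<rho>}"
  proof -
    show "f ` T \<subseteq> {-1..1}"
    proof
      fix s assume "s \<in> f ` T"
      then obtain x y where xy: "s = real_of_int x / real_of_int y" "\<bar>x\<bar> \<le> \<bar>y\<bar>"
        unfolding f_def T by auto
      then have "\<bar>real_of_int x\<bar> \<le> \<bar>real_of_int y\<bar>" by (metis of_int_abs of_int_le_iff)
      then have "\<bar>s\<bar> \<le> 1" unfolding xy(1) abs_divide by (auto simp: divide_le_eq_1)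
      then show "s \<in> {-1..1}" by auto
    qed
    show "f ` T \<subseteq> {c - \<rho>..c + \<rho>}" unfolding f_def T by (auto simp: abs_le_iff)
  qed
  have sep': "\<eta> \<le> \<bar>s - s'\<bar>" if "s \<in> f ` T" "s' \<in> f ` T" "s \<noteq> s'" for s s'
    using gap that by blast
  \<comment> \<open>The trivial range [-1, 1] and the interval around \<open>c\<close> are both
    used, which produces \<open>min 1 \<rho>\<close>.\<close>
  have "real (card (f ` T)) \<le> 1 + (1 - (-1)) / \<eta>"
    by (rule card_separated_le[OF sub(1) \<eta> _ sep']) auto
  moreover have "real (card (f ` T)) \<le> 1 + ((c + \<rho>) - (c - \<rho>)) / \<eta>"
    by (rule card_separated_le[OF sub(2) \<eta> _ sep']) (use \<rho> in auto)
  ultimately have "real (card (f ` T)) \<le> 1 + 2 * min 1 \<rho> / \<eta>" by (auto simp: min_def)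
  also have "2 * min 1 \<rho> / \<eta> = 8 * \<Gamma> * (4 ^ j * min 1 \<rho> / M)"
    using M \<Gamma> by (simp add: \<eta>_def field_simps)
  finally show "real (card T) \<le> 1 + 8 * (\<Prod>p\<in>P. real p ^ g p) * (4 ^ j * min 1 \<rho> / (\<Prod>p\<in>P. real p ^ v p))"
    unfolding card_image[OF inj] M_def \<Gamma>_def .
qed

text \<open>Put X = 2^(j n \<epsilon>), so that \<open>4 ^ j\<close> is X times the expected
  \<open>2 powr (real j * (2 - real n * \<epsilon>))\<close>. The slope radius is a constant times
  \<open>(M / X) powr (1 / \<epsilon>)\<close>, and 1 / \<epsilon> is at least 2; so for M < X the
  quotient X / M times the radius is at most M / X, while for M >= X the bound 1 leaves X /
  M.\<close>

lemma weight_le_exp: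
  fixes \<epsilon> M D \<kappa> :: real
  assumes \<epsilon>: "0 < \<epsilon>" "\<epsilon> < 1 / real n" "n \<ge> 2" and M: "M > 0" and D: "D > 0" and \<kappa>: "\<kappa> > 0"
  shows "4 ^ j * min 1 (D * (\<kappa> * M) powr (1 / \<epsilon>) / 2 ^ (j * n)) / M
    \<le> max 1 (D * \<kappa> powr (1 / \<epsilon>)) * 2 powr (real j * (2 - real n * \<epsilon>))
        * exp (- \<bar>ln M - real j * real n * \<epsilon> * ln 2\<bar>)"
proof -
  define E where "E = max 1 (D * \<kappa> powr (1 / \<epsilon>))"
  define X where "X = exp (real j * real n * \<epsilon> * ln 2)"
  have X: "X > 0" and lnX: "ln X = real j * real n * \<epsilon> * ln 2" by (simp_all add: X_def)
  have Xe: "X powr (1 / \<epsilon>) = 2 ^ (j * n)"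
    using \<epsilon> by (simp add: X_def powr_def exp_of_nat_mult[symmetric] flip: exp_of_nat_mult)
       (simp add: powr_realpow[symmetric] powr_def)
  have four: "(4::real) ^ j = 2 powr (real j * (2 - real n * \<epsilon>)) * X"
  proof -
    have "(4::real) ^ j = 2 powr (2 * real j)"
      by (simp add: powr_realpow[symmetric] powr_powr[symmetric] powr_numeral)
    also have "\<dots> = 2 powr (real j * (2 - real n * \<epsilon>)) * 2 powr (real j * real n * \<epsilon>)"
      by (simp add: powr_add[symmetric] algebra_simps)
    also have "2 powr (real j * real n * \<epsilon>) = X" by (simp add: X_def powr_def)
    finally show ?thesis .
  qed
  have "real n * \<epsilon> < 1" using \<epsilon> by (simp add: field_simps)
  moreover have "2 * \<epsilon> \<le> real n * \<epsilon>" using \<epsilon> by (intro mult_right_mono) auto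
  ultimately have "2 * \<epsilon> < 1" by linarith
  then have e2: "1 / \<epsilon> \<ge> 2" using \<epsilon> by (simp add: field_simps)
  have "D * (\<kappa> * M) powr (1 / \<epsilon>) / 2 ^ (j * n) = (D * \<kappa> powr (1 / \<epsilon>)) * (M / X) powr (1 / \<epsilon>)"
    using M X \<kappa> by (simp add: powr_mult powr_divide Xe)
  also have "\<dots> \<le> E * (M / X) powr (1 / \<epsilon>)" unfolding E_def by (intro mult_right_mono) auto
  finally have "min 1 (D * (\<kappa> * M) powr (1 / \<epsilon>) / 2 ^ (j * n)) \<le> min E (E * (M / X) powr (1 / \<epsilon>))"
    by (intro min.mono) (auto simp: E_def)
  also have "\<dots> = E * min 1 ((M / X) powr (1 / \<epsilon>))"
    by (auto simp: min_def E_def mult_le_cancel_left1)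
  finally have 1: "min 1 (D * (\<kappa> * M) powr (1 / \<epsilon>) / 2 ^ (j * n)) \<le> E * min 1 ((M / X) powr (1 / \<epsilon>))" .
  have 2: "X / M * min 1 ((M / X) powr (1 / \<epsilon>)) \<le> exp (- \<bar>ln M - ln X\<bar>)"
  proof (cases "X \<le> M")
    case True
    then have "- \<bar>ln M - ln X\<bar> = ln X - ln M" using M X ln_mono[of X M] by linarith
    then have "exp (- \<bar>ln M - ln X\<bar>) = X / M" using M X by (simp only: exp_diff exp_ln)
    moreover have "X / M * min 1 ((M / X) powr (1 / \<epsilon>)) \<le> X / M * 1"
      using M X by (intro mult_left_mono) auto
    ultimately show ?thesis by simp
  next
    case False
    then have "- \<bar>ln M - ln X\<bar> = ln M - ln X" using M X ln_mono[of M X] by linarith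
    then have "exp (- \<bar>ln M - ln X\<bar>) = M / X" using M X by (simp only: exp_diff exp_ln)
    moreover have "(M / X) powr (1 / \<epsilon>) \<le> (M / X) powr 2"
      using False M X e2 by (intro powr_mono') auto
    then have "X / M * (M / X) powr (1 / \<epsilon>) \<le> X / M * (M / X) ^ 2"
      using M X by (intro mult_left_mono) (auto simp: powr_numeral)
    moreover have "X / M * (M / X) ^ 2 = M / X" using M X by (simp add: power2_eq_square)
    moreover have "X / M * min 1 ((M / X) powr (1 / \<epsilon>)) \<le> X / M * (M / X) powr (1 / \<epsilon>)"
      using M X by (intro mult_left_mono) auto
    ultimately show ?thesis by linarith
  qed
  have "4 ^ j * min 1 (D * (\<kappa> * M) powr (1 / \<epsilon>) / 2 ^ (j * n)) / M
      \<le> 4 ^ j * (E * min 1 ((M / X) powr (1 / \<epsilon>))) / M"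
    using 1 M by (intro divide_right_mono mult_left_mono) auto
  also have "\<dots> = E * 2 powr (real j * (2 - real n * \<epsilon>)) * (X / M * min 1 ((M / X) powr (1 / \<epsilon>)))"
    unfolding four by (simp add: field_simps)
  also have "\<dots> \<le> E * 2 powr (real j * (2 - real n * \<epsilon>)) * exp (- \<bar>ln M - ln X\<bar>)"
    using 2 by (intro mult_left_mono) (auto simp: E_def)
  finally show ?thesis unfolding E_def lnX .
qed

section \<open>Upper bound: summation over dyadic heights and exponent vectors\<close>

lemma log_growth_eventually:
  "\<forall>\<^sub>F B in at_top. B \<ge> 3 \<and> ln B \<ge> 1 \<and> (ln B)\<^sup>2 \<le> B \<and> ln K \<le> ln (B::real)"
proof -
  have "\<forall>\<^sub>F B in at_top. B \<ge> (3::real)" by (rule eventually_ge_at_top)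
  moreover have "\<forall>\<^sub>F B in at_top. ln B \<ge> (1::real)" by real_asymp
  moreover have "\<forall>\<^sub>F B in at_top. (ln B)\<^sup>2 \<le> (B::real)" by real_asymp
  moreover have "\<forall>\<^sub>F B in at_top. ln K \<le> ln (B::real)" by real_asymp
  ultimately show ?thesis by eventually_elim auto
qed

text \<open>\<open>\<Phi>\<close> is abstract so that both charts, F(x, y) and F(y, x), are covered;
  \<open>\<kappa>\<close> absorbs the primes of S outside P. Each class costs 1 plus a weight. The
  ones add up to about (ln B)^(s + 1), a lower order term, and the weights to a geometric sum over
  the heights.\<close>

lemma primitive_count_upper:
  fixes \<Phi> :: "int \<Rightarrow> int \<Rightarrow> int" and P :: "nat set" and g :: "nat \<Rightarrow> nat" and c :: "nat \<Rightarrow> real"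
    and \<epsilon> K D \<kappa> :: real and n :: nat
  assumes P: "finite P" "P \<noteq> {}" "\<And>p. p \<in> P \<Longrightarrow> prime p"
    and sep: "\<And>p k x y x' y'. p \<in> P \<Longrightarrow> gcd x y = 1 \<Longrightarrow> gcd x' y' = 1 \<Longrightarrow>
      [x = x'] (mod int p ^ (g p + 1)) \<Longrightarrow> [y = y'] (mod int p ^ (g p + 1)) \<Longrightarrow>
      int p ^ k dvd \<Phi> x y \<Longrightarrow> int p ^ k dvd \<Phi> x' y' \<Longrightarrow> int p ^ (k - g p) dvd x * y' - x' * y"
    and cover: "\<And>x y. y \<noteq> 0 \<Longrightarrow> \<bar>x\<bar> \<le> \<bar>y\<bar> \<Longrightarrow>
      \<exists>i<n. \<bar>real_of_int x / real_of_int y - c i\<bar> \<le> D * \<bar>real_of_int (\<Phi> x y)\<bar> / \<bar>real_of_int y\<bar> ^ n"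
    and bound: "\<And>x y. \<bar>x\<bar> \<le> \<bar>y\<bar> \<Longrightarrow> \<bar>real_of_int (\<Phi> x y)\<bar> \<le> K * \<bar>real_of_int y\<bar> ^ n"
    and K: "K \<ge> 1" and D: "D > 0" and \<kappa>: "\<kappa> > 0" and \<epsilon>: "0 < \<epsilon>" "\<epsilon> < 1 / real n" "n \<ge> 2"
  shows "\<exists>C > 0. \<forall>\<^sub>F B in at_top. real (card {(x, y). gcd x y = 1 \<and> \<bar>x\<bar> \<le> \<bar>y\<bar> \<and>
      real_of_int \<bar>y\<bar> \<le> B \<and> \<Phi> x y \<noteq> 0 \<and>
      \<bar>real_of_int (\<Phi> x y)\<bar> powr \<epsilon> \<le> \<kappa> * (\<Prod>p\<in>P. real p ^ multiplicity (int p) (\<Phi> x y))})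
    \<le> C * B powr (2 - real n * \<epsilon>) * ln B ^ (card P - 1)"
proof -
  define \<theta> where "\<theta> = 2 - real n * \<epsilon>"
  define s where "s = card P"
  define R where "R = (\<Prod>p\<in>P. int p ^ (g p + 1))"
  define M where "M v = (\<Prod>p\<in>P. real p ^ v p)" for v :: "nat \<Rightarrow> nat"
  have ne: "real n * \<epsilon> < 1" using \<epsilon> by (simp add: field_simps)
  have \<theta>: "\<theta> > 1" using ne by (simp add: \<theta>_def)
  have p0: "real p > 0" if "p \<in> P" for p using P(3)[OF that] prime_gt_0_nat by simp
  have M0: "M v > 0" for v unfolding M_def using p0 by (auto intro!: prod_pos)
  have lnM: "ln (M v) = (\<Sum>p\<in>P. real (v p) * ln (real p))" for v
    unfolding M_def using P(1) p0 by (subst ln_prod) (auto simp: ln_realpow)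
  have R0: "R > 0" unfolding R_def using P(3) prime_gt_0_nat by (intro prod_pos) simp
  have s1: "s \<ge> 1" using P by (simp add: s_def Suc_leI card_gt_0_iff)
  then have pow_s: "x ^ s = x * x ^ (s - 1)" for x :: real by (cases s) auto
  have lnp: "ln (real p) > 0" if "p \<in> P" for p using prime_gt_1_nat[OF P(3)[OF that]] by simp
  have "\<exists>E > 0. \<forall>V z. (\<Sum>v\<in>PiE P (\<lambda>_. {..V::nat}). exp (- \<bar>(\<Sum>p\<in>P. real (v p) * ln (real p)) - z\<bar>))
    \<le> E * (1 + max z 0) ^ (s - 1) * exp (min z 0)"
    unfolding s_def by (rule sum_exponents_exp_le[OF P(1,2)]) (rule lnp)
  then obtain E where E: "E > 0" "\<And>V z. (\<Sum>v\<in>PiE P (\<lambda>_. {..V::nat}). exp (- \<bar>(\<Sum>p\<in>P. real (v p) * ln (real p)) - z\<bar>))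
    \<le> E * (1 + max z 0) ^ (s - 1) * exp (min z 0)" by auto
  define C1 where "C1 = 8 * (\<Prod>p\<in>P. real p ^ g p) * max 1 (D * \<kappa> powr (1 / \<epsilon>))"
  have C1: "C1 > 0" unfolding C1_def using p0 by (intro mult_pos_pos prod_pos) auto
  \<comment> \<open>Labels for the nearest centre, the residues of x and y modulo \<open>R\<close>,
    and the sign of y; their number is a constant.\<close>
  define Q where "Q = {..<n} \<times> {0..<R} \<times> {0..<R} \<times> (UNIV :: bool set)"
  have finQ: "finite Q" by (simp add: Q_def)
  \<comment> \<open>The slope radius combines \<open>2 ^ j <= |y|\<close> with
    \<open>(\<kappa> * M v) powr (1 / \<epsilon>)\<close>, the largest value of
    \<open>|\<Phi>|\<close> that the condition on the P-part admits.\<close>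
  define T where "T j v q = (case q of (i, r1, r2, \<sigma>) \<Rightarrow>
     {(x, y). gcd x y = 1 \<and> \<bar>x\<bar> \<le> \<bar>y\<bar> \<and> 2 ^ j \<le> \<bar>y\<bar> \<and> \<bar>y\<bar> < 2 ^ (j + 1) \<and>
       (0 < y) = \<sigma> \<and> x mod R = r1 \<and> y mod R = r2 \<and> (\<forall>p\<in>P. int p ^ v p dvd \<Phi> x y) \<and>
       \<bar>real_of_int x / real_of_int y - c i\<bar> \<le> D * (\<kappa> * M v) powr (1 / \<epsilon>) / 2 ^ (j * n)})"
    for j v q
  have T: "finite (T j v q)" "real (card (T j v q)) \<le> 1 + C1 * (2 powr (real j * \<theta>) *
      exp (- \<bar>(\<Sum>p\<in>P. real (v p) * ln (real p)) - real j * real n * \<epsilon> * ln 2\<bar>))" for j v q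
  proof -
    obtain i r1 r2 \<sigma> where q: "q = (i, r1, r2, \<sigma>)" by (rule prod_cases4)
    have \<rho>: "0 \<le> D * (\<kappa> * M v) powr (1 / \<epsilon>) / 2 ^ (j * n)" using D by simp
    have TT: "T j v q = {(x, y). gcd x y = 1 \<and> \<bar>x\<bar> \<le> \<bar>y\<bar> \<and> 2 ^ j \<le> \<bar>y\<bar> \<and> \<bar>y\<bar> < 2 ^ (j + 1) \<and>
       (0 < y) = \<sigma> \<and> x mod R = r1 \<and> y mod R = r2 \<and> (\<forall>p\<in>P. int p ^ v p dvd \<Phi> x y) \<and>
       \<bar>real_of_int x / real_of_int y - c i\<bar> \<le> D * (\<kappa> * M v) powr (1 / \<epsilon>) / 2 ^ (j * n)}"
      by (simp only: T_def q prod.case)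
    show "finite (T j v q)"
      by (rule card_class_le(1)[OF P(1) _ _ R_def TT \<rho>]) (erule P(3), rule sep)
    have Mv: "(\<Prod>p\<in>P. real p ^ v p) = M v" by (simp only: M_def)
    show "real (card (T j v q)) \<le> 1 + C1 * (2 powr (real j * \<theta>) *
      exp (- \<bar>(\<Sum>p\<in>P. real (v p) * ln (real p)) - real j * real n * \<epsilon> * ln 2\<bar>))"
    proof -
      have "real (card (T j v q)) \<le> 1 + 8 * (\<Prod>p\<in>P. real p ^ g p) *
          (4 ^ j * min 1 (D * (\<kappa> * M v) powr (1 / \<epsilon>) / 2 ^ (j * n)) / M v)"
        unfolding Mv[symmetric]
        by (rule card_class_le(2)[OF P(1) _ _ R_def TT[unfolded M_def] \<rho>[unfolded M_def]]) (erule P(3), rule sep)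
      also have "\<dots> \<le> 1 + 8 * (\<Prod>p\<in>P. real p ^ g p) * (max 1 (D * \<kappa> powr (1 / \<epsilon>)) * 2 powr (real j * \<theta>)
          * exp (- \<bar>ln (M v) - real j * real n * \<epsilon> * ln 2\<bar>))"
        unfolding \<theta>_def by (intro add_left_mono mult_left_mono weight_le_exp) (use \<epsilon> M0 D \<kappa> in \<open>auto intro!: prod_nonneg\<close>)
      finally show ?thesis by (simp add: C1_def lnM mult_ac)
    qed
  qed
  define C2 where "C2 = real (card Q)"
  define L2 where "L2 = 1 / ln (2::real)"
  have L2: "L2 > 0" by (simp add: L2_def)
  define A where "A = (L2 + 1) * ((1 + real n) * L2 + 1) ^ s"
  have main: "real (card {(x, y). gcd x y = 1 \<and> \<bar>x\<bar> \<le> \<bar>y\<bar> \<and>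
      real_of_int \<bar>y\<bar> \<le> B \<and> \<Phi> x y \<noteq> 0 \<and>
      \<bar>real_of_int (\<Phi> x y)\<bar> powr \<epsilon> \<le> \<kappa> * (\<Prod>p\<in>P. real p ^ multiplicity (int p) (\<Phi> x y))})
    \<le> C2 * (A + C1 * E * 2 ^ s) * B powr \<theta> * ln B ^ (s - 1)"
    (is "real (card ?N) \<le> _")
    if B: "B \<ge> 3" "ln B \<ge> 1" "(ln B)\<^sup>2 \<le> B" "ln K \<le> ln B" for B
  proof -
    define J where "J = nat \<lfloor>log 2 B\<rfloor>"
    \<comment> \<open>No exponent exceeds \<open>V\<close>, since \<open>2 ^ v p <= p ^ v p\<close>,
      which is at most \<open>|\<Phi> x y|\<close> and hence at most
      \<open>K * B ^ n\<close>.\<close>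
    define V where "V = nat \<lfloor>log 2 (K * B ^ n)\<rfloor>"
    define W where "W = PiE P (\<lambda>_. {..V})"
    have finW: "finite W" unfolding W_def using P(1) by (intro finite_PiE) auto
    have "?N \<subseteq> (\<Union>j\<in>{..J}. \<Union>v\<in>W. \<Union>q\<in>Q. T j v q)"
    proof
      fix w assume "w \<in> ?N"
      obtain x y where w: "w = (x, y)" by (cases w)
      have xy: "gcd x y = 1" "\<bar>x\<bar> \<le> \<bar>y\<bar>" "real_of_int \<bar>y\<bar> \<le> B" "\<Phi> x y \<noteq> 0"
        "\<bar>real_of_int (\<Phi> x y)\<bar> powr \<epsilon> \<le> \<kappa> * (\<Prod>p\<in>P. real p ^ multiplicity (int p) (\<Phi> x y))"
        using \<open>w \<in> ?N\<close> unfolding w mem_Collect_eq prod.case by blast+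
      have y0: "y \<noteq> 0" using xy by auto
      define j where "j = nat \<lfloor>log 2 (real_of_int \<bar>y\<bar>)\<rfloor>"
      have y1: "real_of_int \<bar>y\<bar> \<ge> 1" using y0 by linarith
      have jr: "real j = of_int \<lfloor>log 2 (real_of_int \<bar>y\<bar>)\<rfloor>" using y1 by (simp add: j_def)
      have "real j \<le> log 2 (real_of_int \<bar>y\<bar>)" "log 2 (real_of_int \<bar>y\<bar>) < real j + 1"
        unfolding jr by linarith+
      then have "2 powr real j \<le> real_of_int \<bar>y\<bar>" "real_of_int \<bar>y\<bar> < 2 powr (real j + 1)"
        using y1 le_log_iff[of 2 "real_of_int \<bar>y\<bar>" "real j"]
          log_less_iff[of 2 "real_of_int \<bar>y\<bar>" "real j + 1"] by auto
      then have jy: "(2::real) ^ j \<le> real_of_int \<bar>y\<bar>" "real_of_int \<bar>y\<bar> < (2::real) ^ (j + 1)"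
        by (simp_all add: powr_realpow powr_add)
      then have jy': "2 ^ j \<le> \<bar>y\<bar>" "\<bar>y\<bar> < 2 ^ (j + 1)"
      proof -
        have "real_of_int (2 ^ j) \<le> real_of_int \<bar>y\<bar>" "real_of_int \<bar>y\<bar> < real_of_int (2 ^ (j + 1))"
          using jy by simp_all
        then show "2 ^ j \<le> \<bar>y\<bar>" "\<bar>y\<bar> < 2 ^ (j + 1)" by (simp_all only: of_int_le_iff of_int_less_iff)
      qed
      have jJ: "j \<le> J" unfolding j_def J_def using xy(3) y1 by (intro nat_mono floor_mono) simp
      define v where "v = restrict (\<lambda>p. multiplicity (int p) (\<Phi> x y)) P"
      have vdvd: "int p ^ v p dvd \<Phi> x y" if "p \<in> P" for p
        using that by (simp add: v_def multiplicity_dvd)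
      have \<Phi>B: "\<bar>real_of_int (\<Phi> x y)\<bar> \<le> K * B ^ n"
      proof -
        have "\<bar>real_of_int y\<bar> ^ n \<le> B ^ n" using xy(3) by (intro power_mono) auto
        then show ?thesis using bound[OF xy(2)] K by (meson mult_left_mono order_trans zero_le_one)
      qed
      have vV: "v p \<le> V" if p: "p \<in> P" for p
      proof -
        have "2 ^ v p \<le> real p ^ v p"
          using P(3)[OF p] prime_ge_2_nat by (intro power_mono) auto
        also have "int p ^ v p \<le> \<bar>\<Phi> x y\<bar>"
          using vdvd[OF p] xy(4) by (intro zdvd_imp_le) auto
        then have "real p ^ v p \<le> \<bar>real_of_int (\<Phi> x y)\<bar>"
        proof -
          assume "int p ^ v p \<le> \<bar>\<Phi> x y\<bar>"
          then have "real_of_int (int p ^ v p) \<le> real_of_int \<bar>\<Phi> x y\<bar>" by (simp only: of_int_le_iff)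
          then show ?thesis by simp
        qed
        also note \<Phi>B
        finally have "2 powr real (v p) \<le> K * B ^ n" by (simp add: powr_realpow)
        then have "real (v p) \<le> log 2 (K * B ^ n)" using K B by (subst le_log_iff) auto
        then show ?thesis unfolding V_def by (simp add: le_nat_floor)
      qed
      have vW: "v \<in> W" unfolding W_def using vV by (auto simp: v_def PiE_def)
      have Mv: "M v = (\<Prod>p\<in>P. real p ^ multiplicity (int p) (\<Phi> x y))"
        unfolding M_def v_def by (intro prod.cong) auto
      obtain i where i: "i < n" "\<bar>real_of_int x / real_of_int y - c i\<bar> \<le> D * \<bar>real_of_int (\<Phi> x y)\<bar> / \<bar>real_of_int y\<bar> ^ n"
        using cover[OF y0 xy(2)] by blast
      have "\<bar>real_of_int (\<Phi> x y)\<bar> = (\<bar>real_of_int (\<Phi> x y)\<bar> powr \<epsilon>) powr (1 / \<epsilon>)"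
        using \<epsilon> by (simp add: powr_powr)
      also have "\<dots> \<le> (\<kappa> * M v) powr (1 / \<epsilon>)"
        using xy(5) \<epsilon> unfolding Mv by (intro powr_mono2) auto
      finally have "D * \<bar>real_of_int (\<Phi> x y)\<bar> / \<bar>real_of_int y\<bar> ^ n \<le> D * (\<kappa> * M v) powr (1 / \<epsilon>) / (2 ^ j) ^ n"
        using D jy(1) y0 by (intro frac_le mult_left_mono power_mono) auto
      then have "(x, y) \<in> T j v (i, x mod R, y mod R, 0 < y)"
        using xy(1,2) jy' vdvd i(2) by (auto simp: T_def power_mult)
      moreover have "(i, x mod R, y mod R, 0 < y) \<in> Q" using i(1) R0 by (simp add: Q_def)
      ultimately show "w \<in> (\<Union>j\<in>{..J}. \<Union>v\<in>W. \<Union>q\<in>Q. T j v q)" using jJ vW unfolding w by blast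
    qed
    then have "card ?N \<le> card (\<Union>j\<in>{..J}. \<Union>v\<in>W. \<Union>q\<in>Q. T j v q)"
      using T(1) finW finQ by (intro card_mono) auto
    also have "\<dots> \<le> (\<Sum>j\<le>J. \<Sum>v\<in>W. \<Sum>q\<in>Q. card (T j v q))"
    proof -
      have "card (\<Union>q\<in>Q. T j v q) \<le> (\<Sum>q\<in>Q. card (T j v q))" for j v
        using finQ by (rule card_UN_le)
      moreover have "card (\<Union>v\<in>W. \<Union>q\<in>Q. T j v q) \<le> (\<Sum>v\<in>W. card (\<Union>q\<in>Q. T j v q))" for j
        using finW by (rule card_UN_le)
      ultimately have "card (\<Union>v\<in>W. \<Union>q\<in>Q. T j v q) \<le> (\<Sum>v\<in>W. \<Sum>q\<in>Q. card (T j v q))" for j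
        by (meson order_trans sum_mono)
      then have "(\<Sum>j\<le>J. card (\<Union>v\<in>W. \<Union>q\<in>Q. T j v q)) \<le> (\<Sum>j\<le>J. \<Sum>v\<in>W. \<Sum>q\<in>Q. card (T j v q))"
        by (intro sum_mono)
      then show ?thesis by (rule order_trans[OF card_UN_le[OF finite_atMost]])
    qed
    finally have "real (card ?N) \<le> (\<Sum>j\<le>J. \<Sum>v\<in>W. \<Sum>q\<in>Q. real (card (T j v q)))"
      unfolding of_nat_sum[symmetric] by (simp only: of_nat_le_iff)
    also have "\<dots> \<le> (\<Sum>j\<le>J. \<Sum>v\<in>W. \<Sum>q\<in>Q. 1 + C1 * (2 powr (real j * \<theta>) *
      exp (- \<bar>(\<Sum>p\<in>P. real (v p) * ln (real p)) - real j * real n * \<epsilon> * ln 2\<bar>)))"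
      by (intro sum_mono T)
    also have "\<dots> = C2 * (real (J + 1) * real (card W) + C1 * (\<Sum>j\<le>J. 2 powr (real j * \<theta>) * (\<Sum>v\<in>W.
      exp (- \<bar>(\<Sum>p\<in>P. real (v p) * ln (real p)) - real j * real n * \<epsilon> * ln 2\<bar>))))"
    proof -
      have "(\<Sum>j\<le>J. \<Sum>v\<in>W. \<Sum>q\<in>Q. 1 + C1 * (a j * b j v))
          = C2 * (real (J + 1) * real (card W) + C1 * (\<Sum>j\<le>J. a j * (\<Sum>v\<in>W. b j v)))" for a b
        by (simp add: C2_def sum.distrib sum_distrib_left distrib_left distrib_right mult.assoc mult.left_commute)
      then show ?thesis .
    qed
    also have "\<dots> \<le> C2 * (A * (ln B ^ (s - 1) * B powr \<theta>) + C1 * (E * 2 ^ s * (ln B ^ (s - 1) * B powr \<theta>)))"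
    proof (intro mult_left_mono add_mono)
      have lB: "ln B > 0" using B by simp
      have "real J = of_int \<lfloor>log 2 B\<rfloor>" using B(1) by (simp add: J_def)
      then have JB: "real J \<le> log 2 B" by linarith
      have J1: "real (J + 1) \<le> (L2 + 1) * ln B"
        using JB B(2) by (simp add: L2_def log_def algebra_simps)
      have "1 \<le> K * B ^ n" using K B(1) mult_mono[of 1 K 1 "B ^ n"] by simp
      then have "real V = of_int \<lfloor>log 2 (K * B ^ n)\<rfloor>" by (simp add: V_def)
      then have "real V \<le> log 2 (K * B ^ n)" by linarith
      also have "\<dots> = (ln K + real n * ln B) * L2"
        using K B(1) by (simp add: log_def L2_def ln_mult ln_realpow)
      also have "\<dots> \<le> (1 + real n) * L2 * ln B"
        using B(4) L2 by (simp add: algebra_simps)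
      finally have V1: "real (V + 1) \<le> ((1 + real n) * L2 + 1) * ln B"
        using B(2) by (simp add: algebra_simps)
      have "card W = (V + 1) ^ s" unfolding W_def s_def using P(1) by (simp add: card_PiE)
      then have "real (J + 1) * real (card W) \<le> ((L2 + 1) * ln B) * (((1 + real n) * L2 + 1) * ln B) ^ s"
        using J1 V1 by (auto intro!: mult_mono power_mono)
      also have "\<dots> = A * (ln B ^ (s - 1) * (ln B)\<^sup>2)"
        by (simp add: A_def power_mult_distrib power2_eq_square pow_s[of "ln B"] mult_ac)
      \<comment> \<open>Two of the s + 1 logarithms are too many; they are paid for by B, which is
        below \<open>B powr \<theta>\<close>.\<close>
      also have "\<dots> \<le> A * (ln B ^ (s - 1) * B powr \<theta>)"
      proof -
        have "B powr 1 \<le> B powr \<theta>" using B(1) \<theta> by (intro powr_mono) auto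
        then have "(ln B)\<^sup>2 \<le> B powr \<theta>" using B by simp
        then show ?thesis using L2 lB by (intro mult_left_mono) (auto simp: A_def)
      qed
      finally show "real (J + 1) * real (card W) \<le> A * (ln B ^ (s - 1) * B powr \<theta>)" .
      have "(\<Sum>j\<le>J. 2 powr (real j * \<theta>) * (\<Sum>v\<in>W.
          exp (- \<bar>(\<Sum>p\<in>P. real (v p) * ln (real p)) - real j * real n * \<epsilon> * ln 2\<bar>)))
        \<le> (\<Sum>j\<le>J. 2 powr (real j * \<theta>) * (E * (2 * ln B) ^ (s - 1)))"
      proof (intro sum_mono mult_left_mono)
        fix j assume "j \<in> {..J}"
        then have "real j \<le> log 2 B" using JB by simp
        then have "real j * ln 2 \<le> ln B" by (simp add: log_def field_simps)
        then have "(real n * \<epsilon>) * (real j * ln 2) \<le> 1 * ln B"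
          using ne \<epsilon> by (intro mult_mono) auto
        then have z: "real j * real n * \<epsilon> * ln 2 \<le> ln B" by (simp add: mult_ac)
        have z0: "0 \<le> real j * real n * \<epsilon> * ln 2" using \<epsilon> by simp
        have "(\<Sum>v\<in>W. exp (- \<bar>(\<Sum>p\<in>P. real (v p) * ln (real p)) - real j * real n * \<epsilon> * ln 2\<bar>))
          \<le> E * (1 + real j * real n * \<epsilon> * ln 2) ^ (s - 1)"
          using E(2)[where V = V and z = "real j * real n * \<epsilon> * ln 2"] z0 unfolding W_def by simp
        also have "\<dots> \<le> E * (2 * ln B) ^ (s - 1)"
          using E(1) z z0 B(2) by (intro mult_left_mono power_mono) auto
        finally show "(\<Sum>v\<in>W. exp (- \<bar>(\<Sum>p\<in>P. real (v p) * ln (real p)) - real j * real n * \<epsilon> * ln 2\<bar>))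
          \<le> E * (2 * ln B) ^ (s - 1)" .
      qed auto
      also have "\<dots> = (\<Sum>j\<le>J. (2 powr \<theta>) ^ j) * (E * (2 * ln B) ^ (s - 1))"
        by (simp add: sum_distrib_right powr_powr[symmetric] powr_realpow mult.commute[of _ \<theta>])
      also have "\<dots> \<le> (2 * B powr \<theta>) * (E * (2 * ln B) ^ (s - 1))"
      proof (intro mult_right_mono)
        have r: "2 powr \<theta> \<ge> 2" using powr_mono[of 1 \<theta> 2] \<theta> by simp
        \<comment> \<open>The ratio \<open>2 powr \<theta>\<close> is at least 2, so the top dyadic
          block dominates and no logarithm comes from the sum over heights.\<close>
        have "(\<Sum>j\<le>J. r ^ j) \<le> 2 * r ^ J" if "r \<ge> 2" for r :: real
        proof (induction J)
          case (Suc J)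
          have "2 * r ^ J \<le> r * r ^ J" using that by (intro mult_right_mono) auto
          then show ?case using Suc by simp
        qed simp
        then have "(\<Sum>j\<le>J. (2 powr \<theta>) ^ j) \<le> 2 * (2 powr \<theta>) ^ J" using r by blast
        also have "(2 powr \<theta>) ^ J = (2 powr real J) powr \<theta>"
          by (simp add: powr_powr powr_realpow[symmetric] mult.commute)
        also have "\<dots> \<le> B powr \<theta>"
        proof -
          have "2 powr real J \<le> B" using JB B(1) by (subst (asm) le_log_iff) auto
          then show ?thesis using \<theta> by (intro powr_mono2) auto
        qed
        finally show "(\<Sum>j\<le>J. (2 powr \<theta>) ^ j) \<le> 2 * B powr \<theta>" by simp
      qed (use E(1) lB in auto)
      also have "\<dots> = E * 2 ^ s * (ln B ^ (s - 1) * B powr \<theta>)"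
        by (simp add: power_mult_distrib pow_s[of 2] mult_ac)
      finally show "(\<Sum>j\<le>J. 2 powr (real j * \<theta>) * (\<Sum>v\<in>W.
          exp (- \<bar>(\<Sum>p\<in>P. real (v p) * ln (real p)) - real j * real n * \<epsilon> * ln 2\<bar>)))
        \<le> E * 2 ^ s * (ln B ^ (s - 1) * B powr \<theta>)" .
    qed (use C1 in \<open>auto simp: C2_def\<close>)
    also have "\<dots> = C2 * (A + C1 * E * 2 ^ s) * B powr \<theta> * ln B ^ (s - 1)"
      by (simp add: algebra_simps)
    finally show ?thesis .
  qed
  have "Q \<noteq> {}" using R0 \<epsilon>(3) by (auto simp: Q_def lessThan_empty_iff)
  then have "C2 > 0" using finQ by (simp add: C2_def card_gt_0_iff)
  moreover have "A > 0" unfolding A_def using L2 by (intro mult_pos_pos zero_less_power) (auto intro!: add_nonneg_pos)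
  ultimately have "C2 * (A + C1 * E * 2 ^ s) > 0" using C1 E(1) by (intro mult_pos_pos add_pos_pos) auto
  moreover have "\<forall>\<^sub>F B in at_top. real (card {(x, y). gcd x y = 1 \<and> \<bar>x\<bar> \<le> \<bar>y\<bar> \<and>
      real_of_int \<bar>y\<bar> \<le> B \<and> \<Phi> x y \<noteq> 0 \<and>
      \<bar>real_of_int (\<Phi> x y)\<bar> powr \<epsilon> \<le> \<kappa> * (\<Prod>p\<in>P. real p ^ multiplicity (int p) (\<Phi> x y))})
    \<le> C2 * (A + C1 * E * 2 ^ s) * B powr \<theta> * ln B ^ (s - 1)"
    using log_growth_eventually[of K] by eventually_elim (blast intro: main)
  ultimately show ?thesis unfolding \<theta>_def s_def by blast
qed

section \<open>Counting primitive points from below\<close>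

lemma card_pairwise_cong_le:
  fixes S :: "int set"
  assumes S: "S \<subseteq> {1..int N}" and m: "m > 0" and cong: "\<And>x y. x \<in> S \<Longrightarrow> y \<in> S \<Longrightarrow> m dvd x - y"
  shows "real (card S) \<le> real N / real_of_int m + 1"
proof -
  have "inj_on (\<lambda>x. x div m) S"
  proof (rule inj_onI)
    fix x y assume xy: "x \<in> S" "y \<in> S" "x div m = y div m"
    then have "x mod m = y mod m" using cong by (simp add: mod_eq_dvd_iff)
    then show "x = y" using xy(3) by (metis div_mult_mod_eq)
  qed
  moreover have "(\<lambda>x. x div m) ` S \<subseteq> {0..int N div m}"
    using S m by (auto simp: pos_imp_zdiv_nonneg_iff zdiv_mono1)
  ultimately have "card S \<le> card {0..int N div m}" by (intro card_inj_on_le) auto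
  also have "\<dots> = nat (int N div m + 1)" by simp
  finally have "card S \<le> nat (int N div m + 1)" .
  moreover have "0 \<le> int N div m" using m by (simp add: pos_imp_zdiv_nonneg_iff)
  ultimately have "int (card S) \<le> int N div m + 1" by linarith
  then have "real (card S) \<le> real_of_int (int N div m) + 1" by linarith
  moreover have "real_of_int (int N div m) \<le> real N / real_of_int m"
    using real_of_int_div4[of "int N" m] by simp
  ultimately show ?thesis by linarith
qed

lemma card_residue_class_ge:
  fixes r m :: int
  assumes m: "m > 0"
  shows "real N / real_of_int m - 1 \<le> real (card {x\<in>{1..int N}. [x = r] (mod m)})"
proof -
  \<comment> \<open>The representative is taken in 1..m and not in 0..m-1, because the points start
    at 1.\<close>
  define r0 where "r0 = (r - 1) mod m + 1"
  have r0: "1 \<le> r0" "r0 \<le> m" using pos_mod_bound[OF m, of "r - 1"] pos_mod_sign[OF m, of "r - 1"]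
    by (auto simp: r0_def)
  have r0r: "[r0 = r] (mod m)" unfolding r0_def Cong.cong_def by (simp add: mod_simps)
  have "(\<lambda>k. r0 + k * m) ` {0..<int N div m} \<subseteq> {x\<in>{1..int N}. [x = r] (mod m)}"
  proof (rule image_subsetI)
    fix k assume k: "k \<in> {0..<int N div m}"
    then have "(k + 1) * m \<le> (int N div m) * m" using m by (intro mult_right_mono) auto
    also have "\<dots> \<le> int N" using m by (metis mod_div_trivial mult.commute mult_div_mod_eq le_add_same_cancel1 pos_mod_sign)
    finally have "r0 + k * m \<le> int N" using r0 by (simp add: algebra_simps)
    moreover have "0 \<le> k * m" using k m by simp
    moreover have "[r0 + k * m = r] (mod m)" using r0r by (simp add: Cong.cong_def)
    ultimately show "r0 + k * m \<in> {x\<in>{1..int N}. [x = r] (mod m)}" using r0 by auto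
  qed
  moreover have "inj_on (\<lambda>k. r0 + k * m) {0..<int N div m}" using m by (auto simp: inj_on_def)
  ultimately have "card {0..<int N div m} \<le> card {x\<in>{1..int N}. [x = r] (mod m)}"
    by (intro card_inj_on_le) (auto intro: finite_subset[of _ "{1..int N}"])
  then have "real_of_int (int N div m) \<le> real (card {x\<in>{1..int N}. [x = r] (mod m)})"
    using m by (simp add: pos_imp_zdiv_nonneg_iff)
  moreover have "real N / real_of_int m \<le> real_of_int (int N div m) + 1"
    using real_of_int_div3[of "int N" m] by simp
  ultimately show ?thesis by linarith
qed

section \<open>Sieve for primitive points of a congruence lattice\<close>

lemma sum_inverse_squares_le:
  assumes "N \<ge> 2"
  shows "(\<Sum>q = 2..N. 1 / (real q)\<^sup>2) \<le> 3 / 4 - 1 / real N"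
  using assms
proof (induction N rule: dec_induct)
  case (step N)
  have "1 / (real (Suc N))\<^sup>2 \<le> 1 / (real N * real (Suc N))"
    using step by (intro divide_left_mono) (auto simp: power2_eq_square)
  also have "\<dots> = 1 / real N - 1 / real (Suc N)" using step by (simp add: field_simps)
  finally show ?case using step by simp
qed simp

lemma sum_inverse_le_ln:
  assumes "N \<ge> 1"
  shows "(\<Sum>q = 2..N. 1 / real q) \<le> ln (real N)"
  using assms
proof (induction N rule: dec_induct)
  case (step N)
  have "ln (real N / real (Suc N)) \<le> real N / real (Suc N) - 1"
    using step by (intro ln_le_minus_one) auto
  also have "\<dots> = - 1 / real (Suc N)" by (simp add: field_simps)
  finally have "1 / real (Suc N) \<le> ln (real (Suc N)) - ln (real N)"
    using step by (simp add: ln_div)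
  then show ?case using step by simp
qed simp

text \<open>Subtract, for every integer q >= 2, the pairs divisible by q. The condition that u is 1
  modulo P makes any common divisor prime to Q, so divisibility by q is independent of the
  congruences and costs a proportion 1 / q^2. These proportions sum to at most 3 / 4, so a quarter
  of the main term is left; rounding in the residue counts gives the error terms.\<close>

lemma card_primitive_lattice_ge:
  fixes P Q t :: int
  assumes P: "1 \<le> P" "P dvd Q" and Q: "0 < Q" "Q \<le> int N"
    and rad: "\<And>q. prime q \<Longrightarrow> q dvd Q \<Longrightarrow> q dvd P"
  shows "(real N)\<^sup>2 / (4 * real_of_int P * real_of_int Q) - 3 * real N - 2 * real N * ln (real N)
    \<le> real (card {(u, v). u \<in> {1..int N} \<and> v \<in> {1..int N} \<and> [u = 1] (mod P) \<and> [v = t * u] (mod Q) \<and> coprime u v})"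
proof -
  define U where "U = {u\<in>{1..int N}. [u = 1] (mod P)}"
  define V where "V u = {v\<in>{1..int N}. [v = t * u] (mod Q)}" for u
  define Uq where "Uq q = {u\<in>U. int q dvd u}" for q :: nat
  define Vq where "Vq q u = {v\<in>V u. int q dvd v}" for q :: nat and u
  define I where "I = {q\<in>{2..N}. coprime (int q) Q}"
  define G where "G = {(u, v). u \<in> {1..int N} \<and> v \<in> {1..int N} \<and> [u = 1] (mod P) \<and> [v = t * u] (mod Q) \<and> coprime u v}"
  let ?N = "real N" and ?P = "real_of_int P" and ?Q = "real_of_int Q"
  have N1: "N \<ge> 1" using Q by linarith
  have PQ: "P \<le> Q" using P Q by (intro zdvd_imp_le) auto
  have fin: "finite U" "finite (V u)" "finite (Uq q)" "finite (Vq q u)" for u q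
    by (auto simp: U_def V_def Uq_def Vq_def intro: finite_subset[of _ "{1..int N}"])
  have cop: "coprime q P" if "coprime q Q" for q using that P(2) by (meson coprime_divisors dvd_refl)
  have "Sigma U V \<subseteq> G \<union> (\<Union>q\<in>I. Sigma (Uq q) (Vq q))"
  proof
    fix z assume z: "z \<in> Sigma U V"
    then obtain u v where uv: "z = (u, v)" "u \<in> U" "v \<in> V u" by auto
    show "z \<in> G \<union> (\<Union>q\<in>I. Sigma (Uq q) (Vq q))"
    proof (cases "coprime u v")
      case True
      then show ?thesis using uv by (auto simp: G_def U_def V_def)
    next
      case False
      define q where "q = nat (gcd u v)"
      have u: "1 \<le> u" "u \<le> int N" "[u = 1] (mod P)" using uv by (auto simp: U_def)
      have "gcd u v > 0" using u by (simp add: gcd_pos_int)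
      then have q: "int q = gcd u v" by (simp add: q_def)
      have "gcd u v \<noteq> 1" using False by (simp add: coprime_iff_gcd_eq_1)
      then have q2: "q \<ge> 2" using \<open>gcd u v > 0\<close> q by linarith
      have qu: "int q dvd u" "int q dvd v" unfolding q by auto
      then have "int q \<le> u" using u by (intro zdvd_imp_le) auto
      then have "q \<le> N" using u by linarith
      moreover have "coprime (int q) Q"
      proof (rule ccontr)
        assume "\<not> coprime (int q) Q"
        then obtain d where d: "d dvd int q" "d dvd Q" "\<not> is_unit d" by (rule not_coprimeE)
        have "d \<noteq> 0" using d(1) q2 by auto
        then obtain r where "prime r" "r dvd d" using d(3) prime_divisor_exists by blast
        then have r: "prime r" "r dvd int q" "r dvd Q" using d by (auto intro: dvd_trans)
        have "r dvd P" using rad r by blast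
        then have "[u = 1] (mod r)" using u(3) by (rule cong_dvd_mono_modulus[rotated])
        moreover have "r dvd u" using r qu by (meson dvd_trans)
        ultimately have "r dvd 1" by (simp add: cong_dvd_iff)
        then show False using r(1) not_prime_unit by blast
      qed
      ultimately show ?thesis using uv q2 qu by (auto simp: I_def Uq_def Vq_def)
    qed
  qed
  then have "card (Sigma U V) \<le> card (G \<union> (\<Union>q\<in>I. Sigma (Uq q) (Vq q)))"
    by (intro card_mono) (auto simp: I_def fin G_def
        intro: finite_subset[of _ "{1..int N} \<times> {1..int N}"] finite_SigmaI)
  also have "\<dots> \<le> card G + card (\<Union>q\<in>I. Sigma (Uq q) (Vq q))" by (rule card_Un_le)
  also have "card (\<Union>q\<in>I. Sigma (Uq q) (Vq q)) \<le> (\<Sum>q\<in>I. card (Sigma (Uq q) (Vq q)))"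
    by (rule card_UN_le) (simp add: I_def)
  finally have "real (card (Sigma U V)) \<le> real (card G) + (\<Sum>q\<in>I. real (card (Sigma (Uq q) (Vq q))))"
    unfolding of_nat_sum[symmetric] of_nat_add[symmetric] by (simp only: of_nat_le_iff)
  moreover have "(?N / ?P - 1) * (?N / ?Q - 1) \<le> real (card (Sigma U V))"
  proof -
    have n1: "1 \<le> ?N / ?Q" using Q by (simp add: field_simps)
    have "real (card (Sigma U V)) = (\<Sum>u\<in>U. real (card (V u)))" using fin by (simp add: card_SigmaI)
    also have "\<dots> \<ge> (\<Sum>u\<in>U. ?N / ?Q - 1)"
      unfolding V_def by (intro sum_mono card_residue_class_ge Q)
    finally have "real (card U) * (?N / ?Q - 1) \<le> real (card (Sigma U V))" by simp
    moreover have "(?N / ?P - 1) * (?N / ?Q - 1) \<le> real (card U) * (?N / ?Q - 1)"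
      using P n1 unfolding U_def by (intro mult_right_mono card_residue_class_ge) auto
    ultimately show ?thesis by linarith
  qed
  moreover have "(\<Sum>q\<in>I. real (card (Sigma (Uq q) (Vq q)))) \<le>
      (\<Sum>q\<in>I. (?N / ?P * (1 / real q) + 1) * (?N / ?Q * (1 / real q) + 1))"
  proof (intro sum_mono)
    fix q assume "q \<in> I"
    then have q: "2 \<le> q" "coprime (int q) Q" "coprime (int q) P" using cop by (auto simp: I_def)
    have u: "real (card (Uq q)) \<le> ?N / ?P * (1 / real q) + 1"
    proof -
      have "real (card (Uq q)) \<le> ?N / real_of_int (int q * P) + 1"
      proof (rule card_pairwise_cong_le)
        fix x y assume xy: "x \<in> Uq q" "y \<in> Uq q"
        then have "[x = y] (mod P)" by (auto simp: Uq_def U_def intro: cong_trans cong_sym)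
        then have "P dvd x - y" by (simp add: cong_iff_dvd_diff)
        moreover have "int q dvd x - y" using xy by (auto simp: Uq_def)
        ultimately show "int q * P dvd x - y" using q by (intro divides_mult) auto
      qed (use P q in \<open>auto simp: Uq_def U_def\<close>)
      then show ?thesis by (simp add: field_simps)
    qed
    have v: "real (card (Vq q u)) \<le> ?N / ?Q * (1 / real q) + 1" for u
    proof -
      have "real (card (Vq q u)) \<le> ?N / real_of_int (int q * Q) + 1"
      proof (rule card_pairwise_cong_le)
        fix x y assume xy: "x \<in> Vq q u" "y \<in> Vq q u"
        then have "[x = y] (mod Q)" by (auto simp: Vq_def V_def intro: cong_trans cong_sym)
        then have "Q dvd x - y" by (simp add: cong_iff_dvd_diff)
        moreover have "int q dvd x - y" using xy by (auto simp: Vq_def)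
        ultimately show "int q * Q dvd x - y" using q by (intro divides_mult) auto
      qed (use Q q in \<open>auto simp: Vq_def V_def\<close>)
      then show ?thesis by (simp add: field_simps)
    qed
    have "real (card (Sigma (Uq q) (Vq q))) = (\<Sum>u\<in>Uq q. real (card (Vq q u)))"
      using fin by (simp add: card_SigmaI)
    also have "\<dots> \<le> (\<Sum>u\<in>Uq q. ?N / ?Q * (1 / real q) + 1)" by (intro sum_mono v)
    also have "\<dots> = real (card (Uq q)) * (?N / ?Q * (1 / real q) + 1)" by simp
    also have "\<dots> \<le> (?N / ?P * (1 / real q) + 1) * (?N / ?Q * (1 / real q) + 1)"
      using u Q by (intro mult_right_mono) auto
    finally show "real (card (Sigma (Uq q) (Vq q))) \<le> (?N / ?P * (1 / real q) + 1) * (?N / ?Q * (1 / real q) + 1)" .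
  qed
  moreover have "(\<Sum>q\<in>I. (?N / ?P * (1 / real q) + 1) * (?N / ?Q * (1 / real q) + 1))
      \<le> (\<Sum>q = 2..N. (?N / ?P * (1 / real q) + 1) * (?N / ?Q * (1 / real q) + 1))"
    using P Q by (intro sum_mono2) (auto simp: I_def)
  moreover have "(\<Sum>q = 2..N. (?N / ?P * (1 / real q) + 1) * (?N / ?Q * (1 / real q) + 1))
      \<le> 3 / 4 * (?N / ?P * (?N / ?Q)) + (?N / ?P + ?N / ?Q) * ln ?N + ?N"
  proof -
    have expand: "(\<Sum>q = 2..N. (a * (1 / real q) + 1) * (b * (1 / real q) + 1))
        = a * b * (\<Sum>q = 2..N. 1 / (real q)\<^sup>2) + (a + b) * (\<Sum>q = 2..N. 1 / real q) + (\<Sum>q = 2..N. 1)" for a b :: real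
      unfolding sum_distrib_left sum.distrib[symmetric]
      by (intro sum.cong) (auto simp: algebra_simps power2_eq_square add_divide_distrib)
    have h1: "?N / ?P * (?N / ?Q) * (\<Sum>q = 2..N. 1 / (real q)\<^sup>2) \<le> ?N / ?P * (?N / ?Q) * (3 / 4)"
    proof (rule mult_left_mono)
      show "(\<Sum>q = 2..N. 1 / (real q)\<^sup>2) \<le> 3 / 4"
      proof (cases "N \<ge> 2")
        case True
        have "0 \<le> 1 / real N" by simp
        then show ?thesis using sum_inverse_squares_le[OF True] by linarith
      qed simp
    qed (use P Q in auto)
    have h2: "(?N / ?P + ?N / ?Q) * (\<Sum>q = 2..N. 1 / real q) \<le> (?N / ?P + ?N / ?Q) * ln ?N"
      using P Q by (intro mult_left_mono sum_inverse_le_ln N1) auto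
    have h3: "(\<Sum>q = 2..N. 1) \<le> ?N" by simp
    show ?thesis unfolding expand mult.commute[of "3 / 4"] by (intro add_mono h1 h2 h3)
  qed
  moreover have "?N / ?P \<le> ?N" "?N / ?Q \<le> ?N"
    using P Q by (auto simp: divide_le_eq mult_le_cancel_left1)
  moreover from this have "(?N / ?P + ?N / ?Q) * ln ?N \<le> (?N + ?N) * ln ?N"
    using N1 by (intro mult_right_mono add_mono) auto
  ultimately have "?N / ?P * (?N / ?Q) / 4 - 3 * ?N - 2 * ?N * ln ?N \<le> real (card G)"
    by (simp add: algebra_simps)
  then show ?thesis unfolding G_def by (simp add: power2_eq_square field_simps)
qed

section \<open>Lower bound: combining primes and exponent vectors\<close>

lemma crt_int:
  fixes P :: "nat set" and m :: "nat \<Rightarrow> nat" and t :: "nat \<Rightarrow> int"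
  assumes P: "finite P" "\<And>p. p \<in> P \<Longrightarrow> prime p"
  shows "\<exists>x::int. \<forall>p\<in>P. [x = t p] (mod int p ^ m p)"
proof -
  have "\<exists>x. \<forall>p\<in>P. [x = nat (t p mod int p ^ m p)] (mod p ^ m p)"
    by (rule chinese_remainder_nat[OF P(1)]) (use P in \<open>auto simp: primes_coprime\<close>)
  then obtain x where x: "\<And>p. p \<in> P \<Longrightarrow> [x = nat (t p mod int p ^ m p)] (mod p ^ m p)" by blast
  have "[int x = t p] (mod int p ^ m p)" if "p \<in> P" for p
  proof -
    have "int p ^ m p > 0" using P(2)[OF that] prime_gt_0_nat by simp
    then have "int (nat (t p mod int p ^ m p)) = t p mod int p ^ m p" by simp
    moreover have "[int x = int (nat (t p mod int p ^ m p))] (mod int (p ^ m p))"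
      using x[OF that] by (simp only: cong_int_iff)
    ultimately show ?thesis by (simp add: Cong.cong_def)
  qed
  then show ?thesis by blast
qed

lemma exists_power_between:
  fixes X Y r :: real
  assumes "1 < r" "0 < Y" "Y \<le> X"
  shows "\<exists>j. X \<le> Y * r ^ j \<and> Y * r ^ j \<le> r * X"
proof -
  obtain k where "X / Y < r ^ k" using real_arch_pow[OF assms(1)] by blast
  then have ex: "X \<le> Y * r ^ k" using assms by (simp add: field_simps)
  define j where "j = (LEAST j. X \<le> Y * r ^ j)"
  have j: "X \<le> Y * r ^ j" unfolding j_def using ex by (rule LeastI)
  moreover have "Y * r ^ j \<le> r * X"
  proof (cases j)
    case 0
    then show ?thesis using assms mult_mono[of 1 r Y X] by simp
  next
    case (Suc i)
    then have "\<not> X \<le> Y * r ^ i" unfolding j_def by (metis lessI not_less_Least)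
    then have "r * (Y * r ^ i) \<le> r * X" using assms by (intro mult_left_mono) auto
    then show ?thesis using Suc by (simp add: mult_ac)
  qed
  ultimately show ?thesis by blast
qed

text \<open>The Chinese remainder theorem merges the local multipliers into one \<open>t\<close>.
  Prescribing u to be 1 modulo the product of P makes u a unit at each p and also meets the
  condition of the sieve on common divisors.\<close>

lemma lattice_class_ge:
  fixes G :: "int \<Rightarrow> int \<Rightarrow> int" and P :: "nat set" and m :: "nat \<Rightarrow> nat"
  assumes P: "finite P" "\<And>p. p \<in> P \<Longrightarrow> prime p"
    and exact: "\<And>p. p \<in> P \<Longrightarrow> \<exists>t. \<forall>u v. \<not> int p dvd u \<longrightarrow> [v = t * u] (mod int p ^ (m p + 1)) \<longrightarrow>
      int p ^ m p dvd G u v \<and> \<not> int p ^ (m p + 1) dvd G u v"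
    and Q: "Q = (\<Prod>p\<in>P. int p ^ (m p + 1))" "Q \<le> int N"
  shows "(real N)\<^sup>2 / (4 * real_of_int (\<Prod>p\<in>P. int p) * real_of_int Q) - 3 * real N - 2 * real N * ln (real N)
    \<le> real (card {(u, v). u \<in> {1..int N} \<and> v \<in> {1..int N} \<and> gcd u v = 1 \<and>
        (\<forall>p\<in>P. int p ^ m p dvd G u v \<and> \<not> int p ^ (m p + 1) dvd G u v)})"
proof -
  obtain tp where tp: "\<And>p u v. p \<in> P \<Longrightarrow> \<not> int p dvd u \<Longrightarrow> [v = tp p * u] (mod int p ^ (m p + 1)) \<Longrightarrow>
      int p ^ m p dvd G u v \<and> \<not> int p ^ (m p + 1) dvd G u v" using exact by metis
  obtain t where t: "\<And>p. p \<in> P \<Longrightarrow> [t = tp p] (mod int p ^ (m p + 1))"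
    using crt_int[OF P, of tp "\<lambda>p. m p + 1"] by blast
  define R where "R = (\<Prod>p\<in>P. int p)"
  have pos: "0 < int p" if "p \<in> P" for p using P(2)[OF that] prime_gt_0_nat by simp
  have "0 < R" "0 < Q" unfolding R_def Q using pos by (auto intro!: prod_pos)
  moreover have "R dvd Q" unfolding R_def Q by (rule prod_dvd_prod) simp
  moreover have "q dvd R" if q: "prime q" "q dvd Q" for q
  proof -
    obtain p where p: "p \<in> P" "q dvd int p ^ (m p + 1)"
      using q P(1) unfolding Q by (auto simp: prime_dvd_prod_iff)
    then have "q dvd int p" using q(1) prime_dvd_power by blast
    moreover have "int p dvd R" unfolding R_def using p P(1) by (intro dvd_prodI) auto
    ultimately show ?thesis by (rule dvd_trans)
  qed
  ultimately have "(real N)\<^sup>2 / (4 * real_of_int R * real_of_int Q) - 3 * real N - 2 * real N * ln (real N)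
    \<le> real (card {(u, v). u \<in> {1..int N} \<and> v \<in> {1..int N} \<and> [u = 1] (mod R) \<and> [v = t * u] (mod Q) \<and> coprime u v})"
    using Q(2) by (intro card_primitive_lattice_ge) auto
  also have "\<dots> \<le> real (card {(u, v). u \<in> {1..int N} \<and> v \<in> {1..int N} \<and> gcd u v = 1 \<and>
        (\<forall>p\<in>P. int p ^ m p dvd G u v \<and> \<not> int p ^ (m p + 1) dvd G u v)})"
  proof (rule of_nat_mono[OF card_mono])
    show "finite {(u, v). u \<in> {1..int N} \<and> v \<in> {1..int N} \<and> gcd u v = 1 \<and>
        (\<forall>p\<in>P. int p ^ m p dvd G u v \<and> \<not> int p ^ (m p + 1) dvd G u v)}"
      by (rule finite_subset[of _ "{1..int N} \<times> {1..int N}"]) auto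
    have "int p ^ m p dvd G u v \<and> \<not> int p ^ (m p + 1) dvd G u v"
      if p: "p \<in> P" and u: "[u = 1] (mod R)" and v: "[v = t * u] (mod Q)" for p u v
    proof (rule tp[OF p])
      have "int p dvd R" unfolding R_def using p P(1) by (intro dvd_prodI) auto
      then have "[u = 1] (mod int p)" using u by (rule cong_dvd_mono_modulus[rotated])
      then show "\<not> int p dvd u" using P(2)[OF p] by (auto simp: cong_dvd_iff)
      have "int p ^ (m p + 1) dvd Q" unfolding Q using p P(1) by (intro dvd_prodI) auto
      then have "[v = t * u] (mod int p ^ (m p + 1))" using v by (rule cong_dvd_mono_modulus[rotated])
      also have "[t * u = tp p * u] (mod int p ^ (m p + 1))" using t[OF p] by (rule cong_scalar_right)
      finally show "[v = tp p * u] (mod int p ^ (m p + 1))" .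
    qed
    then show "{(u, v). u \<in> {1..int N} \<and> v \<in> {1..int N} \<and> [u = 1] (mod R) \<and> [v = t * u] (mod Q) \<and> coprime u v}
      \<subseteq> {(u, v). u \<in> {1..int N} \<and> v \<in> {1..int N} \<and> gcd u v = 1 \<and>
        (\<forall>p\<in>P. int p ^ m p dvd G u v \<and> \<not> int p ^ (m p + 1) dvd G u v)}"
      by (auto simp only: mem_Collect_eq prod.case coprime_iff_gcd_eq_1 split_paired_all)
  qed
  finally show ?thesis unfolding R_def .
qed

lemma multiplicity_exact:
  fixes p x :: "'a::factorial_semiring"
  assumes "prime p" "p ^ m dvd x" "\<not> p ^ (m + 1) dvd x"
  shows "x \<noteq> 0" "multiplicity p x = m"
  using assms by (auto intro!: multiplicity_eqI)

text \<open>The exponents away from one prime \<open>p0\<close> run freely over a box of side about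
  ln B; the exponent at \<open>p0\<close> is then chosen to bring the product between X and p0 X,
  where X bounds \<open>|G| powr \<epsilon>\<close> on the box. This makes the P-part large enough
  and the modulus no larger than a constant times X.\<close>

lemma primitive_count_lower:
  fixes G :: "int \<Rightarrow> int \<Rightarrow> int" and P :: "nat set" and kmin n :: nat and \<epsilon> K :: real
  assumes P: "finite P" "P \<noteq> {}" "\<And>p. p \<in> P \<Longrightarrow> prime p"
    and exact: "\<And>p m. p \<in> P \<Longrightarrow> kmin \<le> m \<Longrightarrow>
      \<exists>t. \<forall>u v. \<not> int p dvd u \<longrightarrow> [v = t * u] (mod int p ^ (m + 1)) \<longrightarrow>
        int p ^ m dvd G u v \<and> \<not> int p ^ (m + 1) dvd G u v"
    and bound: "\<And>u v B. 1 \<le> u \<Longrightarrow> 1 \<le> v \<Longrightarrow> real_of_int u \<le> B \<Longrightarrow> real_of_int v \<le> B \<Longrightarrow>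
      \<bar>real_of_int (G u v)\<bar> \<le> K * B ^ n"
    and K: "K \<ge> 1" and \<epsilon>: "0 < \<epsilon>" "\<epsilon> < 1 / real n" "n \<ge> 1"
  shows "\<exists>c > 0. \<forall>\<^sub>F B in at_top. c * B powr (2 - real n * \<epsilon>) * ln B ^ (card P - 1) \<le>
    real (card {(u, v). 1 \<le> u \<and> 1 \<le> v \<and> real_of_int u \<le> B \<and> real_of_int v \<le> B \<and> gcd u v = 1 \<and>
      G u v \<noteq> 0 \<and> \<bar>real_of_int (G u v)\<bar> powr \<epsilon> \<le> (\<Prod>p\<in>P. real p ^ multiplicity (int p) (G u v))})"
proof -
  define \<theta> where "\<theta> = 2 - real n * \<epsilon>"
  have ne: "real n * \<epsilon> < 1" "0 < real n * \<epsilon>" using \<epsilon> by (simp_all add: field_simps)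
  have p1: "1 < real p" if "p \<in> P" for p using prime_gt_1_nat[OF P(3)[OF that]] by simp
  have ln_p: "0 \<le> ln (real p)" if "p \<in> P" for p using ln_gt_zero[OF p1[OF that]] by simp
  obtain p0 where p0: "p0 \<in> P" using P(2) by blast
  define P' where "P' = P - {p0}"
  have P': "finite P'" "P = insert p0 P'" "p0 \<notin> P'" "card P' = card P - 1"
    using P(1) p0 by (auto simp: P'_def)
  define \<Lambda> where "\<Lambda> = (\<Sum>p\<in>P. ln (real p))"
  have \<Lambda>: "\<Lambda> > 0" unfolding \<Lambda>_def using P(1,2) by (intro sum_pos ln_gt_zero p1)
  define R where "R = (\<Prod>p\<in>P. real p)"
  define Q0 where "Q0 = (\<Prod>p\<in>P. real p ^ (kmin + 1))"
  have R: "R > 0" and Q0: "Q0 > 0" unfolding R_def Q0_def using p1 by (fastforce intro!: prod_pos zero_less_power)+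
  \<comment> \<open>The modulus is at most \<open>Q0 * p0 * X\<close>, which equals
    \<open>D * B powr (real n * \<epsilon>)\<close>.\<close>
  define D where "D = Q0 * real p0 * K powr \<epsilon>"
  have D: "D > 0" unfolding D_def using Q0 p1[OF p0] K by simp
  \<comment> \<open>One 4 is the loss in the sieve, the other comes from squaring
    \<open>N >= B / 2\<close>. In \<open>c\<close> below, half of this pays for the error terms, and
    the power comes from \<open>L + 1 >= real n * \<epsilon> * ln B / \<Lambda>\<close>.\<close>
  define c1 where "c1 = 1 / (16 * R * D)"
  have c1: "c1 > 0" unfolding c1_def using R D by simp
  define c where "c = c1 / 2 * (real n * \<epsilon> / \<Lambda>) ^ (card P - 1)"
  have c: "c > 0" unfolding c_def using c1 ne \<Lambda> by simp
  have main: "c * B powr \<theta> * ln B ^ (card P - 1) \<le>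
    real (card {(u, v). 1 \<le> u \<and> 1 \<le> v \<and> real_of_int u \<le> B \<and> real_of_int v \<le> B \<and> gcd u v = 1 \<and>
      G u v \<noteq> 0 \<and> \<bar>real_of_int (G u v)\<bar> powr \<epsilon> \<le> (\<Prod>p\<in>P. real p ^ multiplicity (int p) (G u v))})"
    (is "_ \<le> real (card ?L)")
    if B: "B \<ge> 3" "ln B \<ge> 1" and BD: "D * B powr (real n * \<epsilon>) \<le> B / 2"
      and Be: "3 * B + 2 * B * ln B \<le> c1 / 2 * B powr \<theta>" for B
  proof -
    define X where "X = (K * B ^ n) powr \<epsilon>"
    have KB: "1 \<le> K * B ^ n" using K B(1) mult_mono[of 1 K 1 "B ^ n"] by simp
    then have X1: "X \<ge> 1" unfolding X_def using \<epsilon> by (simp add: ge_one_powr_ge_zero)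
    have XB: "X = K powr \<epsilon> * B powr (real n * \<epsilon>)"
      unfolding X_def using K B(1) by (simp add: powr_mult powr_powr flip: powr_realpow)
    have lnX: "ln X \<ge> real n * \<epsilon> * ln B"
      unfolding XB using K B(1) \<epsilon> by (simp add: ln_mult ln_powr)
    \<comment> \<open>Even with all free exponents equal to \<open>L\<close> the product stays at
      most \<open>X\<close>, which leaves room for the power of \<open>p0\<close>.\<close>
    define L where "L = nat \<lfloor>ln X / \<Lambda>\<rfloor>"
    define N where "N = nat \<lfloor>B\<rfloor>"
    have "real N = of_int \<lfloor>B\<rfloor>" using B(1) by (simp add: N_def)
    then have NB: "real N \<le> B" "B / 2 \<le> real N" using B(1) by linarith+
    define W where "W = PiE P' (\<lambda>_. {..L})"
    have finW: "finite W" unfolding W_def using P'(1) by (intro finite_PiE) auto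
    have LX: "real L * \<Lambda> \<le> ln X"
    proof -
      have "0 \<le> ln X / \<Lambda>" using X1 \<Lambda> by simp
      then have "real L = of_int \<lfloor>ln X / \<Lambda>\<rfloor>" by (simp add: L_def)
      then have "real L \<le> ln X / \<Lambda>" by linarith
      then show ?thesis using \<Lambda> by (simp add: field_simps)
    qed
    have "\<exists>i. X \<le> (\<Prod>p\<in>P'. real p ^ j p) * real p0 ^ i \<and> (\<Prod>p\<in>P'. real p ^ j p) * real p0 ^ i \<le> real p0 * X"
      if j: "j \<in> W" for j
    proof (rule exists_power_between)
      have pp: "0 < real p" if "p \<in> P'" for p using p1[of p] that P'(2) by simp
      show "1 < real p0" using p1 p0 by simp
      show 0: "0 < (\<Prod>p\<in>P'. real p ^ j p)" using pp by (auto intro!: prod_pos)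
      have "ln (\<Prod>p\<in>P'. real p ^ j p) = (\<Sum>p\<in>P'. real (j p) * ln (real p))"
        using P'(1) pp by (subst ln_prod) (auto simp: ln_realpow)
      also have "\<dots> \<le> (\<Sum>p\<in>P'. real L * ln (real p))"
        using j P'(2) by (intro sum_mono mult_right_mono ln_p) (auto simp: W_def PiE_def Pi_def)
      also have "\<dots> \<le> real L * \<Lambda>"
        unfolding \<Lambda>_def sum_distrib_left using P(1) P'(2)
        by (intro sum_mono2 mult_nonneg_nonneg ln_p) auto
      also note LX
      finally show "(\<Prod>p\<in>P'. real p ^ j p) \<le> X" using 0 X1 by simp
    qed
    then obtain i where i: "\<And>j. j \<in> W \<Longrightarrow> X \<le> (\<Prod>p\<in>P'. real p ^ j p) * real p0 ^ i j"
        "\<And>j. j \<in> W \<Longrightarrow> (\<Prod>p\<in>P'. real p ^ j p) * real p0 ^ i j \<le> real p0 * X" by metis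
    \<comment> \<open>The shift by \<open>kmin\<close> brings every exponent into the range where
      lifting is available. It only enlarges the P-part, and enlarges the modulus by a constant
      factor.\<close>
    define m where "m j p = kmin + (if p = p0 then i j else j p)" for j :: "nat \<Rightarrow> nat" and p
    define T where "T j = {(u, v). u \<in> {1..int N} \<and> v \<in> {1..int N} \<and> gcd u v = 1 \<and>
        (\<forall>p\<in>P. int p ^ m j p dvd G u v \<and> \<not> int p ^ (m j p + 1) dvd G u v)}" for j
    have prodm: "(\<Prod>p\<in>P. real p ^ (m j p + r)) = (\<Prod>p\<in>P. real p ^ (kmin + r)) * ((\<Prod>p\<in>P'. real p ^ j p) * real p0 ^ i j)" for j r
    proof -
      have "(\<Prod>p\<in>P. real p ^ (m j p + r)) = (\<Prod>p\<in>P. real p ^ (kmin + r) * real p ^ (if p = p0 then i j else j p))"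
        by (intro prod.cong) (auto simp: m_def power_add)
      also have "\<dots> = (\<Prod>p\<in>P. real p ^ (kmin + r)) * (\<Prod>p\<in>P. real p ^ (if p = p0 then i j else j p))"
        by (rule prod.distrib)
      also have "(\<Prod>p\<in>P. real p ^ (if p = p0 then i j else j p)) = real p0 ^ i j * (\<Prod>p\<in>P'. real p ^ (if p = p0 then i j else j p))"
        unfolding P'(2) using P'(1,3) by simp
      also have "(\<Prod>p\<in>P'. real p ^ (if p = p0 then i j else j p)) = (\<Prod>p\<in>P'. real p ^ j p)"
        using P'(3) by (intro prod.cong) auto
      finally show ?thesis by simp
    qed
    have cardT: "c1 / 2 * B powr \<theta> \<le> real (card (T j))" if j: "j \<in> W" for j
    proof -
      define Q where "Q = (\<Prod>p\<in>P. int p ^ (m j p + 1))"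
      have "real_of_int Q = Q0 * ((\<Prod>p\<in>P'. real p ^ j p) * real p0 ^ i j)"
        unfolding Q_def Q0_def using prodm[of j 1] by simp
      also have "\<dots> \<le> Q0 * (real p0 * X)" using i(2)[OF j] Q0 by (intro mult_left_mono) auto
      also have "\<dots> = D * B powr (real n * \<epsilon>)" by (simp add: D_def XB)
      finally have QD: "real_of_int Q \<le> D * B powr (real n * \<epsilon>)" .
      then have "real_of_int Q \<le> real N" using BD NB by linarith
      then have QN: "Q \<le> int N" by linarith
      have Qpos: "0 < real_of_int Q" unfolding Q_def using p1 P(3) prime_gt_0_nat
        by (auto intro!: prod_pos)
      have "(real N)\<^sup>2 / (4 * real_of_int (\<Prod>p\<in>P. int p) * real_of_int Q) - 3 * real N - 2 * real N * ln (real N)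
         \<le> real (card (T j))"
        unfolding T_def
      proof (rule lattice_class_ge[OF P(1)])
        show "Q = (\<Prod>p\<in>P. int p ^ (m j p + 1))" by (rule Q_def)
        show "Q \<le> int N" by (rule QN)
      qed (use P(3) exact in \<open>auto simp: m_def\<close>)
      moreover have "c1 * B powr \<theta> \<le> (real N)\<^sup>2 / (4 * real_of_int (\<Prod>p\<in>P. int p) * real_of_int Q)"
      proof -
        have "B powr \<theta> = B\<^sup>2 / B powr (real n * \<epsilon>)"
          using B(1) by (simp add: \<theta>_def powr_diff powr_numeral)
        then have "c1 * B powr \<theta> = (B / 2)\<^sup>2 / (4 * R * (D * B powr (real n * \<epsilon>)))"
          by (simp add: c1_def power_divide)
        also have "\<dots> \<le> (real N)\<^sup>2 / (4 * R * real_of_int Q)"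
          using NB B(1) QD Qpos R by (intro frac_le power_mono mult_left_mono mult_pos_pos) auto
        finally show ?thesis by (simp add: R_def)
      qed
      moreover have "3 * real N + 2 * real N * ln (real N) \<le> 3 * B + 2 * B * ln B"
        using NB B(1) by (intro add_mono mult_mono) auto
      ultimately show ?thesis using Be by linarith
    qed
    have "(\<Union>j\<in>W. T j) \<subseteq> ?L"
    proof
      fix z assume "z \<in> (\<Union>j\<in>W. T j)"
      then obtain j where j: "j \<in> W" "z \<in> T j" by blast
      obtain u v where z: "z = (u, v)" by (cases z)
      have uv: "1 \<le> u" "u \<le> int N" "1 \<le> v" "v \<le> int N" "gcd u v = 1"
        "\<And>p. p \<in> P \<Longrightarrow> int p ^ m j p dvd G u v \<and> \<not> int p ^ (m j p + 1) dvd G u v"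
        using j(2) unfolding T_def z by auto
      have mult: "multiplicity (int p) (G u v) = m j p" if "p \<in> P" for p
        using uv(6)[OF that] P(3)[OF that] by (intro multiplicity_exact) auto
      have G0: "G u v \<noteq> 0" using uv(6)[OF p0] by auto
      have uB: "real_of_int u \<le> B" "real_of_int v \<le> B" using uv NB by linarith+
      have "\<bar>real_of_int (G u v)\<bar> powr \<epsilon> \<le> X"
        unfolding X_def using bound[OF uv(1,3) uB] \<epsilon> by (intro powr_mono2) auto
      also have "X \<le> (\<Prod>p\<in>P'. real p ^ j p) * real p0 ^ i j" using i(1) j(1) by blast
      also have "\<dots> \<le> (\<Prod>p\<in>P. real p ^ (kmin + 0)) * ((\<Prod>p\<in>P'. real p ^ j p) * real p0 ^ i j)"
      proof -
        have "1 \<le> (\<Prod>p\<in>P. real p ^ (kmin + 0))" using p1 by (intro prod_ge_1) (simp add: less_imp_le)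
        moreover have "0 \<le> (\<Prod>p\<in>P'. real p ^ j p) * real p0 ^ i j" by (simp add: prod_nonneg)
        ultimately show ?thesis by (simp add: mult_le_cancel_right1)
      qed
      also have "\<dots> = (\<Prod>p\<in>P. real p ^ multiplicity (int p) (G u v))"
        unfolding prodm[symmetric] using mult by (intro prod.cong) auto
      finally show "z \<in> ?L" using uv uB G0 unfolding z by simp
    qed
    moreover have "finite ?L"
      by (rule finite_subset[of _ "{0..\<lfloor>B\<rfloor>} \<times> {0..\<lfloor>B\<rfloor>}"]) (auto simp: le_floor_iff)
    ultimately have "card (\<Union>j\<in>W. T j) \<le> card ?L" by (intro card_mono)
    \<comment> \<open>The exact valuations of the value at (u, v) recover the vector j, so the sets
      are disjoint.\<close>
    moreover have "card (\<Union>j\<in>W. T j) = (\<Sum>j\<in>W. card (T j))"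
    proof (rule card_UN_disjoint[OF finW])
      have "T j \<subseteq> {1..int N} \<times> {1..int N}" for j unfolding T_def by auto
      then show "\<forall>j\<in>W. finite (T j)" by (meson finite_SigmaI finite_atLeastAtMost_int finite_subset)
      show "\<forall>j\<in>W. \<forall>j'\<in>W. j \<noteq> j' \<longrightarrow> T j \<inter> T j' = {}"
      proof (intro ballI impI, rule ccontr)
        fix j j' assume j: "j \<in> W" "j' \<in> W" "j \<noteq> j'" "T j \<inter> T j' \<noteq> {}"
        then obtain u v where uv: "(u, v) \<in> T j" "(u, v) \<in> T j'" by auto
        have "j p = j' p" for p
        proof (cases "p \<in> P'")
          case True
          then have p: "p \<in> P" "p \<noteq> p0" using P'(2,3) by auto
          have "multiplicity (int p) (G u v) = m j p" "multiplicity (int p) (G u v) = m j' p"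
            using uv p P(3)[OF p(1)] unfolding T_def by (auto intro!: multiplicity_exact)
          then show ?thesis using p by (simp add: m_def)
        next
          case False
          then show ?thesis using j(1,2) unfolding W_def by (metis PiE_arb)
        qed
        then show False using j(3) by blast
      qed
    qed
    ultimately have "(\<Sum>j\<in>W. card (T j)) \<le> card ?L" by simp
    then have "(\<Sum>j\<in>W. real (card (T j))) \<le> real (card ?L)"
      unfolding of_nat_sum[symmetric] by (simp only: of_nat_le_iff)
    moreover have "(\<Sum>j\<in>W. c1 / 2 * B powr \<theta>) \<le> (\<Sum>j\<in>W. real (card (T j)))"
      by (intro sum_mono cardT)
    moreover have "(\<Sum>j\<in>W. c1 / 2 * B powr \<theta>) = real (L + 1) ^ (card P - 1) * (c1 / 2 * B powr \<theta>)"
      unfolding W_def using P' by (simp add: card_PiE)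
    moreover have "(real n * \<epsilon> * ln B / \<Lambda>) ^ (card P - 1) * (c1 / 2 * B powr \<theta>)
        \<le> real (L + 1) ^ (card P - 1) * (c1 / 2 * B powr \<theta>)"
    proof (intro mult_right_mono power_mono)
      have "real n * \<epsilon> * ln B / \<Lambda> \<le> ln X / \<Lambda>" using lnX \<Lambda> by (intro divide_right_mono) auto
      also have "\<dots> \<le> real (L + 1)" unfolding L_def by linarith
      finally show "real n * \<epsilon> * ln B / \<Lambda> \<le> real (L + 1)" .
    qed (use c1 ne \<Lambda> B in auto)
    moreover have "c * B powr \<theta> * ln B ^ (card P - 1)
        = (real n * \<epsilon> * ln B / \<Lambda>) ^ (card P - 1) * (c1 / 2 * B powr \<theta>)"
      by (simp add: c_def power_mult_distrib power_divide mult_ac)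
    ultimately show ?thesis by linarith
  qed
  have "\<forall>\<^sub>F B in at_top. B \<ge> 3 \<and> ln B \<ge> 1 \<and> (ln B)\<^sup>2 \<le> B \<and> ln K \<le> ln (B::real)"
    by (rule log_growth_eventually)
  moreover have "\<forall>\<^sub>F B in at_top. D * B powr (real n * \<epsilon>) \<le> B / 2"
    using ne D by real_asymp
  moreover have "\<forall>\<^sub>F B in at_top. 3 * B + 2 * B * ln B \<le> c1 / 2 * B powr \<theta>"
    using ne c1 unfolding \<theta>_def by real_asymp
  ultimately have "\<forall>\<^sub>F B in at_top. c * B powr \<theta> * ln B ^ (card P - 1) \<le>
    real (card {(u, v). 1 \<le> u \<and> 1 \<le> v \<and> real_of_int u \<le> B \<and> real_of_int v \<le> B \<and> gcd u v = 1 \<and>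
      G u v \<noteq> 0 \<and> \<bar>real_of_int (G u v)\<bar> powr \<epsilon> \<le> (\<Prod>p\<in>P. real p ^ multiplicity (int p) (G u v))})"
    by eventually_elim (rule main, auto)
  then show ?thesis using c unfolding \<theta>_def by blast
qed

section \<open>The theorem\<close>

definition zero_primes :: "nat \<Rightarrow> int poly poly \<Rightarrow> nat set \<Rightarrow> nat set" where
  "zero_primes n F S = {p \<in> S. \<exists>(x, y) \<in> Z2_prim.
     [eval2 F x y = 0] (mod int p ^ (multiplicity (int p) (form_disc n F) + 1))}"

lemma real_S_part: "real (S_part S m) = (\<Prod>p\<in>S. real p ^ multiplicity (int p) m)"
  by (simp add: S_part_def)

text \<open>A point is counted in the chart in which its second coordinate is the larger one in
  absolute value; the other chart exchanges the variables, under which the separation only changes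
  sign.\<close>

lemma N_count_upper:
  assumes n: "n \<ge> 2" and F: "binary_form n F" "form_disc n F \<noteq> 0"
    and \<epsilon>: "0 < \<epsilon>" "\<epsilon> < 1 / real n" and S: "finite S" "\<forall>p\<in>S. prime p"
    and ne: "zero_primes n F S \<noteq> {}"
  shows "\<exists>C > 0. \<forall>\<^sub>F B in at_top.
    real (N_count F S \<epsilon> B) \<le> C * B powr (2 - real n * \<epsilon>) * ln B ^ (card (zero_primes n F S) - 1)"
proof -
  define P where "P = zero_primes n F S"
  define g where "g p = multiplicity (int p) (form_disc n F)" for p :: nat
  define \<kappa> where "\<kappa> = (\<Prod>p\<in>S - P. real p ^ g p)"
  have hom: "homogeneous n F" using F by (auto simp: binary_form_def homogeneous_def)
  have P: "finite P" "P \<noteq> {}" "P \<subseteq> S" using S ne by (auto simp: P_def zero_primes_def)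
  have prime: "prime p" if "p \<in> P" for p using that S P by auto
  have \<kappa>: "\<kappa> > 0" unfolding \<kappa>_def using S prime_gt_0_nat by (intro prod_pos) auto
  have sep: "int p ^ (k - g p) dvd x * y' - x' * y"
    if "p \<in> P" "gcd x y = 1" "gcd x' y' = 1" "[x = x'] (mod int p ^ (g p + 1))" "[y = y'] (mod int p ^ (g p + 1))"
      "int p ^ k dvd eval2 F x y" "int p ^ k dvd eval2 F x' y'" for p k x y x' y'
    using form_separation[OF n F _ g_def that(2-7)] prime[OF that(1)] by simp
  have sep': "int p ^ (k - g p) dvd x * y' - x' * y"
    if "p \<in> P" "gcd x y = 1" "gcd x' y' = 1" "[x = x'] (mod int p ^ (g p + 1))" "[y = y'] (mod int p ^ (g p + 1))"
      "int p ^ k dvd eval2 F y x" "int p ^ k dvd eval2 F y' x'" for p k x y x' y'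
  proof -
    have "int p ^ (k - g p) dvd y * x' - y' * x"
      using sep[OF that(1) _ _ that(5,4,6,7)] that(2,3) by (simp add: gcd.commute)
    then have "int p ^ (k - g p) dvd - (y * x' - y' * x)" by (simp only: dvd_minus_iff)
    then show ?thesis by (simp add: mult.commute)
  qed
  obtain K where K: "K \<ge> 1" "\<forall>x y B. \<bar>real_of_int x\<bar> \<le> B \<longrightarrow> \<bar>real_of_int y\<bar> \<le> B \<longrightarrow>
    \<bar>real_of_int (eval2 F x y)\<bar> \<le> K * B ^ n" using form_bound[OF hom] by blast
  have abs_le: "\<bar>real_of_int x\<bar> \<le> \<bar>real_of_int y\<bar>" if "\<bar>x\<bar> \<le> \<bar>y\<bar>" for x y
    using that by (metis of_int_abs of_int_le_iff)
  have bound: "\<bar>real_of_int (eval2 F x y)\<bar> \<le> K * \<bar>real_of_int y\<bar> ^ n"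
    and bound': "\<bar>real_of_int (eval2 F y x)\<bar> \<le> K * \<bar>real_of_int y\<bar> ^ n" if "\<bar>x\<bar> \<le> \<bar>y\<bar>" for x y
    using K(2) abs_le[OF that] by blast+
  obtain D1 c1 where D1: "D1 > 0" "\<forall>x y. y \<noteq> 0 \<longrightarrow> \<bar>x\<bar> \<le> \<bar>y\<bar> \<longrightarrow>
      (\<exists>i<n. \<bar>real_of_int x / real_of_int y - c1 i\<bar> \<le> D1 * \<bar>real_of_int (eval2 F x y)\<bar> / \<bar>real_of_int y\<bar> ^ n)"
    using form_cover(1)[OF n F] by blast
  obtain D2 c2 where D2: "D2 > 0" "\<forall>x y. y \<noteq> 0 \<longrightarrow> \<bar>x\<bar> \<le> \<bar>y\<bar> \<longrightarrow>
      (\<exists>i<n. \<bar>real_of_int x / real_of_int y - c2 i\<bar> \<le> D2 * \<bar>real_of_int (eval2 F y x)\<bar> / \<bar>real_of_int y\<bar> ^ n)"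
    using form_cover(2)[OF n F] by blast
  define N1 where "N1 B = {(x, y). gcd x y = 1 \<and> \<bar>x\<bar> \<le> \<bar>y\<bar> \<and> real_of_int \<bar>y\<bar> \<le> B \<and> eval2 F x y \<noteq> 0 \<and>
      \<bar>real_of_int (eval2 F x y)\<bar> powr \<epsilon> \<le> \<kappa> * (\<Prod>p\<in>P. real p ^ multiplicity (int p) (eval2 F x y))}" for B
  define N2 where "N2 B = {(x, y). gcd x y = 1 \<and> \<bar>x\<bar> \<le> \<bar>y\<bar> \<and> real_of_int \<bar>y\<bar> \<le> B \<and> eval2 F y x \<noteq> 0 \<and>
      \<bar>real_of_int (eval2 F y x)\<bar> powr \<epsilon> \<le> \<kappa> * (\<Prod>p\<in>P. real p ^ multiplicity (int p) (eval2 F y x))}" for B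
  have "\<exists>C > 0. \<forall>\<^sub>F B in at_top. real (card (N1 B)) \<le> C * B powr (2 - real n * \<epsilon>) * ln B ^ (card P - 1)"
    unfolding N1_def
    by (rule primitive_count_upper[where \<Phi> = "\<lambda>x y. eval2 F x y" and g = g and c = c1 and D = D1 and K = K])
      (rule P(1), rule P(2), erule prime, rule sep, assumption+, rule D1(2)[rule_format], assumption+,
       rule bound, assumption, rule K(1), rule D1(1), rule \<kappa>, rule \<epsilon>(1), rule \<epsilon>(2), rule n)
  then obtain C1 where C1: "C1 > 0" "\<forall>\<^sub>F B in at_top. real (card (N1 B)) \<le> C1 * B powr (2 - real n * \<epsilon>) * ln B ^ (card P - 1)"
    by blast
  have "\<exists>C > 0. \<forall>\<^sub>F B in at_top. real (card (N2 B)) \<le> C * B powr (2 - real n * \<epsilon>) * ln B ^ (card P - 1)"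
    unfolding N2_def
    by (rule primitive_count_upper[where \<Phi> = "\<lambda>x y. eval2 F y x" and g = g and c = c2 and D = D2 and K = K])
      (rule P(1), rule P(2), erule prime, rule sep', assumption+, rule D2(2)[rule_format], assumption+,
       rule bound', assumption, rule K(1), rule D2(1), rule \<kappa>, rule \<epsilon>(1), rule \<epsilon>(2), rule n)
  then obtain C2 where C2: "C2 > 0" "\<forall>\<^sub>F B in at_top. real (card (N2 B)) \<le> C2 * B powr (2 - real n * \<epsilon>) * ln B ^ (card P - 1)"
    by blast
  have fin: "finite (N1 B)" "finite (N2 B)" for B
  proof -
    define Q where "Q = {z :: int \<times> int. \<bar>fst z\<bar> \<le> \<bar>snd z\<bar> \<and> real_of_int \<bar>snd z\<bar> \<le> B}"
    have "Q \<subseteq> {-\<lfloor>B\<rfloor>..\<lfloor>B\<rfloor>} \<times> {-\<lfloor>B\<rfloor>..\<lfloor>B\<rfloor>}"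
      unfolding Q_def le_floor_iff[symmetric] by auto
    then have "finite Q" by (rule finite_subset) auto
    moreover have "N1 B \<subseteq> Q" unfolding N1_def Q_def by clarsimp
    moreover have "N2 B \<subseteq> Q" unfolding N2_def Q_def by clarsimp
    ultimately show "finite (N1 B)" "finite (N2 B)" by (simp_all add: finite_subset)
  qed
  have count: "real (N_count F S \<epsilon> B) \<le> real (card (N1 B)) + real (card (N2 B))" for B
  proof -
    have kap: "\<bar>real_of_int (eval2 F x y)\<bar> powr \<epsilon> \<le> \<kappa> * (\<Prod>p\<in>P. real p ^ multiplicity (int p) (eval2 F x y))"
      if xy: "gcd x y = 1" "eval2 F x y \<noteq> 0"
        "real (S_part S (eval2 F x y)) \<ge> real_of_int \<bar>eval2 F x y\<bar> powr \<epsilon>" for x y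
    proof -
      have "\<bar>real_of_int (eval2 F x y)\<bar> powr \<epsilon> \<le> (\<Prod>p\<in>S. real p ^ multiplicity (int p) (eval2 F x y))"
        using xy(3) by (simp add: real_S_part)
      also have "\<dots> = (\<Prod>p\<in>S - P. real p ^ multiplicity (int p) (eval2 F x y)) * (\<Prod>p\<in>P. real p ^ multiplicity (int p) (eval2 F x y))"
        using S(1) P(3) by (rule prod.subset_diff[rotated])
      also have "\<dots> \<le> \<kappa> * (\<Prod>p\<in>P. real p ^ multiplicity (int p) (eval2 F x y))"
        unfolding \<kappa>_def
      proof (intro mult_right_mono prod_mono conjI)
        fix p assume p: "p \<in> S - P"
        have pr: "prime p" using p S by auto
        \<comment> \<open>A prime of S outside P has no primitive zero modulo
          \<open>p ^ (g p + 1)\<close>, so its multiplicity is at most \<open>g p\<close> at every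
          primitive point; \<open>\<kappa>\<close> is the product of these maximal powers.\<close>
        have "\<not> [eval2 F x y = 0] (mod int p ^ (g p + 1))"
        proof
          assume "[eval2 F x y = 0] (mod int p ^ (g p + 1))"
          moreover have "(x, y) \<in> Z2_prim" using xy(1) by (simp add: Z2_prim_def)
          ultimately have "p \<in> P" using p unfolding P_def zero_primes_def g_def by (auto intro!: bexI[of _ "(x, y)"])
          then show False using p by simp
        qed
        then have "\<not> int p ^ (g p + 1) dvd eval2 F x y" by (simp add: cong_0_iff)
        then have "multiplicity (int p) (eval2 F x y) \<le> g p"
          using multiplicity_dvd'[of "g p + 1" "int p" "eval2 F x y"] by linarith
        then show "real p ^ multiplicity (int p) (eval2 F x y) \<le> real p ^ g p"
          using prime_ge_1_nat[OF pr] by (intro power_increasing) auto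
      qed (auto intro!: prod_nonneg)
      finally show ?thesis .
    qed
    have "{(x, y) \<in> Z2_prim. real_of_int (max \<bar>x\<bar> \<bar>y\<bar>) \<le> B \<and> eval2 F x y \<noteq> 0 \<and>
       real (S_part S (eval2 F x y)) \<ge> real_of_int \<bar>eval2 F x y\<bar> powr \<epsilon>} \<subseteq> N1 B \<union> prod.swap ` N2 B"
    proof
      fix z assume z: "z \<in> {(x, y) \<in> Z2_prim. real_of_int (max \<bar>x\<bar> \<bar>y\<bar>) \<le> B \<and> eval2 F x y \<noteq> 0 \<and>
         real (S_part S (eval2 F x y)) \<ge> real_of_int \<bar>eval2 F x y\<bar> powr \<epsilon>}"
      obtain x y where xy: "z = (x, y)" by (cases z)
      have h: "gcd x y = 1" "real_of_int (max \<bar>x\<bar> \<bar>y\<bar>) \<le> B" "eval2 F x y \<noteq> 0"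
         "real (S_part S (eval2 F x y)) \<ge> real_of_int \<bar>eval2 F x y\<bar> powr \<epsilon>"
        using z unfolding xy Z2_prim_def by auto
      note k = kap[OF h(1,3,4)]
      show "z \<in> N1 B \<union> prod.swap ` N2 B"
      proof (cases "\<bar>x\<bar> \<le> \<bar>y\<bar>")
        case True
        then have "(x, y) \<in> N1 B" unfolding N1_def using h k by (simp add: max_def)
        then show ?thesis using xy by simp
      next
        case False
        then have "(y, x) \<in> N2 B" unfolding N2_def using h k by (simp add: max_def gcd.commute)
        then have "prod.swap (y, x) \<in> prod.swap ` N2 B" by (rule imageI)
        then show ?thesis using xy by simp
      qed
    qed
    then have "N_count F S \<epsilon> B \<le> card (N1 B \<union> prod.swap ` N2 B)"
      unfolding N_count_def using fin by (intro card_mono) auto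
    also have "\<dots> \<le> card (N1 B) + card (prod.swap ` N2 B)" by (rule card_Un_le)
    also have "card (prod.swap ` N2 B) \<le> card (N2 B)" using fin by (intro card_image_le) auto
    finally show ?thesis by linarith
  qed
  have "\<forall>\<^sub>F B in at_top. real (N_count F S \<epsilon> B) \<le> (C1 + C2) * B powr (2 - real n * \<epsilon>) * ln B ^ (card P - 1)"
    using C1(2) C2(2)
  proof eventually_elim
    case (elim B)
    then show ?case using count[of B] by (simp add: algebra_simps)
  qed
  then show ?thesis using C1(1) C2(1) unfolding P_def by (intro exI[of _ "C1 + C2"]) auto
qed

text \<open>Combine the local zeros by the Chinese remainder theorem and divide by the gcd.\<close>

lemma common_local_zero:
  fixes g :: "nat \<Rightarrow> nat"
  assumes hom: "homogeneous n F" and P: "finite P" "P \<noteq> {}" "\<And>p. p \<in> P \<Longrightarrow> prime p"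
    and zero: "\<And>p. p \<in> P \<Longrightarrow> \<exists>x y. gcd x y = 1 \<and> int p ^ (g p + 1) dvd eval2 F x y"
  shows "\<exists>x y. gcd x y = 1 \<and> (\<forall>p\<in>P. int p ^ (g p + 1) dvd eval2 F x y)"
proof -
  obtain a b where ab: "\<And>p. p \<in> P \<Longrightarrow> gcd (a p) (b p) = 1"
    "\<And>p. p \<in> P \<Longrightarrow> int p ^ (g p + 1) dvd eval2 F (a p) (b p)" using zero by metis
  have "\<exists>x. \<forall>p\<in>P. [x = a p] (mod int p ^ (g p + 1))" "\<exists>y. \<forall>p\<in>P. [y = b p] (mod int p ^ (g p + 1))"
    using P by (intro crt_int; blast)+
  then obtain x y where xy: "\<And>p. p \<in> P \<Longrightarrow> [x = a p] (mod int p ^ (g p + 1))"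
    "\<And>p. p \<in> P \<Longrightarrow> [y = b p] (mod int p ^ (g p + 1))" by blast
  define d where "d = gcd x y"
  \<comment> \<open>As (a p, b p) is primitive, the common divisor is a unit at each p in P, and by
    homogeneity removing it divides the value by the unit \<open>d ^ n\<close>.\<close>
  have pd: "\<not> int p dvd d" if p: "p \<in> P" for p
  proof
    assume "int p dvd d"
    then have "int p dvd x" "int p dvd y" unfolding d_def by auto
    moreover have "[x = a p] (mod int p)" "[y = b p] (mod int p)"
      using xy[OF p] by (auto elim: cong_dvd_mono_modulus)
    ultimately have "int p dvd a p" "int p dvd b p" by (auto simp: cong_dvd_iff)
    then have "int p dvd gcd (a p) (b p)" by (rule gcd_greatest)
    then show False using ab(1)[OF p] P(3)[OF p] by auto
  qed
  then have d0: "d \<noteq> 0" using P(2) by auto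
  obtain x0 y0 where x0: "x = d * x0" "y = d * y0" unfolding d_def by (meson gcd_dvd1 gcd_dvd2 dvdE)
  have "d * gcd x0 y0 = \<bar>d\<bar> * gcd x0 y0" by (simp add: d_def)
  also have "\<dots> = gcd (d * x0) (d * y0)" by (rule gcd_mult_distrib_int)
  also have "\<dots> = d" unfolding x0[symmetric] by (simp only: d_def)
  finally have "gcd x0 y0 = 1" using d0 by simp
  moreover have "int p ^ (g p + 1) dvd eval2 F x0 y0" if p: "p \<in> P" for p
  proof -
    have "[eval2 F x y = eval2 F (a p) (b p)] (mod int p ^ (g p + 1))"
      by (rule cong_eval2[OF hom xy(1)[OF p] xy(2)[OF p]])
    then have "int p ^ (g p + 1) dvd d ^ n * eval2 F x0 y0"
      using ab(2)[OF p] unfolding x0 eval2_scale[OF hom] by (simp add: cong_dvd_iff)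
    moreover have "coprime (int p ^ (g p + 1)) (d ^ n)"
      using pd[OF p] P(3)[OF p] by (simp add: prime_imp_coprime)
    ultimately show ?thesis by (simp only: coprime_dvd_mult_right_iff)
  qed
  ultimately show ?thesis by (intro exI[of _ x0] exI[of _ y0]) simp
qed

text \<open>A common primitive zero lets a single unimodular basis serve all primes of P at once.
  \<open>G\<close> is F in this basis; the basis change preserves primitivity and maps the box of
  size B into the one of size \<open>A * B\<close>.\<close>

lemma N_count_lower:
  assumes n: "n \<ge> 2" and F: "binary_form n F" "form_disc n F \<noteq> 0"
    and \<epsilon>: "0 < \<epsilon>" "\<epsilon> < 1 / real n" and S: "finite S" "\<forall>p\<in>S. prime p"
    and ne: "zero_primes n F S \<noteq> {}"
  shows "\<exists>c > 0. \<forall>\<^sub>F B in at_top.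
    c * B powr (2 - real n * \<epsilon>) * ln B ^ (card (zero_primes n F S) - 1) \<le> real (N_count F S \<epsilon> B)"
proof -
  define P where "P = zero_primes n F S"
  have n1: "n \<ge> 1" using n by simp
  define s where "s = card P - 1"
  define \<theta> where "\<theta> = 2 - real n * \<epsilon>"
  define g where "g p = multiplicity (int p) (form_disc n F)" for p :: nat
  have hom: "homogeneous n F" using F by (auto simp: binary_form_def homogeneous_def)
  have P: "finite P" "P \<noteq> {}" "P \<subseteq> S" using S ne by (auto simp: P_def zero_primes_def)
  have prime: "prime p" if "p \<in> P" for p using that S P by auto
  have "\<exists>x y. gcd x y = 1 \<and> (\<forall>p\<in>P. int p ^ (g p + 1) dvd eval2 F x y)"
  proof (rule common_local_zero[OF hom P(1,2)])
    show "\<exists>x y. gcd x y = 1 \<and> int p ^ (g p + 1) dvd eval2 F x y" if "p \<in> P" for p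
      using that unfolding P_def zero_primes_def Z2_prim_def g_def by (auto simp: cong_0_iff)
  qed (rule prime)
  then obtain x y where xy: "gcd x y = 1" and zero: "\<forall>p\<in>P. int p ^ (g p + 1) dvd eval2 F x y" by metis
  obtain x1 y1 and b :: "nat \<Rightarrow> int" where det: "x * y1 - x1 * y = 1"
    and ex: "\<forall>u v. eval2 F (u * x + v * x1) (u * y + v * y1) = (\<Sum>k\<le>n. b k * v ^ k * u ^ (n - k))"
    and b1: "\<forall>p. prime p \<longrightarrow> p ^ (multiplicity p (form_disc n F) + 1) dvd b 0
       \<longrightarrow> b 1 \<noteq> 0 \<and> 2 * multiplicity p (b 1) \<le> multiplicity p (form_disc n F)"
    using unimodular_expansion[OF n F xy] by blast
  have "eval2 F x y = (\<Sum>k\<le>n. b k * 0 ^ k * 1 ^ (n - k))" using ex[rule_format, of 1 0] by simp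
  also have "\<dots> = (\<Sum>k\<le>n. if k = 0 then b 0 else 0)" by (intro sum.cong) auto
  finally have b0: "b 0 = eval2 F x y" by simp
  define G where "G u v = eval2 F (u * x + v * x1) (u * y + v * y1)" for u v
  \<comment> \<open>A sum instead of a maximum: it is at least \<open>g p + 1\<close> for every p in
    P.\<close>
  define k0 where "k0 = (\<Sum>p\<in>P. g p + 1)"
  define A where "A = real_of_int (\<bar>x\<bar> + \<bar>x1\<bar> + \<bar>y\<bar> + \<bar>y1\<bar>)"
  have A1: "A \<ge> 1"
  proof -
    have "x \<noteq> 0 \<or> y \<noteq> 0" using det by auto
    then show ?thesis unfolding A_def by linarith
  qed
  have box: "\<bar>real_of_int (u * x + v * x1)\<bar> \<le> A * B" "\<bar>real_of_int (u * y + v * y1)\<bar> \<le> A * B"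
    if uv: "1 \<le> u" "1 \<le> v" "real_of_int u \<le> B" "real_of_int v \<le> B" for u v B
  proof -
    have "\<bar>real_of_int (u * w + v * w')\<bar> \<le> (\<bar>real_of_int w\<bar> + \<bar>real_of_int w'\<bar>) * B" for w w'
    proof -
      have "\<bar>real_of_int (u * w + v * w')\<bar> \<le> real_of_int u * \<bar>real_of_int w\<bar> + real_of_int v * \<bar>real_of_int w'\<bar>"
        using uv by (simp add: abs_mult order_trans[OF abs_triangle_ineq])
      also have "\<dots> \<le> B * \<bar>real_of_int w\<bar> + B * \<bar>real_of_int w'\<bar>"
        using uv by (intro add_mono mult_right_mono) auto
      finally show ?thesis by (simp add: algebra_simps)
    qed
    moreover have "(\<bar>real_of_int x\<bar> + \<bar>real_of_int x1\<bar>) * B \<le> A * B" "(\<bar>real_of_int y\<bar> + \<bar>real_of_int y1\<bar>) * B \<le> A * B"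
      using uv by (auto simp: A_def intro!: mult_right_mono)
    ultimately show "\<bar>real_of_int (u * x + v * x1)\<bar> \<le> A * B" "\<bar>real_of_int (u * y + v * y1)\<bar> \<le> A * B"
      by (meson order_trans)+
  qed
  obtain K where K: "K \<ge> 1" "\<forall>x y B. \<bar>real_of_int x\<bar> \<le> B \<longrightarrow> \<bar>real_of_int y\<bar> \<le> B \<longrightarrow>
    \<bar>real_of_int (eval2 F x y)\<bar> \<le> K * B ^ n" using form_bound[OF hom] by blast
  define L where "L B = {(u, v). 1 \<le> u \<and> 1 \<le> v \<and> real_of_int u \<le> B \<and> real_of_int v \<le> B \<and> gcd u v = 1 \<and>
      G u v \<noteq> 0 \<and> \<bar>real_of_int (G u v)\<bar> powr \<epsilon> \<le> (\<Prod>p\<in>P. real p ^ multiplicity (int p) (G u v))}" for B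
  have exact: "\<exists>t. \<forall>u v. \<not> int p dvd u \<longrightarrow> [v = t * u] (mod int p ^ (m + 1)) \<longrightarrow>
      int p ^ m dvd G u v \<and> \<not> int p ^ (m + 1) dvd G u v" if p: "p \<in> P" and m: "k0 \<le> m" for p m
  proof -
    have pr: "prime (int p)" using prime[OF p] by simp
    have z: "int p ^ (g p + 1) dvd b 0" using zero p b0 by simp
    then have "b 1 \<noteq> 0" "2 * multiplicity (int p) (b 1) \<le> g p" using b1 pr by (auto simp: g_def)
    moreover have "g p + 1 \<le> k0" unfolding k0_def using p P(1) by (intro member_le_sum) auto
    ultimately show ?thesis
      unfolding G_def ex[rule_format] using pr z m n by (intro hensel_form) auto
  qed
  have boundG: "\<bar>real_of_int (G u v)\<bar> \<le> K * A ^ n * B ^ n"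
    if "1 \<le> u" "1 \<le> v" "real_of_int u \<le> B" "real_of_int v \<le> B" for u v B
    using K(2)[rule_format, OF box[OF that]] by (simp add: G_def power_mult_distrib)
  have KA: "1 \<le> K * A ^ n" using K(1) A1 mult_mono[of 1 K 1 "A ^ n"] by simp
  have lower: "\<exists>c > 0. \<forall>\<^sub>F B in at_top. c * B powr \<theta> * ln B ^ s \<le> real (card (L B))"
    unfolding L_def \<theta>_def s_def
  proof (rule primitive_count_lower[where G = G and P = P and kmin = k0 and n = n and \<epsilon> = \<epsilon> and K = "K * A ^ n"])
    fix p assume "p \<in> P"
    then show "prime p" by (rule prime)
  next
    fix p m assume "p \<in> P" "k0 \<le> m"
    then show "\<exists>t. \<forall>u v. \<not> int p dvd u \<longrightarrow> [v = t * u] (mod int p ^ (m + 1)) \<longrightarrow>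
        int p ^ m dvd G u v \<and> \<not> int p ^ (m + 1) dvd G u v" by (rule exact)
  next
    fix u v B assume "1 \<le> u" "1 \<le> v" "real_of_int u \<le> B" "real_of_int v \<le> B"
    then show "\<bar>real_of_int (G u v)\<bar> \<le> K * A ^ n * B ^ n" by (rule boundG)
  qed (fact P(1) P(2) KA \<epsilon>(1) \<epsilon>(2) n1)+
  obtain c where c: "c > 0" "\<forall>\<^sub>F B in at_top. c * B powr \<theta> * ln B ^ s \<le> real (card (L B))"
    using lower by blast
  have count: "real (card (L B)) \<le> real (N_count F S \<epsilon> (A * B))" for B
  proof -
    define f where "f = (\<lambda>(u, v). (u * x + v * x1, u * y + v * y1))"
    \<comment> \<open>Cramer's rule with determinant 1, used for injectivity and for primitivity of
      the image.\<close>
    have rec: "u = (u * x + v * x1) * y1 - (u * y + v * y1) * x1" "v = (u * y + v * y1) * x - (u * x + v * x1) * y" for u v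
    proof -
      have "(u * x + v * x1) * y1 - (u * y + v * y1) * x1 = u * (x * y1 - x1 * y)"
        "(u * y + v * y1) * x - (u * x + v * x1) * y = v * (x * y1 - x1 * y)" by (simp_all add: algebra_simps)
      then show "u = (u * x + v * x1) * y1 - (u * y + v * y1) * x1" "v = (u * y + v * y1) * x - (u * x + v * x1) * y"
        using det by simp_all
    qed
    have "inj_on f (L B)"
    proof (rule inj_onI)
      fix z z' assume "f z = f z'"
      moreover obtain u v u' v' where z: "z = (u, v)" "z' = (u', v')" by (cases z, cases z')
      ultimately have e: "u * x + v * x1 = u' * x + v' * x1" "u * y + v * y1 = u' * y + v' * y1" by (auto simp: f_def)
      have "u = u'" using rec(1)[of u v] rec(1)[of u' v'] unfolding e by (rule trans[OF _ sym])
      moreover have "v = v'" using rec(2)[of v u] rec(2)[of v' u'] unfolding e by (rule trans[OF _ sym])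
      ultimately show "z = z'" unfolding z by simp
    qed
    moreover have "f ` L B \<subseteq> {(x, y) \<in> Z2_prim. real_of_int (max \<bar>x\<bar> \<bar>y\<bar>) \<le> A * B \<and> eval2 F x y \<noteq> 0 \<and>
       real (S_part S (eval2 F x y)) \<ge> real_of_int \<bar>eval2 F x y\<bar> powr \<epsilon>}" (is "_ \<subseteq> ?N")
    proof
      fix w assume "w \<in> f ` L B"
      then obtain u v where w: "w = (u * x + v * x1, u * y + v * y1)" and uv: "(u, v) \<in> L B" by (auto simp: f_def)
      have h: "1 \<le> u" "1 \<le> v" "real_of_int u \<le> B" "real_of_int v \<le> B" "gcd u v = 1" "G u v \<noteq> 0"
        "\<bar>real_of_int (G u v)\<bar> powr \<epsilon> \<le> (\<Prod>p\<in>P. real p ^ multiplicity (int p) (G u v))"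
        using uv unfolding L_def mem_Collect_eq prod.case by blast+
      define d where "d = gcd (u * x + v * x1) (u * y + v * y1)"
      have d: "d dvd u * x + v * x1" "d dvd u * y + v * y1" by (auto simp: d_def)
      have "d dvd (u * x + v * x1) * y1 - (u * y + v * y1) * x1" by (intro dvd_diff dvd_mult2 d)
      moreover have "d dvd (u * y + v * y1) * x - (u * x + v * x1) * y" by (intro dvd_diff dvd_mult2 d)
      ultimately have "d dvd u" "d dvd v" by (simp_all only: rec[symmetric])
      then have "d dvd gcd u v" by (rule gcd_greatest)
      then have "d = 1" using h(5) by (simp add: d_def)
      moreover have "(\<Prod>p\<in>P. real p ^ multiplicity (int p) (G u v)) \<le> real (S_part S (G u v))"
      proof -
        have "(\<Prod>p\<in>P. real p ^ multiplicity (int p) (G u v)) \<le> (\<Prod>p\<in>S. real p ^ multiplicity (int p) (G u v))"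
        proof (rule prod_mono2[OF S(1) P(3)])
          show "1 \<le> real p ^ multiplicity (int p) (G u v)" if "p \<in> S - P" for p
            using that S(2) prime_ge_1_nat by (intro one_le_power) auto
        qed simp
        then show ?thesis by (simp add: real_S_part)
      qed
      moreover have "real_of_int (max \<bar>u * x + v * x1\<bar> \<bar>u * y + v * y1\<bar>) \<le> A * B"
        using box[OF h(1-4)] by (simp only: max_def of_int_abs split: if_splits) simp
      ultimately show "w \<in> ?N"
        using h(6,7) unfolding w d_def G_def by (simp add: Z2_prim_def)
    qed
    moreover have "finite ?N"
    proof (rule finite_subset)
      show "?N \<subseteq> {-\<lfloor>A * B\<rfloor>..\<lfloor>A * B\<rfloor>} \<times> {-\<lfloor>A * B\<rfloor>..\<lfloor>A * B\<rfloor>}"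
        unfolding le_floor_iff[symmetric] by auto
    qed auto
    ultimately have "card (L B) \<le> card ?N" by (intro card_inj_on_le)
    then show ?thesis unfolding N_count_def by simp
  qed
  \<comment> \<open>The count is applied at B / A: \<open>A powr \<theta>\<close> comes from the
    main power, and \<open>2 ^ s\<close> from \<open>ln (B / A) >= ln B / 2\<close> for large
    B.\<close>
  define c' where "c' = c / (A powr \<theta> * 2 ^ s)"
  have A0: "A > 0" using A1 by simp
  have c': "c' > 0" unfolding c'_def using c(1) A0 by simp
  have "filterlim (\<lambda>B. B / A) at_top at_top" using A0 by real_asymp
  then have "\<forall>\<^sub>F B in at_top. c * (B / A) powr \<theta> * ln (B / A) ^ s \<le> real (card (L (B / A)))"
    using c(2) by (rule eventually_compose_filterlim[rotated])
  moreover have "\<forall>\<^sub>F B in at_top. B > 0 \<and> ln B \<ge> (0::real)"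
    using eventually_conj[OF eventually_gt_at_top[of 0] log_growth_eventually[of 1]] by eventually_elim auto
  moreover have "\<forall>\<^sub>F B in at_top. ln B / 2 \<le> ln (B / A)" using A0 by real_asymp
  ultimately have "\<forall>\<^sub>F B in at_top. c' * B powr \<theta> * ln B ^ s \<le> real (N_count F S \<epsilon> B)"
  proof eventually_elim
    case (elim B)
    have "c' * B powr \<theta> * ln B ^ s = c * (B / A) powr \<theta> * (ln B / 2) ^ s"
      using elim A0 by (simp add: c'_def powr_divide power_divide)
    also have "\<dots> \<le> c * (B / A) powr \<theta> * ln (B / A) ^ s"
      using elim c(1) by (intro mult_left_mono power_mono) auto
    also have "\<dots> \<le> real (card (L (B / A)))" using elim by blast
    also have "\<dots> \<le> real (N_count F S \<epsilon> (A * (B / A)))" by (rule count)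
    also have "A * (B / A) = B" using A0 by simp
    finally show ?case .
  qed
  then show ?thesis using c' unfolding \<theta>_def s_def P_def by blast
qed

theorem theorem2p6:
  fixes F :: "int poly poly" and n :: nat and S :: "nat set" and \<epsilon> :: real
  assumes "n \<ge> 3" and "binary_form n F" and "form_disc n F \<noteq> 0"
    and "0 < \<epsilon>" and "\<epsilon> < 1 / real n"
    and "finite S" and "\<forall>p\<in>S. prime p"
    and "s_prime n F S > 0"
  shows "\<exists>c C :: real. 0 < c \<and> c < C \<and>
    (\<forall>\<^sub>F B in at_top.
      c * B powr (2 - real n * \<epsilon>) * ln B ^ (s_prime n F S - 1) \<le> real (N_count F S \<epsilon> B) \<and>
      real (N_count F S \<epsilon> B) \<le> C * B powr (2 - real n * \<epsilon>) * ln B ^ (s_prime n F S - 1))"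
proof -
  have s: "s_prime n F S = card (zero_primes n F S)" by (simp add: s_prime_def zero_primes_def)
  have n: "n \<ge> 2" and ne: "zero_primes n F S \<noteq> {}" using assms(1,8) s by auto
  define h where "h B = B powr (2 - real n * \<epsilon>) * ln B ^ (s_prime n F S - 1)" for B
  obtain c where c: "c > 0" "\<forall>\<^sub>F B in at_top. c * h B \<le> real (N_count F S \<epsilon> B)"
    using N_count_lower[OF n assms(2-7) ne] unfolding h_def s by (auto simp: mult.assoc)
  obtain C where C: "C > 0" "\<forall>\<^sub>F B in at_top. real (N_count F S \<epsilon> B) \<le> C * h B"
    using N_count_upper[OF n assms(2-7) ne] unfolding h_def s by (auto simp: mult.assoc)
  \<comment> \<open>Taking \<open>C + c\<close> as the upper constant makes the inequality between
    the constants strict.\<close>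
  have "\<forall>\<^sub>F B in at_top. c * h B \<le> real (N_count F S \<epsilon> B) \<and> real (N_count F S \<epsilon> B) \<le> (C + c) * h B"
    using c(2) C(2) log_growth_eventually[of 1]
  proof eventually_elim
    case (elim B)
    then have "0 \<le> c * h B" using c(1) by (simp add: h_def)
    then show ?case using elim by (simp add: algebra_simps)
  qed
  then show ?thesis using c(1) C(1) unfolding h_def
    by (intro exI[of _ c] exI[of _ "C + c"]) (simp add: mult.assoc)
qed

end
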